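(* Let $N\ge2$. There exist $\beta>0$ and a constant $K=K(\beta)>0$, independent of $u$ and $\lambda$, such that for every nonzero $u\in W^{1,2}(\mathbb{H}^{N})$ with $\int_{\mathbb{H}^{N}}\rho^{2}(x)|u|^{2}dV_{\mathbb{H}}<\infty$, $$\begin{aligned}&\delta_{1,\mathbb{H}}(u)\mathbf{1}_{\mathcal{A}_{\beta}}(u)+\tilde{\delta}_{1,\mathbb{H}}(u)\mathbf{1}_{\overline{\mathcal{A}_{\beta}}}(u)\\&\geq K\inf_{c,\lambda}\int_{\mathbb{H}^{N}}\left|u-ce^{-\frac{\rho^{2}(x)}{2\lambda^{2}}}\mathbf{1}_{\mathcal{A}_{\beta}}(u)-ce^{-\left(\frac{\rho(x)}{\sinh\rho(x)}\right)^{\frac{N-1}{2}}\frac{\rho^{2}(x)}{2\lambda^{2}}}\mathbf{1}_{\overline{\mathcal{A}_{\beta}}}(u)\right|^{2}dV_{\mathbb{H}}\\&=K\inf_{c,\lambda}\left\|u-\left(ce^{-\frac{\rho^{2}(x)}{2\lambda^{2}}}\mathbf{1}_{\mathcal{A}_{\beta}}(u)+ce^{-\left(\frac{\rho(x)}{\sinh\rho(x)}\right)^{\frac{N-1}{2}}\frac{\rho^{2}(x)}{2\lambda^{2}}}\mathbf{1}_{\overline{\mathcal{A}_{\beta}}}(u)\right)\right\|_{L^{2}(\mathbb{H}^{N})}^{2},\end{aligned}$$ where the infimum is over $c\in\mathbb{R}$ and over $\lambda>0$ with $\lambda\leq\beta$ if $u\in\mathcal{A}_{\beta}$, and with $\lambda>\beta$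 if $u\in\overline{\mathcal{A}_{\beta}}$.
   Context: $\mathbb{H}^{N}$ is the hyperbolic space in the Poincaré ball model: the Euclidean unit ball with Riemannian metric $\left(\frac{2}{1-|x|^{2}}\right)^{2}dx^{2}$, volume element $dV_{\mathbb{H}}=\left(\frac{2}{1-|x|^{2}}\right)^{N}dx$, Riemannian gradient $\nabla_{\mathbb{H}}=\left(\frac{1-|x|^{2}}{2}\right)^{2}\nabla$; norms and inner products of tangent vectors are Riemannian. $r=\rho(x)=\log\frac{1+|x|}{1-|x|}$ is the hyperbolic distance from $x$ to $0$. Functions are real-valued. For $\beta>0$, $\mathcal{A}_{\beta}$ is the set of nonzero $u\in W^{1,2}(\mathbb{H}^{N})$ with $\int_{\mathbb{H}^{N}}\rho^{2}|u|^{2}dV_{\mathbb{H}}<\infty$ and $\frac{\int_{\mathbb{H}^{N}}\rho^{2}|u|^{2}dV_{\mathbb{H}}}{\int_{\mathbb{H}^{N}}|\nabla_{\mathbb{H}}u|^{2}dV_{\mathbb{H}}}\leq\beta^{4}$; $\overline{\mathcal{A}_{\beta}}$ is its complement (among nonzero $u\in W^{1,2}(\mathbb{H}^N)$ with $\int\rho^2|u|^2dV_{\mathbb H}<\infty$). $\mathbf{1}_S(u)$ equals $1$ if $u\in S$ and $0$ otherwise. The Heisenberg deficit is $$\delta_{1,\mathbb{H}}(u)=\left(\int_{\mathbb{H}^{N}}|\nabla_{\mathbb{H}}u|^{2}dV_{\mathbb{H}}\right)^{1/2}\left(\int_{\mathbb{H}^{N}}\rho^{2}|u|^{2}dV_{\mathbb{H}}\right)^{1/2}-\frac12\int_{\mathbb{H}^{N}}\left(N+(N-1)\frac{\rho\cosh\rho-\sinh\rho}{\sinh\rho}\right)|u|^{2}dV_{\mathbb{H}}.$$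 The modified deficit is, with $\lambda_u=\left(\frac{\int_{\mathbb{H}^{N}}\rho^{2}|u|^{2}dV_{\mathbb{H}}}{\int_{\mathbb{H}^{N}}|\nabla_{\mathbb{H}}u|^{2}dV_{\mathbb{H}}}\right)^{1/4}$, $$\begin{aligned}\tilde{\delta}_{1,\mathbb{H}}(u)={}&\delta_{1,\mathbb{H}}(u)+\frac{1}{16\lambda_u^{2}}\int_{\mathbb{H}^{N}}|u|^{2}\Big(\frac{(N-1)^{2}}{2}\frac{r^{N+3}}{(\sinh r)^{N+1}}\cosh^{2}r+\frac{(N+3)^{2}}{2}\frac{r^{N+1}}{(\sinh r)^{N-1}}\\&\qquad-(N-1)(N+3)\frac{r^{N+2}}{(\sinh r)^{N}}\cosh r-8r^{2}\Big)dV_{\mathbb{H}}\\&-\int_{\mathbb{H}^{N}}u\,\langle\nabla_{\mathbb{H}}u,\nabla_{\mathbb{H}}r\rangle\left(\frac{N-1}{4}\frac{r^{\frac{N+3}{2}}}{(\sinh r)^{\frac{N+1}{2}}}\cosh r-\frac{N+3}{4}\frac{r^{\frac{N+1}{2}}}{(\sinh r)^{\frac{N-1}{2}}}+r\right)dV_{\mathbb{H}}.\end{aligned}$$ *)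

theory Defs
  imports "HOL-Analysis.Analysis"
begin

text \<open>
  Hyperbolic space in the Poincare ball model. The ambient Euclidean space is a type
  \<^typ>\<open>'a::euclidean_space\<close> of dimension N = DIM('a), and the manifold is \<open>ball 0 1\<close>;
  functions on it are total functions on \<^typ>\<open>'a\<close> whose values off the ball are irrelevant.
\<close>

definition hyp_vol :: "'a::euclidean_space measure" where
  "hyp_vol = density (lebesgue_on (ball 0 1))
     (\<lambda>x. ennreal ((2 / (1 - (norm x)\<^sup>2)) ^ DIM('a)))"

definition hyp_rho :: "'a::euclidean_space \<Rightarrow> real" where
  "hyp_rho x = ln ((1 + norm x) / (1 - norm x))"

definition hyp_inner :: "'a::euclidean_space \<Rightarrow> 'a \<Rightarrow> 'a \<Rightarrow> real" where
  "hyp_inner x v w = (2 / (1 - (norm x)\<^sup>2))\<^sup>2 * (v \<bullet> w)"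

definition hyp_norm :: "'a::euclidean_space \<Rightarrow> 'a \<Rightarrow> real" where
  "hyp_norm x v = sqrt (hyp_inner x v v)"


subsection \<open>Gradients\<close>

definition egrad :: "('a::euclidean_space \<Rightarrow> real) \<Rightarrow> 'a \<Rightarrow> 'a" where
  "egrad f x = (\<Sum>b\<in>Basis. frechet_derivative f (at x) b *\<^sub>R b)"

primrec C_k :: "nat \<Rightarrow> ('a::euclidean_space \<Rightarrow> real) \<Rightarrow> bool" where
  "C_k 0 f = continuous_on UNIV f"
| "C_k (Suc k) f = ((\<forall>x. f differentiable (at x)) \<and>
      (\<forall>b\<in>Basis. C_k k (\<lambda>x. frechet_derivative f (at x) b)))"

definition test_function :: "('a::euclidean_space \<Rightarrow> real) \<Rightarrow> bool" where
  "test_function \<phi> \<longleftrightarrow> (\<forall>k. C_k k \<phi>) \<and> closure {x. \<phi> x \<noteq> 0} \<subseteq> ball 0 1"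

definition loc_integrable :: "('a::euclidean_space \<Rightarrow> 'b::euclidean_space) \<Rightarrow> bool" where
  "loc_integrable f \<longleftrightarrow> (\<forall>C. compact C \<and> C \<subseteq> ball 0 1 \<longrightarrow> f absolutely_integrable_on C)"

definition has_weak_grad :: "('a::euclidean_space \<Rightarrow> real) \<Rightarrow> ('a \<Rightarrow> 'a) \<Rightarrow> bool" where
  "has_weak_grad u G \<longleftrightarrow> loc_integrable u \<and> loc_integrable G \<and>
     (\<forall>\<phi>. test_function \<phi> \<longrightarrow>
        (\<integral>x. u x *\<^sub>R egrad \<phi> x \<partial>lebesgue_on (ball 0 1))
          = - (\<integral>x. \<phi> x *\<^sub>R G x \<partial>lebesgue_on (ball 0 1)))"

text \<open>A weak gradient is determined up to a null set, so the choice below does not affect any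
  integral formed from it.\<close>

definition weak_grad :: "('a::euclidean_space \<Rightarrow> real) \<Rightarrow> 'a \<Rightarrow> 'a" where
  "weak_grad u = (SOME G. has_weak_grad u G)"

definition hyp_grad :: "('a::euclidean_space \<Rightarrow> real) \<Rightarrow> 'a \<Rightarrow> 'a" where
  "hyp_grad u x = ((1 - (norm x)\<^sup>2) / 2)\<^sup>2 *\<^sub>R weak_grad u x"

text \<open>The function \<^const>\<open>hyp_rho\<close> is smooth on the ball away from the origin (a null set), so
  its gradient is taken classically.\<close>

definition hyp_grad_rho :: "'a::euclidean_space \<Rightarrow> 'a" where
  "hyp_grad_rho x = ((1 - (norm x)\<^sup>2) / 2)\<^sup>2 *\<^sub>R egrad hyp_rho x"


subsection \<open>The Sobolev space and the classes of functions\<close>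

definition W12 :: "('a::euclidean_space \<Rightarrow> real) set" where
  "W12 = {u. u \<in> borel_measurable hyp_vol \<and> integrable hyp_vol (\<lambda>x. (u x)\<^sup>2) \<and>
     (\<exists>G. has_weak_grad u G) \<and> integrable hyp_vol (\<lambda>x. (hyp_norm x (hyp_grad u x))\<^sup>2)}"

text \<open>Elements of the Sobolev space are classes modulo equality almost everywhere, so being
  nonzero means not vanishing almost everywhere.\<close>

definition heis_dom :: "('a::euclidean_space \<Rightarrow> real) set" where
  "heis_dom = {u \<in> W12. \<not> (AE x in hyp_vol. u x = 0) \<and>
     integrable hyp_vol (\<lambda>x. (hyp_rho x)\<^sup>2 * (u x)\<^sup>2)}"

definition energy :: "('a::euclidean_space \<Rightarrow> real) \<Rightarrow> real" where
  "energy u = (\<integral>x. (hyp_norm x (hyp_grad u x))\<^sup>2 \<partial>hyp_vol)"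

definition second_moment :: "('a::euclidean_space \<Rightarrow> real) \<Rightarrow> real" where
  "second_moment u = (\<integral>x. (hyp_rho x)\<^sup>2 * (u x)\<^sup>2 \<partial>hyp_vol)"

text \<open>The energy of a member of \<^const>\<open>heis_dom\<close> is positive, since nonzero constants are not
  square integrable on hyperbolic space; the quotients below never have denominator 0.\<close>

definition class_A :: "real \<Rightarrow> ('a::euclidean_space \<Rightarrow> real) set" where
  "class_A \<beta> = {u \<in> heis_dom. second_moment u / energy u \<le> \<beta> ^ 4}"

definition class_Ac :: "real \<Rightarrow> ('a::euclidean_space \<Rightarrow> real) set" where
  "class_Ac \<beta> = heis_dom - class_A \<beta>"


subsection \<open>Deficits\<close>

definition deficit :: "('a::euclidean_space \<Rightarrow> real) \<Rightarrow> real" where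
  "deficit u = sqrt (energy u) * sqrt (second_moment u)
     - 1 / 2 * (\<integral>x. (let \<rho> = hyp_rho x; N = real DIM('a) in
         (N + (N - 1) * ((\<rho> * cosh \<rho> - sinh \<rho>) / sinh \<rho>)) * (u x)\<^sup>2) \<partial>hyp_vol)"

definition lambda_u :: "('a::euclidean_space \<Rightarrow> real) \<Rightarrow> real" where
  "lambda_u u = root 4 (second_moment u / energy u)"

definition mod_deficit :: "('a::euclidean_space \<Rightarrow> real) \<Rightarrow> real" where
  "mod_deficit u = deficit u
     + 1 / (16 * (lambda_u u)\<^sup>2) *
       (\<integral>x. (let r = hyp_rho x; n = DIM('a); N = real n in
          (u x)\<^sup>2 *
            ((N - 1)\<^sup>2 / 2 * (r ^ (n + 3) / (sinh r) ^ (n + 1)) * (cosh r)\<^sup>2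
             + (N + 3)\<^sup>2 / 2 * (r ^ (n + 1) / (sinh r) ^ (n - 1))
             - (N - 1) * (N + 3) * (r ^ (n + 2) / (sinh r) ^ n) * cosh r
             - 8 * r\<^sup>2)) \<partial>hyp_vol)
     - (\<integral>x. (let r = hyp_rho x; N = real DIM('a) in
          u x * hyp_inner x (hyp_grad u x) (hyp_grad_rho x) *
            ((N - 1) / 4 * (r powr ((N + 3) / 2) / sinh r powr ((N + 1) / 2)) * cosh r
             - (N + 3) / 4 * (r powr ((N + 1) / 2) / sinh r powr ((N - 1) / 2))
             + r)) \<partial>hyp_vol)"


subsection \<open>Comparison functions and the distance to them\<close>

definition gauss :: "real \<Rightarrow> 'a::euclidean_space \<Rightarrow> real" where
  "gauss lam x = exp (- ((hyp_rho x)\<^sup>2 / (2 * lam\<^sup>2)))"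

definition mod_gauss :: "real \<Rightarrow> 'a::euclidean_space \<Rightarrow> real" where
  "mod_gauss lam x =
     exp (- ((hyp_rho x / sinh (hyp_rho x)) powr ((real DIM('a) - 1) / 2)
              * ((hyp_rho x)\<^sup>2 / (2 * lam\<^sup>2))))"

definition admissible :: "real \<Rightarrow> ('a::euclidean_space \<Rightarrow> real) \<Rightarrow> (real \<times> real) set" where
  "admissible \<beta> u = {(c, lam). 0 < lam \<and>
     (u \<in> class_A \<beta> \<longrightarrow> lam \<le> \<beta>) \<and> (u \<in> class_Ac \<beta> \<longrightarrow> \<beta> < lam)}"

text \<open>
  The squared distances are computed in the extended nonnegative reals, because
  \<^const>\<open>mod_gauss\<close> tends to 1 at infinity (N \<ge> 2) and is not square integrable: for a nonzero
  coefficient the distance is infinite, whereas a Bochner integral would return 0.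
\<close>

definition hyp_sq_integral :: "('a::euclidean_space \<Rightarrow> real) \<Rightarrow> ennreal" where
  "hyp_sq_integral f = (\<integral>\<^sup>+x. ennreal (\<bar>f x\<bar>\<^sup>2) \<partial>hyp_vol)"

definition hyp_L2_norm :: "('a::euclidean_space \<Rightarrow> real) \<Rightarrow> ennreal" where
  "hyp_L2_norm f =
     (if hyp_sq_integral f < \<infinity> then ennreal (sqrt (enn2real (hyp_sq_integral f))) else \<infinity>)"

end

theory Submission
  imports Defs
begin

text \<open>
  With \<open>\<lambda> = lambda_u u\<close> both deficits are completed squares,
  \<open>\<lambda>\<^sup>2/2 * \<integral> |grad u + u grad \<phi>/\<lambda>\<^sup>2|\<^sup>2\<close>, where \<open>\<phi> = r\<^sup>2/2\<close> for the deficit and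
  \<open>\<phi> = r\<^sup>2/2 * (r/sinh r) powr ((N-1)/2)\<close> for the modified one; the cross terms come from integrating
  by parts against a radial field \<open>M(r) grad r\<close>.

  Above the threshold the comparison functions with \<open>c \<noteq> 0\<close> are not square integrable, so what is
  needed is a Hardy inequality for the twisted gradient. As the modified \<open>\<phi>\<close> is bounded, it follows from the identity for
  \<open>M = r/(1+r) * exp (2\<phi>/\<lambda>\<^sup>2)\<close>, whose divergence is bounded below.

  Below the threshold, the identity for \<open>M = r\<close>, applied to \<open>w = u - c exp (-r\<^sup>2/2\<lambda>\<^sup>2)\<close>, is a Lyapunov estimate:
  it controls \<open>w\<close> outside the ball \<open>r \<le> \<lambda> sqrt (6N)\<close> by the deficit and by \<open>w\<close> inside. On that ball, where metric and
  weight are comparable to Euclidean ones if \<open>\<lambda> sqrt (6N) \<le> 1\<close>, the Euclidean Poincare inequality for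
  \<open>u exp (r\<^sup>2/2\<lambda>\<^sup>2)\<close> supplies \<open>c\<close>.

  Weakly differentiable functions are reached from smooth ones by mollification: a weak gradient
  commutes with it away from the boundary.
\<close>

text \<open>At \<open>\<lambda> = lambda_u u\<close> the product of the square roots of energy E and
  second moment S equals both \<open>\<lambda>\<^sup>2 E\<close> and
  \<open>S / \<lambda>\<^sup>2\<close>; half of each supplies the diagonal terms of the square. The
  difficulty is a constant uniform in \<lambda>. As \<lambda> tends to 0 the prefactor
  \<open>\<lambda>\<^sup>2/2\<close> degenerates; it is recovered because the Poincare ball has
  radius of order \<lambda>, hence a constant of order \<open>\<lambda>\<^sup>2\<close>. As
  \<lambda> grows the prefactor only helps, and the Hardy constant
  \<open>16 exp (12 / \<lambda>\<^sup>2)\<close> stays bounded when \<lambda> is bounded below. The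
  two ranges meet at \<open>\<beta> = 1 / sqrt (6 N)\<close>. The Lyapunov estimate may be applied
  to \<open>w\<close> in place of \<open>u\<close> because the twisted gradient annihilates the
  Gaussian, so the square is the same for both. Integration by parts has to cope with gradients
  tested only inside the open ball and with fields singular at the origin; cutoffs in
  \<open>ln r\<close> handle both ends, and mass, second moment and energy dominate the integrands
  while the cutoffs are removed.\<close>

section \<open>Smooth bump functions\<close>

text \<open>The negative powers make the family \<open>flat 0, flat 1, \<dots>\<close> closed under differentiation up to linear combinations.\<close>

definition flat :: "nat \<Rightarrow> real \<Rightarrow> real" where
  "flat j t = (if 0 < t then exp (- (1 / t)) / t ^ j else 0)"

lemma flat_nonneg: "0 \<le> flat j t"
  by (simp add: flat_def)

lemma flat_tendsto_0: "(flat j \<longlongrightarrow> 0) (at 0)"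
proof -
  have "((\<lambda>t::real. (inverse t) ^ j / exp (inverse t)) \<longlongrightarrow> 0) (at_right 0)"
    using filterlim_compose[OF tendsto_power_div_exp_0 filterlim_inverse_at_top_right, of j] .
  then have "(flat j \<longlongrightarrow> 0) (at_right 0)"
    by (rule Lim_transform_eventually)
      (auto simp: eventually_at_right_field flat_def exp_minus field_simps power_inverse
        intro!: exI[of _ 1])
  moreover have "(flat j \<longlongrightarrow> 0) (at_left 0)"
    by (rule tendsto_eventually) (auto simp: eventually_at_left_field flat_def intro!: exI[of _ "-1"])
  ultimately show ?thesis
    using filterlim_split_at by blast
qed

lemma flat_has_derivative:
  "(flat j has_real_derivative flat (j + 2) t - real j * flat (j + 1) t) (at t)"
proof (cases t "0::real" rule: linorder_cases)
  case less
  have "((\<lambda>_. 0) has_real_derivative 0) (at t)" by simp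
  then have "(flat j has_real_derivative 0) (at t)"
    by (rule has_field_derivative_transform_within_open[where S = "{..<0}"])
      (use less in \<open>auto simp: flat_def\<close>)
  with less show ?thesis by (simp add: flat_def)
next
  case equal
  \<comment> \<open>The difference quotient of \<open>flat j\<close> at 0 is
    \<open>flat (j + 1)\<close>, so differentiability at 0 is the limit at 0 of the next member of
    the family.\<close>
  have "((\<lambda>h. flat j h / h) \<longlongrightarrow> 0) (at 0)"
    by (rule Lim_transform_eventually[OF flat_tendsto_0[of "j + 1"]])
      (auto simp: eventually_at_filter flat_def)
  with equal show ?thesis
    by (simp add: DERIV_def flat_def)
next
  case greater
  have "((\<lambda>t. exp (- (1 / t)) / t ^ j) has_real_derivative
      (exp (- (1 / t)) * (1 / t\<^sup>2) * t ^ j - exp (- (1 / t)) * (real j * t ^ (j - 1))) / (t ^ j * t ^ j)) (at t)"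
    using greater by (auto intro!: derivative_eq_intros simp: power2_eq_square)
  also have "(exp (- (1 / t)) * (1 / t\<^sup>2) * t ^ j - exp (- (1 / t)) * (real j * t ^ (j - 1))) / (t ^ j * t ^ j)
      = exp (- (1 / t)) / t ^ (j + 2) - real j * (exp (- (1 / t)) / t ^ (j + 1))"
    using greater by (cases j) (auto simp: field_simps power2_eq_square)
  finally have "(flat j has_real_derivative exp (- (1 / t)) / t ^ (j + 2) - real j * (exp (- (1 / t)) / t ^ (j + 1))) (at t)"
    by (rule has_field_derivative_transform_within_open[where S = "{0<..}"])
      (use greater in \<open>auto simp: flat_def\<close>)
  with greater show ?thesis by (simp add: flat_def)
qed

text \<open>An algebra of functions containing the mollifiers and closed under partial derivatives, so that
  all its members are \<^const>\<open>C_k\<close> for every \<open>k\<close>.\<close>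

inductive bump_alg :: "('a::euclidean_space \<Rightarrow> real) \<Rightarrow> bool" where
  const: "bump_alg (\<lambda>x. c)"
| coord: "bump_alg (\<lambda>x. x \<bullet> b)"
| add: "bump_alg f \<Longrightarrow> bump_alg g \<Longrightarrow> bump_alg (\<lambda>x. f x + g x)"
| mult: "bump_alg f \<Longrightarrow> bump_alg g \<Longrightarrow> bump_alg (\<lambda>x. f x * g x)"
| flat: "bump_alg f \<Longrightarrow> bump_alg (\<lambda>x. flat j (f x))"

text \<open>The derivative is kept as a family in the direction \<open>b\<close> so that each
  partial derivative is again a member. Differentiability alone would not support the induction on
  \<open>k\<close> in \<open>bump_alg_C_k\<close>.\<close>

lemma bump_alg_derivative:
  assumes "bump_alg f"
  shows "\<exists>f'. (\<forall>x. (f has_derivative f' x) (at x)) \<and> (\<forall>b. bump_alg (\<lambda>x. f' x b))"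
  using assms
proof induction
  case (const c)
  show ?case
    by (rule exI[of _ "\<lambda>x h. 0"]) (auto intro: bump_alg.const)
next
  case (coord b)
  show ?case
    by (rule exI[of _ "\<lambda>x h. h \<bullet> b"]) (auto intro: bump_alg.const intro!: derivative_eq_intros)
next
  case (add f g)
  then obtain f' g' where
    "\<forall>x. (f has_derivative f' x) (at x)" "\<forall>b. bump_alg (\<lambda>x. f' x b)"
    "\<forall>x. (g has_derivative g' x) (at x)" "\<forall>b. bump_alg (\<lambda>x. g' x b)" by blast
  then show ?case
    by (intro exI[of _ "\<lambda>x h. f' x h + g' x h"])
      (auto intro: bump_alg.add intro!: has_derivative_add)
next
  case (mult f g)
  then obtain f' g' where
    "\<forall>x. (f has_derivative f' x) (at x)" "\<forall>b. bump_alg (\<lambda>x. f' x b)"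
    "\<forall>x. (g has_derivative g' x) (at x)" "\<forall>b. bump_alg (\<lambda>x. g' x b)" by blast
  with mult.hyps show ?case
    by (intro exI[of _ "\<lambda>x h. f x * g' x h + f' x h * g x"])
      (intro conjI allI has_derivative_mult bump_alg.add bump_alg.mult; simp)
next
  case (flat f j)
  then obtain f' where f': "\<forall>x. (f has_derivative f' x) (at x)" "\<forall>b. bump_alg (\<lambda>x. f' x b)"
    by blast
  have "((\<lambda>x. flat j (f x)) has_derivative
      (\<lambda>h. (flat (j + 2) (f x) + (- real j) * flat (j + 1) (f x)) * f' x h)) (at x)" for x
    using has_derivative_compose[OF f'(1)[rule_format] flat_has_derivative[of j "f x", unfolded has_field_derivative_def]]
    by (simp add: mult.commute)
  with f'(2) flat.hyps show ?case
    by (intro exI[of _ "\<lambda>x h. (flat (j + 2) (f x) + (- real j) * flat (j + 1) (f x)) * f' x h"])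
      (intro conjI allI bump_alg.add bump_alg.mult bump_alg.const bump_alg.flat; simp)
qed

lemma bump_alg_C_k:
  assumes "bump_alg f"
  shows "C_k k f"
  using assms
proof (induction k arbitrary: f)
  case 0
  then show ?case
    using bump_alg_derivative[OF 0]
    by (auto intro!: continuous_at_imp_continuous_on intro: has_derivative_continuous)
next
  case (Suc k)
  obtain f' where f': "\<And>x. (f has_derivative f' x) (at x)" "\<And>b. bump_alg (\<lambda>x. f' x b)"
    using bump_alg_derivative[OF Suc.prems] by blast
  have "frechet_derivative f (at x) = f' x" for x
    using frechet_derivative_at[OF f'(1)] by simp
  moreover have "f differentiable (at x)" for x
    using f'(1) by (auto simp: differentiable_def)
  ultimately show ?case using f'(2) Suc.IH by simp
qed

lemma bump_alg_sum: "finite A \<Longrightarrow> (\<And>i. i \<in> A \<Longrightarrow> bump_alg (f i)) \<Longrightarrow> bump_alg (\<lambda>x. \<Sum>i\<in>A. f i x)"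
  by (induction A rule: finite_induct) (auto intro: bump_alg.const bump_alg.add)



text \<open>The squared norm is used because it is a polynomial in the coordinates, which puts every
  translate into \<open>bump_alg\<close>; the norm itself is not smooth at 0.\<close>

definition bump :: "real \<Rightarrow> 'a::euclidean_space \<Rightarrow> real" where
  "bump e x = flat 0 (1 - (norm x)\<^sup>2 / e\<^sup>2)"

lemma bump_alg_bump: "bump_alg (\<lambda>y. bump e (x - y))"
proof -
  have eq: "bump e (x - y) = flat 0 (1 + (- (1 / e\<^sup>2)) *
      (\<Sum>b\<in>Basis. (x \<bullet> b + (- 1) * (y \<bullet> b)) * (x \<bullet> b + (- 1) * (y \<bullet> b))))" for y
    unfolding bump_def power2_norm_eq_inner
    by (subst euclidean_inner) (simp add: inner_diff_left)
  show ?thesis unfolding eq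
    by (intro bump_alg.flat bump_alg.add bump_alg.mult bump_alg.const bump_alg_sum bump_alg.coord) auto
qed

lemma bump_nonneg: "0 \<le> bump e x"
  by (simp add: bump_def flat_nonneg)

lemma bump_eq_0_iff: "e > 0 \<Longrightarrow> bump e x = 0 \<longleftrightarrow> e \<le> norm x"
  using abs_square_less_1[of "norm x / e"] by (auto simp: bump_def flat_def power_divide not_less)

lemma bump_minus: "bump e (- x) = bump e x"
  by (simp add: bump_def)

lemma test_function_bump:
  assumes "e > 0" "norm x + e < 1"
  shows "test_function (\<lambda>y. c * bump e (x - y))"
proof -
  have "closure {y. c * bump e (x - y) \<noteq> 0} \<subseteq> cball x e"
    using assms by (intro closure_minimal) (auto simp: bump_eq_0_iff dist_norm)
  moreover have "cball x e \<subseteq> ball 0 1"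
    using assms by (subst cball_subset_ball_iff) auto
  moreover have "C_k k (\<lambda>y. c * bump e (x - y))" for k
    by (intro bump_alg_C_k bump_alg.mult bump_alg.const bump_alg_bump)
  ultimately show ?thesis
    unfolding test_function_def by (meson order_trans)
qed

section \<open>Square-integrable functions\<close>

text \<open>Measurability is asked for separately: integrability of the square gives measurability
  of the square only, which loses the sign.\<close>

definition sq_int :: "'a measure \<Rightarrow> ('a \<Rightarrow> real) \<Rightarrow> bool" where
  "sq_int M f \<longleftrightarrow> f \<in> borel_measurable M \<and> integrable M (\<lambda>x. (f x)\<^sup>2)"

lemma sq_int_measurable: "sq_int M f \<Longrightarrow> f \<in> borel_measurable M"
  by (simp add: sq_int_def)

lemma sq_int_mult:
  assumes "sq_int M f" "sq_int M g"
  shows "integrable M (\<lambda>x. f x * g x)"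
proof (rule Bochner_Integration.integrable_bound)
  show "integrable M (\<lambda>x. (f x)\<^sup>2 + (g x)\<^sup>2)"
    using assms by (simp add: sq_int_def)
  show "(\<lambda>x. f x * g x) \<in> borel_measurable M"
    using assms by (auto simp: sq_int_def intro!: borel_measurable_times)
  have "\<bar>a * b\<bar> \<le> a\<^sup>2 + b\<^sup>2" for a b :: real
  proof -
    have "2 * \<bar>a * b\<bar> \<le> a\<^sup>2 + b\<^sup>2"
      using zero_le_power2[of "\<bar>a\<bar> - \<bar>b\<bar>"] by (simp add: power2_diff abs_mult algebra_simps)
    then show ?thesis by linarith
  qed
  then show "AE x in M. norm (f x * g x) \<le> norm ((f x)\<^sup>2 + (g x)\<^sup>2)"
    by simp
qed

lemma sq_int_add:
  assumes "sq_int M f" "sq_int M g"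
  shows "sq_int M (\<lambda>x. f x + g x)"
  using assms sq_int_mult[OF assms] by (auto simp: sq_int_def power2_sum mult.assoc)

lemma sq_int_bounded_mult:
  assumes f: "sq_int M f" and a: "a \<in> borel_measurable M"
    and le: "\<And>x. x \<in> space M \<Longrightarrow> \<bar>a x\<bar> \<le> B"
  shows "sq_int M (\<lambda>x. a x * f x)"
proof -
  have "integrable M (\<lambda>x. (a x * f x)\<^sup>2)"
  proof (rule Bochner_Integration.integrable_bound)
    show "integrable M (\<lambda>x. B\<^sup>2 * (f x)\<^sup>2)"
      using f by (simp add: sq_int_def)
    show "(\<lambda>x. (a x * f x)\<^sup>2) \<in> borel_measurable M"
      using f a by (auto simp: sq_int_def intro!: borel_measurable_power borel_measurable_times)
    have "(a x * f x)\<^sup>2 \<le> B\<^sup>2 * (f x)\<^sup>2" if "x \<in> space M" for x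
      using power_mono[OF le[OF that], of 2] by (simp add: power_mult_distrib mult_right_mono)
    then show "AE x in M. norm ((a x * f x)\<^sup>2) \<le> norm (B\<^sup>2 * (f x)\<^sup>2)"
      by simp
  qed
  with f a show ?thesis by (auto simp: sq_int_def intro!: borel_measurable_times)
qed

lemma sq_int_cmult: "sq_int M f \<Longrightarrow> sq_int M (\<lambda>x. c * f x)"
  by (rule sq_int_bounded_mult[of _ _ _ "\<bar>c\<bar>"]) auto

lemma sq_int_diff: "sq_int M f \<Longrightarrow> sq_int M g \<Longrightarrow> sq_int M (\<lambda>x. f x - g x)"
  using sq_int_add[of M f "\<lambda>x. (- 1) * g x"] sq_int_cmult[of M g "- 1"] by simp

lemma sq_int_integrable:
  assumes "sq_int M f" "finite_measure M"
  shows "integrable M f"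
proof -
  interpret finite_measure M by fact
  have "sq_int M (\<lambda>x. 1)" by (simp add: sq_int_def)
  from sq_int_mult[OF assms(1) this] show ?thesis by simp
qed

lemma integral_Cauchy_Schwarz:
  assumes f: "sq_int M f" and g: "sq_int M g"
  shows "\<bar>\<integral>x. f x * g x \<partial>M\<bar> \<le> sqrt (\<integral>x. (f x)\<^sup>2 \<partial>M) * sqrt (\<integral>x. (g x)\<^sup>2 \<partial>M)"
proof -
  have [measurable]: "f \<in> borel_measurable M" "g \<in> borel_measurable M"
    using f g by (auto simp: sq_int_def)
  have nn: "(\<integral>\<^sup>+x. ennreal (\<bar>h x\<bar>) ^ 2 \<partial>M) = ennreal (\<integral>x. (h x)\<^sup>2 \<partial>M)" if "sq_int M h" for h
    using that by (subst nn_integral_eq_integral[symmetric]) (auto simp: sq_int_def ennreal_power)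
  have "ennreal (\<integral>x. \<bar>f x\<bar> * \<bar>g x\<bar> \<partial>M) = (\<integral>\<^sup>+x. ennreal \<bar>f x\<bar> * ennreal \<bar>g x\<bar> \<partial>M)"
    using integrable_abs[OF sq_int_mult[OF f g]]
    by (subst nn_integral_eq_integral[symmetric]) (auto simp: abs_mult ennreal_mult)
  then have "ennreal ((\<integral>x. \<bar>f x\<bar> * \<bar>g x\<bar> \<partial>M)\<^sup>2)
      \<le> ennreal ((\<integral>x. (f x)\<^sup>2 \<partial>M) * (\<integral>x. (g x)\<^sup>2 \<partial>M))"
    using Cauchy_Schwarz_nn_integral[of "\<lambda>x. ennreal \<bar>f x\<bar>" M "\<lambda>x. ennreal \<bar>g x\<bar>"]
    by (simp add: nn f g ennreal_mult ennreal_power[symmetric])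
  then have "(\<integral>x. \<bar>f x\<bar> * \<bar>g x\<bar> \<partial>M)\<^sup>2 \<le> (\<integral>x. (f x)\<^sup>2 \<partial>M) * (\<integral>x. (g x)\<^sup>2 \<partial>M)"
    by (subst (asm) ennreal_le_iff) auto
  then have "(\<integral>x. \<bar>f x\<bar> * \<bar>g x\<bar> \<partial>M) \<le> sqrt (\<integral>x. (f x)\<^sup>2 \<partial>M) * sqrt (\<integral>x. (g x)\<^sup>2 \<partial>M)"
    by (simp add: real_le_rsqrt real_sqrt_mult[symmetric])
  moreover have "\<bar>\<integral>x. f x * g x \<partial>M\<bar> \<le> (\<integral>x. \<bar>f x\<bar> * \<bar>g x\<bar> \<partial>M)"
    using integral_norm_bound[of M "\<lambda>x. f x * g x"] by (simp add: abs_mult)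
  ultimately show ?thesis by linarith
qed

section \<open>Convergence in the square norm\<close>

definition L2_lim :: "'a measure \<Rightarrow> (nat \<Rightarrow> 'a \<Rightarrow> real) \<Rightarrow> ('a \<Rightarrow> real) \<Rightarrow> bool" where
  "L2_lim M F f \<longleftrightarrow> (\<forall>n. sq_int M (F n)) \<and> sq_int M f \<and> (\<lambda>n. \<integral>x. (F n x - f x)\<^sup>2 \<partial>M) \<longlonglongrightarrow> 0"

lemma L2_lim_const: "sq_int M f \<Longrightarrow> L2_lim M (\<lambda>_. f) f"
  by (simp add: L2_lim_def)

lemma L2_lim_add:
  assumes F: "L2_lim M F f" and G: "L2_lim M G g"
  shows "L2_lim M (\<lambda>n x. F n x + G n x) (\<lambda>x. f x + g x)"
proof -
  have "(\<lambda>n. \<integral>x. (F n x + G n x - (f x + g x))\<^sup>2 \<partial>M) \<longlonglongrightarrow> 0"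
  proof (rule tendsto_sandwich[OF always_eventually always_eventually, rule_format])
    show "0 \<le> (\<integral>x. (F n x + G n x - (f x + g x))\<^sup>2 \<partial>M)" for n
      by simp
    show "(\<integral>x. (F n x + G n x - (f x + g x))\<^sup>2 \<partial>M)
        \<le> 2 * (\<integral>x. (F n x - f x)\<^sup>2 \<partial>M) + 2 * (\<integral>x. (G n x - g x)\<^sup>2 \<partial>M)" for n
    proof -
      have 1: "sq_int M (\<lambda>x. F n x - f x)" "sq_int M (\<lambda>x. G n x - g x)"
        using F G by (auto simp: L2_lim_def intro: sq_int_diff)
      have "(\<integral>x. (F n x + G n x - (f x + g x))\<^sup>2 \<partial>M)
          \<le> (\<integral>x. 2 * (F n x - f x)\<^sup>2 + 2 * (G n x - g x)\<^sup>2 \<partial>M)"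
      proof (rule integral_mono)
        show "integrable M (\<lambda>x. (F n x + G n x - (f x + g x))\<^sup>2)"
          using sq_int_add[OF 1] by (simp add: sq_int_def algebra_simps)
        show "integrable M (\<lambda>x. 2 * (F n x - f x)\<^sup>2 + 2 * (G n x - g x)\<^sup>2)"
          using 1 by (simp add: sq_int_def)
        have "(a + b)\<^sup>2 \<le> 2 * a\<^sup>2 + 2 * b\<^sup>2" for a b :: real
          using zero_le_power2[of "a - b"] by (simp add: power2_diff power2_sum)
        from this[of "F n x - f x" "G n x - g x" for x]
        show "(F n x + G n x - (f x + g x))\<^sup>2 \<le> 2 * (F n x - f x)\<^sup>2 + 2 * (G n x - g x)\<^sup>2" for x
          by (simp add: algebra_simps)
      qed
      also have "\<dots> = 2 * (\<integral>x. (F n x - f x)\<^sup>2 \<partial>M) + 2 * (\<integral>x. (G n x - g x)\<^sup>2 \<partial>M)"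
        using 1 by (simp add: sq_int_def)
      finally show ?thesis .
    qed
    show "(\<lambda>n. 2 * (\<integral>x. (F n x - f x)\<^sup>2 \<partial>M) + 2 * (\<integral>x. (G n x - g x)\<^sup>2 \<partial>M)) \<longlonglongrightarrow> 0"
      using F G by (auto simp: L2_lim_def intro!: tendsto_eq_intros)
  qed simp
  with F G show ?thesis by (auto simp: L2_lim_def intro: sq_int_add)
qed

lemma L2_lim_bounded_mult:
  assumes F: "L2_lim M F f" and a: "a \<in> borel_measurable M"
    and le: "\<And>x. x \<in> space M \<Longrightarrow> \<bar>a x\<bar> \<le> B"
  shows "L2_lim M (\<lambda>n x. a x * F n x) (\<lambda>x. a x * f x)"
proof -
  have "(\<lambda>n. \<integral>x. (a x * F n x - a x * f x)\<^sup>2 \<partial>M) \<longlonglongrightarrow> 0"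
  proof (rule tendsto_sandwich[OF always_eventually always_eventually, rule_format])
    show "0 \<le> (\<integral>x. (a x * F n x - a x * f x)\<^sup>2 \<partial>M)" for n
      by simp
    show "(\<integral>x. (a x * F n x - a x * f x)\<^sup>2 \<partial>M) \<le> B\<^sup>2 * (\<integral>x. (F n x - f x)\<^sup>2 \<partial>M)" for n
    proof -
      have 1: "sq_int M (\<lambda>x. F n x - f x)"
        using F by (auto simp: L2_lim_def intro: sq_int_diff)
      have "(\<integral>x. (a x * F n x - a x * f x)\<^sup>2 \<partial>M) \<le> (\<integral>x. B\<^sup>2 * (F n x - f x)\<^sup>2 \<partial>M)"
      proof (rule integral_mono)
        show "integrable M (\<lambda>x. (a x * F n x - a x * f x)\<^sup>2)"
          using sq_int_bounded_mult[OF 1 a le] by (simp add: sq_int_def algebra_simps)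
        show "integrable M (\<lambda>x. B\<^sup>2 * (F n x - f x)\<^sup>2)"
          using 1 by (simp add: sq_int_def)
        show "(a x * F n x - a x * f x)\<^sup>2 \<le> B\<^sup>2 * (F n x - f x)\<^sup>2" if "x \<in> space M" for x
          using power_mono[OF le[OF that], of 2]
          by (simp add: right_diff_distrib[symmetric] power_mult_distrib mult_right_mono)
      qed
      then show ?thesis by simp
    qed
    show "(\<lambda>n. B\<^sup>2 * (\<integral>x. (F n x - f x)\<^sup>2 \<partial>M)) \<longlonglongrightarrow> 0"
      using F by (auto simp: L2_lim_def intro!: tendsto_eq_intros)
  qed simp
  with F show ?thesis by (auto simp: L2_lim_def intro: sq_int_bounded_mult[OF _ a le])
qed

text \<open>The divergence identity and the Poincare inequality are quadratic in a function and its
  gradient, so this pairing is what carries them from smooth functions to weakly differentiable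
  ones. The difference of products splits into three terms with at least one small factor each, and
  Cauchy-Schwarz bounds them.\<close>

lemma L2_lim_integral_mult:
  assumes F: "L2_lim M F f" and G: "L2_lim M G g"
  shows "(\<lambda>n. \<integral>x. F n x * G n x \<partial>M) \<longlonglongrightarrow> (\<integral>x. f x * g x \<partial>M)"
proof -
  define p where "p n = sqrt (\<integral>x. (F n x - f x)\<^sup>2 \<partial>M)" for n
  define q where "q n = sqrt (\<integral>x. (G n x - g x)\<^sup>2 \<partial>M)" for n
  define A where "A = sqrt (\<integral>x. (f x)\<^sup>2 \<partial>M)"
  define B where "B = sqrt (\<integral>x. (g x)\<^sup>2 \<partial>M)"
  have pq: "p \<longlonglongrightarrow> 0" "q \<longlonglongrightarrow> 0"
    using F G tendsto_real_sqrt[where x = 0] by (fastforce simp: L2_lim_def p_def[abs_def] q_def[abs_def])+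
  have "(\<lambda>n. (\<integral>x. F n x * G n x \<partial>M) - (\<integral>x. f x * g x \<partial>M)) \<longlonglongrightarrow> 0"
  proof (rule tendsto_rabs_zero_cancel, rule tendsto_sandwich[OF always_eventually always_eventually, rule_format])
    show "0 \<le> \<bar>(\<integral>x. F n x * G n x \<partial>M) - (\<integral>x. f x * g x \<partial>M)\<bar>" for n
      by simp
    show "\<bar>(\<integral>x. F n x * G n x \<partial>M) - (\<integral>x. f x * g x \<partial>M)\<bar> \<le> p n * q n + A * q n + p n * B" for n
    proof -
      have si: "sq_int M (\<lambda>x. F n x - f x)" "sq_int M (\<lambda>x. G n x - g x)" "sq_int M f" "sq_int M g"
        "sq_int M (F n)" "sq_int M (G n)"
        using F G by (auto simp: L2_lim_def intro: sq_int_diff)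
      have "(\<integral>x. F n x * G n x \<partial>M) - (\<integral>x. f x * g x \<partial>M) = (\<integral>x. F n x * G n x - f x * g x \<partial>M)"
        using sq_int_mult[OF si(5,6)] sq_int_mult[OF si(3,4)] by simp
      also have "\<dots> = (\<integral>x. (F n x - f x) * (G n x - g x) + f x * (G n x - g x) + (F n x - f x) * g x \<partial>M)"
        by (simp add: algebra_simps)
      also have "\<dots> = (\<integral>x. (F n x - f x) * (G n x - g x) \<partial>M) + (\<integral>x. f x * (G n x - g x) \<partial>M)
          + (\<integral>x. (F n x - f x) * g x \<partial>M)"
        using sq_int_mult[OF si(1,2)] sq_int_mult[OF si(3,2)] sq_int_mult[OF si(1,4)] by simp
      finally show ?thesis
        using integral_Cauchy_Schwarz[OF si(1,2)] integral_Cauchy_Schwarz[OF si(3,2)]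
          integral_Cauchy_Schwarz[OF si(1,4)]
        unfolding p_def q_def A_def B_def by linarith
    qed
    show "(\<lambda>n. p n * q n + A * q n + p n * B) \<longlonglongrightarrow> 0"
      using pq by (auto intro!: tendsto_eq_intros)
  qed simp
  then show ?thesis by (simp add: LIM_zero_iff)
qed

section \<open>Translations and mollification in the square norm\<close>

lemma lborel_integrable_translation:
  fixes f :: "'a::euclidean_space \<Rightarrow> real"
  assumes "integrable lborel f"
  shows "integrable lborel (\<lambda>x. f (x + z))"
proof -
  have "integrable (distr lborel borel ((+) z)) f"
    using assms by (simp add: lborel_distr_plus)
  then show ?thesis
    by (subst (asm) integrable_distr_eq) (use assms in \<open>auto simp: add.commute[of z]\<close>)
qed

lemma lborel_integral_translation:
  fixes f :: "'a::euclidean_space \<Rightarrow> real"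
  assumes "f \<in> borel_measurable borel"
  shows "(\<integral>x. f (x + z) \<partial>lborel) = (\<integral>x. f x \<partial>lborel)"
proof -
  have "(\<integral>x. f x \<partial>lborel) = (\<integral>x. f x \<partial>distr lborel borel ((+) z))"
    by (simp add: lborel_distr_plus)
  also have "\<dots> = (\<integral>x. f (z + x) \<partial>lborel)"
    using assms by (subst integral_distr) auto
  finally show ?thesis by (simp add: add.commute[of z])
qed

lemma lborel_nn_integral_translation:
  fixes f :: "'a::euclidean_space \<Rightarrow> ennreal"
  assumes "f \<in> borel_measurable borel"
  shows "(\<integral>\<^sup>+x. f (x + z) \<partial>lborel) = (\<integral>\<^sup>+x. f x \<partial>lborel)"
proof -
  have "(\<integral>\<^sup>+x. f x \<partial>lborel) = (\<integral>\<^sup>+x. f x \<partial>distr lborel borel ((+) z))"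
    by (simp add: lborel_distr_plus)
  also have "\<dots> = (\<integral>\<^sup>+x. f (z + x) \<partial>lborel)"
    using assms by (subst nn_integral_distr) auto
  finally show ?thesis by (simp add: add.commute[of z])
qed

lemma sq_int_translation:
  fixes f :: "'a::euclidean_space \<Rightarrow> real"
  assumes "sq_int lborel f"
  shows "sq_int lborel (\<lambda>x. f (x + z))"
  using assms lborel_integrable_translation[of "\<lambda>x. (f x)\<^sup>2" z]
  by (auto simp: sq_int_def)

lemma integrable_bounded_support:
  fixes f :: "'a::euclidean_space \<Rightarrow> real"
  assumes "f \<in> borel_measurable borel" "\<And>x. \<bar>f x\<bar> \<le> B" "\<And>x. R < norm x \<Longrightarrow> f x = 0"
  shows "integrable lborel f"
proof (rule Bochner_Integration.integrable_bound)
  show "integrable lborel (\<lambda>x::'a. B * indicator (cball 0 R) x)"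
    using emeasure_bounded_finite[OF bounded_cball, of "0::'a" R]
    by (intro integrable_mult_right integrable_real_indicator) auto
  show "AE x in lborel. norm (f x) \<le> norm (B * indicator (cball 0 R) x)"
    using assms(2,3) by (auto simp: indicator_def not_le intro: order_trans[OF _ abs_ge_self])
qed (use assms in auto)

definition clamp_real :: "real \<Rightarrow> real \<Rightarrow> real" where
  "clamp_real k t = max (- k) (min k t)"

lemma sq_int_truncate:
  fixes f :: "'a::euclidean_space \<Rightarrow> real"
  assumes f: "sq_int lborel f"
  shows "(\<lambda>k. \<integral>x. (clamp_real (real k) (f x) - f x)\<^sup>2 \<partial>lborel) \<longlonglongrightarrow> 0"
proof -
  have [measurable]: "f \<in> borel_measurable borel" using f by (simp add: sq_int_def)
  have "(\<lambda>k. \<integral>x. (clamp_real (real k) (f x) - f x)\<^sup>2 \<partial>lborel) \<longlonglongrightarrow> (\<integral>x. 0 \<partial>(lborel::'a measure))"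
  proof (rule integral_dominated_convergence)
    show "integrable lborel (\<lambda>x. (f x)\<^sup>2)" using f by (simp add: sq_int_def)
    show "AE x in lborel. (\<lambda>k. (clamp_real (real k) (f x) - f x)\<^sup>2) \<longlonglongrightarrow> 0"
    proof (rule AE_I2, rule tendsto_eventually)
      fix x
      obtain n :: nat where "\<bar>f x\<bar> \<le> real n" using real_arch_simple by blast
      then have "\<forall>k\<ge>n. clamp_real (real k) (f x) = f x"
        by (auto simp: clamp_real_def max_def min_def)
      then show "\<forall>\<^sub>F k in sequentially. (clamp_real (real k) (f x) - f x)\<^sup>2 = 0"
        by (auto simp: eventually_sequentially)
    qed
    show "AE x in lborel. norm ((clamp_real (real k) (f x) - f x)\<^sup>2) \<le> (f x)\<^sup>2" for k
      by (auto simp: clamp_real_def abs_le_square_iff[symmetric] max_def min_def)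
  qed (auto simp: clamp_real_def)
  then show ?thesis by simp
qed

text \<open>Lebesgue measurability provides continuous functions converging almost everywhere, but
  without any bound. Truncating the values and multiplying by a cutoff in the norm makes the
  sequence dominated, so that it converges in the square norm.\<close>

lemma continuous_dense_L2:
  fixes f :: "'a::euclidean_space \<Rightarrow> real"
  assumes f: "sq_int lborel f" and supp: "\<And>x. 1 \<le> norm x \<Longrightarrow> f x = 0" and e: "0 < e"
  obtains g where "continuous_on UNIV g" "\<And>x. 2 \<le> norm x \<Longrightarrow> g x = 0"
    "sq_int lborel g" "(\<integral>x. (f x - g x)\<^sup>2 \<partial>lborel) < e"
proof -
  have [measurable]: "f \<in> borel_measurable borel" using f by (simp add: sq_int_def)
  have "\<forall>\<^sub>F k in sequentially. (\<integral>x. (clamp_real (real k) (f x) - f x)\<^sup>2 \<partial>lborel) < e / 4"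
    using order_tendstoD(2)[OF sq_int_truncate[OF f], of "e / 4"] e by simp
  then obtain k :: nat where k: "(\<integral>x. (clamp_real (real k) (f x) - f x)\<^sup>2 \<partial>lborel) < e / 4"
    by (auto simp: eventually_sequentially)
  define f1 where "f1 x = clamp_real (real k) (f x)" for x
  have f1[measurable]: "f1 \<in> borel_measurable borel"
    by (auto simp: f1_def[abs_def] clamp_real_def)
  have f1_bound: "\<bar>f1 x\<bar> \<le> real k" for x by (auto simp: f1_def clamp_real_def)
  have f1_supp: "f1 x = 0" if "1 \<le> norm x" for x using supp[OF that] by (auto simp: f1_def clamp_real_def)
  have "f1 \<in> borel_measurable lebesgue" using f1 by (simp add: measurable_completion)
  then have "f1 measurable_on UNIV"
    by (intro lebesgue_measurable_imp_measurable_on) auto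
  then obtain N h where N: "negligible N" and h: "\<And>n. continuous_on UNIV (h n)"
    and hlim: "\<And>x. x \<notin> N \<Longrightarrow> (\<lambda>n. h n x) \<longlonglongrightarrow> f1 x"
    by (auto simp: measurable_on_def)
  \<comment> \<open>The cutoff is 1 on the unit ball, outside which \<open>f1\<close> vanishes, and
    \<open>clamp_real\<close> fixes values bounded by \<open>k\<close>; so neither factor changes
    the limit.\<close>
  define g where "g n x = max 0 (min 1 (2 - norm x)) * clamp_real (real k) (h n x)" for n and x :: 'a
  have g_cont: "continuous_on UNIV (g n)" for n
    unfolding g_def clamp_real_def by (intro continuous_intros h)
  then have g_meas[measurable]: "g n \<in> borel_measurable borel" for n
    by (rule borel_measurable_continuous_onI)
  have g_supp: "g n x = 0" if "2 \<le> norm x" for n x using that by (simp add: g_def)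
  have g_bound: "\<bar>g n x\<bar> \<le> real k" for n x
  proof -
    have "\<bar>clamp_real (real k) (h n x)\<bar> \<le> real k" by (auto simp: clamp_real_def)
    moreover have "\<bar>max 0 (min 1 (2 - norm x))\<bar> \<le> 1" by auto
    ultimately have "\<bar>max 0 (min 1 (2 - norm x))\<bar> * \<bar>clamp_real (real k) (h n x)\<bar> \<le> 1 * real k"
      by (intro mult_mono) auto
    then show ?thesis unfolding g_def abs_mult by simp
  qed
  have sq: "(g n x)\<^sup>2 \<le> (real k)\<^sup>2" for n x
    using power_mono[OF g_bound[of n x], of 2] by simp
  have g_sq: "sq_int lborel (g n)" for n
    unfolding sq_int_def using sq g_supp
    by (auto intro!: integrable_bounded_support[where B = "(real k)\<^sup>2" and R = 2])
  have "(\<lambda>n. \<integral>x. (g n x - f1 x)\<^sup>2 \<partial>lborel) \<longlonglongrightarrow> (\<integral>x. 0 \<partial>(lborel::'a measure))"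
  proof (rule integral_dominated_convergence)
    show "integrable lborel (\<lambda>x::'a. (2 * real k)\<^sup>2 * indicator (cball 0 2) x)"
      using emeasure_bounded_finite[OF bounded_cball, of "0::'a" 2]
      by (intro integrable_mult_right integrable_real_indicator) auto
    have "AE x in lebesgue. x \<notin> N"
      using N by (simp add: AE_not_in negligible_iff_null_sets)
    then have "AE x in lborel. x \<notin> N" by (simp add: AE_completion_iff)
    then show "AE x in lborel. (\<lambda>n. (g n x - f1 x)\<^sup>2) \<longlonglongrightarrow> 0"
    proof (rule AE_mp, intro AE_I2 impI)
      fix x assume "x \<notin> N"
      have "(\<lambda>n. g n x) \<longlonglongrightarrow> max 0 (min 1 (2 - norm x)) * clamp_real (real k) (f1 x)"
        unfolding g_def clamp_real_def
        by (intro tendsto_intros hlim \<open>x \<notin> N\<close>)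
      also have "max 0 (min 1 (2 - norm x)) * clamp_real (real k) (f1 x) = f1 x"
        using f1_supp[of x] f1_bound[of x] by (cases "1 \<le> norm x") (auto simp: clamp_real_def)
      finally show "(\<lambda>n. (g n x - f1 x)\<^sup>2) \<longlonglongrightarrow> 0"
        by (auto intro!: tendsto_eq_intros)
    qed
    show "AE x in lborel. norm ((g n x - f1 x)\<^sup>2) \<le> (2 * real k)\<^sup>2 * indicator (cball 0 2) x" for n
    proof (rule AE_I2)
      fix x
      have "\<bar>g n x - f1 x\<bar> \<le> 2 * real k" using g_bound[of n x] f1_bound[of x] by linarith
      then have "(g n x - f1 x)\<^sup>2 \<le> (2 * real k)\<^sup>2" using power_mono[of "\<bar>g n x - f1 x\<bar>" "2 * real k" 2] by simp
      then show "norm ((g n x - f1 x)\<^sup>2) \<le> (2 * real k)\<^sup>2 * indicator (cball 0 2) x"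
        using g_supp[of x n] f1_supp[of x] by (auto simp: indicator_def)
    qed
  qed auto
  then have "\<forall>\<^sub>F n in sequentially. (\<integral>x. (g n x - f1 x)\<^sup>2 \<partial>lborel) < e / 4"
    using order_tendstoD(2)[of _ 0 _ "e / 4"] e by simp
  then obtain n where n: "(\<integral>x. (g n x - f1 x)\<^sup>2 \<partial>lborel) < e / 4"
    by (auto simp: eventually_sequentially)
  have sq1: "(f1 x)\<^sup>2 \<le> (real k)\<^sup>2" for x
    using power_mono[OF f1_bound[of x], of 2] by simp
  have f1_sq: "sq_int lborel f1"
    unfolding sq_int_def using f1_supp sq1
    by (auto intro!: integrable_bounded_support[where B = "(real k)\<^sup>2" and R = 1])
  have d: "sq_int lborel (\<lambda>x. f1 x - f x)" "sq_int lborel (\<lambda>x. g n x - f1 x)"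
    using sq_int_diff f f1_sq g_sq by blast+
  have "(\<integral>x. (f x - g n x)\<^sup>2 \<partial>lborel) \<le> (\<integral>x. 2 * (f1 x - f x)\<^sup>2 + 2 * (g n x - f1 x)\<^sup>2 \<partial>lborel)"
  proof (rule integral_mono)
    show "integrable lborel (\<lambda>x. (f x - g n x)\<^sup>2)" using sq_int_diff[OF f g_sq] by (simp add: sq_int_def)
    show "integrable lborel (\<lambda>x. 2 * (f1 x - f x)\<^sup>2 + 2 * (g n x - f1 x)\<^sup>2)"
      using d by (simp add: sq_int_def)
    have "(a - b)\<^sup>2 \<le> 2 * (c - a)\<^sup>2 + 2 * (b - c)\<^sup>2" for a b c :: real
      using zero_le_power2[of "(a - c) - (c - b)"] by (simp add: power2_eq_square algebra_simps)
    then show "(f x - g n x)\<^sup>2 \<le> 2 * (f1 x - f x)\<^sup>2 + 2 * (g n x - f1 x)\<^sup>2" for x .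
  qed
  also have "\<dots> < e"
    using d k n by (simp add: sq_int_def f1_def)
  finally show ?thesis using that g_cont g_supp g_sq by blast
qed

lemma L2_translation_continuous:
  fixes f :: "'a::euclidean_space \<Rightarrow> real"
  assumes f: "sq_int lborel f" and supp: "\<And>x. 1 \<le> norm x \<Longrightarrow> f x = 0" and e: "0 < e"
  obtains d where "0 < d" "\<And>z. norm z < d \<Longrightarrow> (\<integral>x. (f (x + z) - f x)\<^sup>2 \<partial>lborel) < e"
proof -
  obtain g where g: "continuous_on UNIV g" "\<And>x. 2 \<le> norm x \<Longrightarrow> g x = 0"
    "sq_int lborel g" "(\<integral>x. (f x - g x)\<^sup>2 \<partial>lborel) < e / 12"
    using continuous_dense_L2[OF f supp, of "e / 12"] e by auto
  define A where "A = measure lborel (cball (0::'a) 3)"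
  \<comment> \<open>The final estimate has three terms with coefficient 3. With each integral at
    most \<open>e / 12\<close> the total is at most \<open>3 * e / 4\<close>.\<close>
  define \<eta> where "\<eta> = sqrt (e / (12 * (A + 1)))"
  have A: "A \<ge> 0" by (simp add: A_def)
  have \<eta>: "\<eta> > 0" "\<eta>\<^sup>2 * A \<le> e / 12"
    using A e by (auto simp: \<eta>_def field_simps)
  \<comment> \<open>Radius 4 contains both \<open>x\<close> and \<open>x + z\<close> when
    \<open>norm x\<close> is at most 3 and \<open>norm z\<close> below 1; for larger
    \<open>norm x\<close> both values of \<open>g\<close> vanish.\<close>
  have "uniformly_continuous_on (cball 0 4) g"
    using g(1) by (intro compact_uniformly_continuous) (auto intro: continuous_on_subset)
  then obtain d where d: "d > 0"
    "\<And>x y. x \<in> cball 0 4 \<Longrightarrow> y \<in> cball 0 4 \<Longrightarrow> dist y x < d \<Longrightarrow> dist (g y) (g x) < \<eta>"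
    unfolding uniformly_continuous_on_def using \<eta>(1) by metis
  have "(\<integral>x. (f (x + z) - f x)\<^sup>2 \<partial>lborel) < e" if z: "norm z < min d 1" for z
  proof -
    have g_diff: "(g (x + z) - g x)\<^sup>2 \<le> \<eta>\<^sup>2 * indicator (cball 0 3) x" for x
    proof (cases "norm x \<le> 3")
      case True
      then have "dist (g (x + z)) (g x) < \<eta>"
        using z norm_triangle_ineq[of x z] by (intro d) (auto simp: dist_norm[of "x + z" x])
      then have "\<bar>g (x + z) - g x\<bar>\<^sup>2 \<le> \<eta>\<^sup>2" by (intro power_mono) (auto simp: dist_real_def)
      then show ?thesis using True by simp
    next
      case False
      then have "2 \<le> norm (x + z)" using z norm_triangle_ineq2[of x "- z"] by simp
      then show ?thesis using False by (simp add: g(2))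
    qed
    have s: "sq_int lborel (\<lambda>x. f x - g x)" "sq_int lborel (\<lambda>x. f (x + z) - g (x + z))"
      "sq_int lborel (\<lambda>x. g (x + z) - g x)" "sq_int lborel (\<lambda>x. f (x + z) - f x)"
      by (intro sq_int_diff sq_int_translation f g)+
    have "(\<integral>x. (f (x + z) - f x)\<^sup>2 \<partial>lborel) \<le>
      (\<integral>x. 3 * (f (x + z) - g (x + z))\<^sup>2 + 3 * (g (x + z) - g x)\<^sup>2 + 3 * (f x - g x)\<^sup>2 \<partial>lborel)"
    proof (rule integral_mono)
      have "(a - b)\<^sup>2 \<le> 3 * (a - c)\<^sup>2 + 3 * (c - d)\<^sup>2 + 3 * (b - d)\<^sup>2" for a b c d :: real
      proof -
        have "0 \<le> (p - q)\<^sup>2 + (q - r)\<^sup>2 + (p - r)\<^sup>2" for p q r :: real by simp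
        from this[of "a - c" "c - d" "d - b"] show ?thesis
          by (simp add: power2_eq_square algebra_simps)
      qed
      then show "(f (x + z) - f x)\<^sup>2 \<le>
          3 * (f (x + z) - g (x + z))\<^sup>2 + 3 * (g (x + z) - g x)\<^sup>2 + 3 * (f x - g x)\<^sup>2" for x .
    qed (use s in \<open>simp_all add: sq_int_def\<close>)
    also have "\<dots> = 3 * (\<integral>x. (f (x + z) - g (x + z))\<^sup>2 \<partial>lborel) + 3 * (\<integral>x. (g (x + z) - g x)\<^sup>2 \<partial>lborel)
        + 3 * (\<integral>x. (f x - g x)\<^sup>2 \<partial>lborel)"
      using s by (simp add: sq_int_def)
    also have "(\<integral>x. (f (x + z) - g (x + z))\<^sup>2 \<partial>lborel) = (\<integral>x. (f x - g x)\<^sup>2 \<partial>lborel)"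
      using f g(3) by (intro lborel_integral_translation[of "\<lambda>x. (f x - g x)\<^sup>2"]) (auto simp: sq_int_def)
    also have "(\<integral>x. (g (x + z) - g x)\<^sup>2 \<partial>lborel) \<le> (\<integral>x. \<eta>\<^sup>2 * indicator (cball (0::'a) 3) x \<partial>lborel)"
    proof (rule integral_mono)
      show "integrable lborel (\<lambda>x::'a. \<eta>\<^sup>2 * indicator (cball 0 3) x)"
        using emeasure_bounded_finite[OF bounded_cball, of "0::'a" 3]
        by (intro integrable_mult_right integrable_real_indicator) auto
    qed (use s g_diff in \<open>auto simp: sq_int_def\<close>)
    also have "\<dots> = \<eta>\<^sup>2 * A" by (simp add: A_def)
    finally show ?thesis using g(4) \<eta>(2) e by linarith
  qed
  with that[of "min d 1"] d(1) show ?thesis by simp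
qed

text \<open>Evenness turns \<open>\<kappa> (x - y)\<close>, as a function of \<open>y\<close>, into
  a translate of \<kappa>, so its mass and integrability follow from translation invariance.\<close>

locale mollifier =
  fixes \<kappa> :: "'a::euclidean_space \<Rightarrow> real" and e B :: real
  assumes continuous: "continuous_on UNIV \<kappa>"
    and nonneg: "\<And>x. 0 \<le> \<kappa> x" and le_B: "\<And>x. \<kappa> x \<le> B"
    and even: "\<And>x. \<kappa> (- x) = \<kappa> x" and support: "\<And>x. e \<le> norm x \<Longrightarrow> \<kappa> x = 0"
    and integral_1: "(\<integral>x. \<kappa> x \<partial>lborel) = 1"
begin

definition smooth :: "('a \<Rightarrow> real) \<Rightarrow> 'a \<Rightarrow> real" where
  "smooth f x = (\<integral>y. \<kappa> (x - y) * f y \<partial>lborel)"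

lemma measurable_kernel[measurable]: "\<kappa> \<in> borel_measurable borel"
  by (rule borel_measurable_continuous_onI[OF continuous])

lemma abs_le_B: "\<bar>\<kappa> x\<bar> \<le> B"
  using nonneg le_B by simp

lemma integrable_kernel: "integrable lborel \<kappa>"
  using integral_1 not_integrable_integral_eq by fastforce

lemma kernel_diff_commute: "\<kappa> (x - y) = \<kappa> (y + (- x))"
  using even[of "x - y"] by simp

lemma integral_kernel_diff: "(\<integral>y. \<kappa> (x - y) \<partial>lborel) = 1" "integrable lborel (\<lambda>y. \<kappa> (x - y))"
  unfolding kernel_diff_commute
  using lborel_integral_translation[of \<kappa> "- x"] lborel_integrable_translation[OF integrable_kernel, of "- x"] integral_1
  by (auto simp del: add_uminus_conv_diff)

lemma integrable_kernel_mult: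
  assumes "integrable lborel f"
  shows "integrable lborel (\<lambda>y. \<kappa> (x - y) * f y)"
proof (rule Bochner_Integration.integrable_bound)
  show "integrable lborel (\<lambda>y. B * f y)" using assms by simp
  show "AE y in lborel. norm (\<kappa> (x - y) * f y) \<le> norm (B * f y)"
    using order_trans[OF nonneg le_B] by (auto simp: abs_mult intro!: mult_right_mono abs_le_B)
qed (use assms in auto)

lemma smooth_measurable[measurable]:
  assumes [measurable]: "f \<in> borel_measurable borel"
  shows "smooth f \<in> borel_measurable borel"
proof -
  have "(\<lambda>x. \<integral>y. (\<lambda>(x, y). \<kappa> (x - y) * f y) (x, y) \<partial>lborel) \<in> borel_measurable lborel"
    by (rule lborel.borel_measurable_lebesgue_integral) measurable
  then show ?thesis by (simp add: smooth_def[abs_def])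
qed

text \<open>The squared error at \<open>x\<close> is at most the kernel average of
  \<open>(f y - f x)\<^sup>2\<close>. Integrating in \<open>x\<close> and writing
  \<open>x = y + z\<close> leaves, for each shift \<open>z\<close> in the support, the translation
  error of \<open>f\<close>; the kernel has mass 1.\<close>

lemma smooth_L2_dist:
  assumes f: "sq_int lborel f" "integrable lborel f"
    and W: "\<And>z. norm z < e \<Longrightarrow> (\<integral>x. (f (x + z) - f x)\<^sup>2 \<partial>lborel) \<le> W"
  shows "sq_int lborel (\<lambda>x. smooth f x - f x)" "(\<integral>x. (smooth f x - f x)\<^sup>2 \<partial>lborel) \<le> W"
proof -
  have [measurable]: "f \<in> borel_measurable borel" using f by (simp add: sq_int_def)
  have f2: "integrable lborel (\<lambda>x. (f x)\<^sup>2)" using f by (simp add: sq_int_def)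
  have pointwise: "ennreal ((smooth f x - f x)\<^sup>2) \<le> (\<integral>\<^sup>+y. ennreal (\<kappa> (x - y) * (f y - f x)\<^sup>2) \<partial>lborel)" for x
  proof -
    define m where "m = smooth f x"
    note ii = integrable_kernel_mult[OF f2, of x] integrable_kernel_mult[OF f(2), of x] integral_kernel_diff(2)[of x]
    have eq: "\<kappa> (x - y) * (f y - a)\<^sup>2 = \<kappa> (x - y) * (f y)\<^sup>2 - 2 * a * (\<kappa> (x - y) * f y) + a\<^sup>2 * \<kappa> (x - y)" for a y
      by (simp add: power2_eq_square algebra_simps)
    have int: "integrable lborel (\<lambda>y. \<kappa> (x - y) * (f y - a)\<^sup>2)" for a
      unfolding eq using ii by simp
    have val: "(\<integral>y. \<kappa> (x - y) * (f y - a)\<^sup>2 \<partial>lborel) = (\<integral>y. \<kappa> (x - y) * (f y)\<^sup>2 \<partial>lborel) - 2 * a * m + a\<^sup>2" for a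
      unfolding eq using ii by (simp add: integral_kernel_diff m_def smooth_def)
    \<comment> \<open>Jensen's inequality as nonnegativity of a variance: by \<open>val\<close> at
      the mean \<open>m\<close>, the average of the squares is at least
      \<open>m\<^sup>2\<close>.\<close>
    have "0 \<le> (\<integral>y. \<kappa> (x - y) * (f y - m)\<^sup>2 \<partial>lborel)"
      by (rule integral_nonneg_AE) (simp add: nonneg)
    then have "(m - f x)\<^sup>2 \<le> (\<integral>y. \<kappa> (x - y) * (f y - f x)\<^sup>2 \<partial>lborel)"
      unfolding val by (simp add: power2_eq_square algebra_simps)
    then show ?thesis
      using int nonneg by (subst nn_integral_eq_integral) (auto simp: m_def intro: ennreal_leI)
  qed
  have "(\<integral>\<^sup>+x. ennreal ((smooth f x - f x)\<^sup>2) \<partial>lborel)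
      \<le> (\<integral>\<^sup>+x. \<integral>\<^sup>+y. ennreal (\<kappa> (x - y) * (f y - f x)\<^sup>2) \<partial>lborel \<partial>lborel)"
    by (intro nn_integral_mono pointwise)
  also have "\<dots> = (\<integral>\<^sup>+y. \<integral>\<^sup>+x. ennreal (\<kappa> (x - y) * (f y - f x)\<^sup>2) \<partial>lborel \<partial>lborel)"
    by (rule lborel_pair.Fubini') measurable
  also have "\<dots> = (\<integral>\<^sup>+y. \<integral>\<^sup>+z. ennreal (\<kappa> z * (f y - f (y + z))\<^sup>2) \<partial>lborel \<partial>lborel)"
  proof (rule nn_integral_cong)
    fix y
    show "(\<integral>\<^sup>+x. ennreal (\<kappa> (x - y) * (f y - f x)\<^sup>2) \<partial>lborel) = (\<integral>\<^sup>+z. ennreal (\<kappa> z * (f y - f (y + z))\<^sup>2) \<partial>lborel)"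
      by (subst lborel_nn_integral_translation[symmetric, of _ y]) (auto simp: add.commute)
  qed
  also have "\<dots> = (\<integral>\<^sup>+z. \<integral>\<^sup>+y. ennreal (\<kappa> z * (f y - f (y + z))\<^sup>2) \<partial>lborel \<partial>lborel)"
    by (rule lborel_pair.Fubini') measurable
  also have "\<dots> \<le> (\<integral>\<^sup>+z. ennreal W * ennreal (\<kappa> z) \<partial>lborel)"
  proof (rule nn_integral_mono)
    fix z :: 'a
    show "(\<integral>\<^sup>+y. ennreal (\<kappa> z * (f y - f (y + z))\<^sup>2) \<partial>lborel) \<le> ennreal W * ennreal (\<kappa> z)"
    proof (cases "norm z < e")
      case True
      have "(\<integral>\<^sup>+y. ennreal (\<kappa> z * (f y - f (y + z))\<^sup>2) \<partial>lborel) = ennreal (\<kappa> z) * (\<integral>\<^sup>+y. ennreal ((f (y + z) - f y)\<^sup>2) \<partial>lborel)"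
        by (subst nn_integral_cmult[symmetric]) (auto simp: nonneg ennreal_mult power2_commute)
      also have "(\<integral>\<^sup>+y. ennreal ((f (y + z) - f y)\<^sup>2) \<partial>lborel) = ennreal (\<integral>y. (f (y + z) - f y)\<^sup>2 \<partial>lborel)"
        using sq_int_diff[OF sq_int_translation[OF f(1), of z] f(1)]
        by (intro nn_integral_eq_integral) (auto simp: sq_int_def)
      also have "ennreal (\<kappa> z) * ennreal (\<integral>y. (f (y + z) - f y)\<^sup>2 \<partial>lborel) \<le> ennreal (\<kappa> z) * ennreal W"
        by (intro mult_left_mono ennreal_leI W True) simp
      finally show ?thesis by (simp add: mult.commute)
    next
      case False
      then show ?thesis by (simp add: support)
    qed
  qed
  also have "\<dots> = ennreal W"
    using integrable_kernel by (simp add: nn_integral_cmult nn_integral_eq_integral nonneg integral_1)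
  finally have *: "(\<integral>\<^sup>+x. ennreal ((smooth f x - f x)\<^sup>2) \<partial>lborel) \<le> ennreal W" .
  have int: "integrable lborel (\<lambda>x. (smooth f x - f x)\<^sup>2)"
    by (rule integrableI_bounded) (use * le_less_trans[OF _ ennreal_less_top] in auto)
  then show "sq_int lborel (\<lambda>x. smooth f x - f x)"
    by (simp add: sq_int_def)
  show "(\<integral>x. (smooth f x - f x)\<^sup>2 \<partial>lborel) \<le> W"
  proof (cases "e > 0")
    case True
    have "0 \<le> (\<integral>x. (f (x + 0) - f x)\<^sup>2 \<partial>lborel)" by simp
    then have "0 \<le> W" using W[of 0] True by simp
    with * int show ?thesis by (simp add: nn_integral_eq_integral)
  next
    \<comment> \<open>A nonpositive width would force the kernel to vanish everywhere, against its
      mass 1.\<close>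
    case False
    then have "\<kappa> = (\<lambda>x. 0)" using support by (metis le_less_linear norm_ge_zero order_trans)
    then show ?thesis using integral_1 by simp
  qed
qed

end

locale smooth_mollifier = mollifier \<kappa> e B for \<kappa> :: "'a::euclidean_space \<Rightarrow> real" and e B +
  fixes \<kappa>' :: "'a \<Rightarrow> 'a \<Rightarrow> real" and L :: real
  assumes derivative: "\<And>x. (\<kappa> has_derivative \<kappa>' x) (at x)"
    and derivative_le: "\<And>x h. \<bar>\<kappa>' x h\<bar> \<le> L * norm h"
    and derivative_cont: "\<And>b. continuous_on UNIV (\<lambda>x. \<kappa>' x b)"
begin

lemma measurable_derivative[measurable]: "(\<lambda>x. \<kappa>' x b) \<in> borel_measurable borel"
  by (rule borel_measurable_continuous_onI[OF derivative_cont])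

lemma derivative_linear: "linear (\<kappa>' x)"
  using derivative has_derivative_linear by blast

lemma kernel_lipschitz: "\<bar>\<kappa> x - \<kappa> y\<bar> \<le> L * norm (x - y)"
proof -
  have "norm (\<kappa> x - \<kappa> y) \<le> L * norm (x - y)"
  proof (rule differentiable_bound[OF convex_UNIV])
    show "(\<kappa> has_derivative \<kappa>' z) (at z within UNIV)" for z using derivative by simp
    show "onorm (\<kappa>' z) \<le> L" for z by (rule onorm_le) (use derivative_le in auto)
  qed auto
  then show ?thesis by simp
qed

lemma integrable_derivative_mult:
  assumes "integrable lborel f"
  shows "integrable lborel (\<lambda>y. \<kappa>' (x - y) h * f y)"
proof (rule Bochner_Integration.integrable_bound)
  show "integrable lborel (\<lambda>y. (L * norm h) * f y)" using assms by simp
  have "\<bar>\<kappa>' (x - y) h\<bar> \<le> \<bar>L\<bar> * norm h" for y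
    by (rule order_trans[OF derivative_le]) (auto intro!: mult_right_mono)
  then show "AE y in lborel. norm (\<kappa>' (x - y) h * f y) \<le> norm ((L * norm h) * f y)"
    by (auto simp: abs_mult intro!: AE_I2 mult_right_mono)
qed (use assms in auto)

text \<open>Differentiation under the integral sign, tested along sequences so that dominated
  convergence applies: the Lipschitz constant of the kernel and the bound on its derivative dominate
  the quotients by \<open>2 * L * \<bar>f y\<bar>\<close>.\<close>

lemma smooth_has_derivative:
  assumes f: "integrable lborel f"
  shows "(smooth f has_derivative (\<lambda>h. \<integral>y. \<kappa>' (x - y) h * f y \<partial>lborel)) (at x)"
proof -
  have [measurable]: "f \<in> borel_measurable borel" using f by auto
  define D where "D h = (\<integral>y. \<kappa>' (x - y) h * f y \<partial>lborel)" for h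
  have lin: "linear D"
  proof
    show "D (a + b) = D a + D b" for a b
      using integrable_derivative_mult[OF f]
      by (simp add: D_def linear_add[OF derivative_linear] distrib_right)
    show "D (r *\<^sub>R b) = r *\<^sub>R D b" for r b
      by (simp add: D_def linear_cmul[OF derivative_linear] mult.assoc)
  qed
  have "((\<lambda>y. norm (smooth f y - smooth f x - D (y - x)) / norm (y - x)) \<longlongrightarrow> 0) (at x)"
    unfolding tendsto_at_iff_sequentially comp_def
  proof (intro allI impI)
    fix X assume X: "\<forall>i. X i \<in> UNIV - {x}" "X \<longlonglongrightarrow> x"
    define q where "q i y = (\<kappa> (X i - y) - \<kappa> (x - y) - \<kappa>' (x - y) (X i - x)) / norm (X i - x) * f y" for i y
    have q_int: "integrable lborel (q i)" for i
    proof -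
      have "integrable lborel (\<lambda>y. (\<kappa> (X i - y) * f y - \<kappa> (x - y) * f y - \<kappa>' (x - y) (X i - x) * f y) / norm (X i - x))"
        by (intro integrable_divide Bochner_Integration.integrable_diff integrable_kernel_mult integrable_derivative_mult f)
      then show ?thesis by (simp add: q_def[abs_def] field_simps)
    qed
    have q_val: "(\<integral>y. q i y \<partial>lborel) = (smooth f (X i) - smooth f x - D (X i - x)) / norm (X i - x)" for i
    proof -
      have "(\<integral>y. q i y \<partial>lborel) = (\<integral>y. (\<kappa> (X i - y) * f y - \<kappa> (x - y) * f y - \<kappa>' (x - y) (X i - x) * f y) / norm (X i - x) \<partial>lborel)"
        by (simp add: q_def field_simps)
      also have "\<dots> = (smooth f (X i) - smooth f x - D (X i - x)) / norm (X i - x)"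
        using integrable_kernel_mult[OF f] integrable_derivative_mult[OF f]
        by (simp add: smooth_def D_def)
      finally show ?thesis .
    qed
    have "(\<lambda>i. \<integral>y. q i y \<partial>lborel) \<longlonglongrightarrow> (\<integral>y. 0 \<partial>(lborel :: 'a measure))"
    proof (rule integral_dominated_convergence)
      show "integrable lborel (\<lambda>y. 2 * L * \<bar>f y\<bar>)" using f by simp
      show "AE y in lborel. norm (q i y) \<le> 2 * L * \<bar>f y\<bar>" for i
      proof (rule AE_I2)
        fix y
        have n: "norm (X i - x) > 0" using X by simp
        have "\<bar>\<kappa> (X i - y) - \<kappa> (x - y) - \<kappa>' (x - y) (X i - x)\<bar> \<le> 2 * L * norm (X i - x)"
          using kernel_lipschitz[of "X i - y" "x - y"] derivative_le[of "x - y" "X i - x"] by simp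
        then have "\<bar>\<kappa> (X i - y) - \<kappa> (x - y) - \<kappa>' (x - y) (X i - x)\<bar> / norm (X i - x) \<le> 2 * L"
          using n by (simp add: pos_divide_le_eq)
        from mult_right_mono[OF this, of "\<bar>f y\<bar>"] show "norm (q i y) \<le> 2 * L * \<bar>f y\<bar>"
          by (simp add: q_def abs_mult)
      qed
      show "AE y in lborel. (\<lambda>i. q i y) \<longlonglongrightarrow> 0"
      proof (rule AE_I2)
        fix y
        have "((\<lambda>z. norm (\<kappa> z - \<kappa> (x - y) - \<kappa>' (x - y) (z - (x - y))) / norm (z - (x - y))) \<longlongrightarrow> 0) (at (x - y))"
          using derivative[of "x - y"] by (simp add: has_derivative_iff_norm)
        moreover have "filterlim (\<lambda>i. X i - y) (at (x - y)) sequentially"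
          using X by (intro filterlim_atI tendsto_intros) auto
        ultimately have "(\<lambda>i. norm (\<kappa> (X i - y) - \<kappa> (x - y) - \<kappa>' (x - y) (X i - x)) / norm (X i - x)) \<longlonglongrightarrow> 0"
          using filterlim_compose by fastforce
        from tendsto_mult_right_zero[OF this, of "\<bar>f y\<bar>"] have "(\<lambda>i. \<bar>q i y\<bar>) \<longlonglongrightarrow> 0"
          by (simp add: q_def abs_mult mult.commute)
        then show "(\<lambda>i. q i y) \<longlonglongrightarrow> 0" by (rule tendsto_rabs_zero_cancel)
      qed
    qed (auto intro: borel_measurable_integrable[OF q_int, simplified])
    then have "(\<lambda>i. \<bar>\<integral>y. q i y \<partial>lborel\<bar>) \<longlonglongrightarrow> 0" by (auto intro!: tendsto_eq_intros)
    then show "(\<lambda>i. norm (smooth f (X i) - smooth f x - D (X i - x)) / norm (X i - x)) \<longlonglongrightarrow> 0"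
      unfolding q_val by simp
  qed
  with lin show ?thesis
    unfolding D_def[symmetric, abs_def] has_derivative_iff_norm
    by (simp add: linear_conv_bounded_linear)
qed

lemma smooth_continuous: "integrable lborel f \<Longrightarrow> continuous_on UNIV (smooth f)"
  by (meson continuous_at_imp_continuous_on has_derivative_continuous smooth_has_derivative)

end

lemma bump_continuous: "continuous_on UNIV (bump e :: 'a::euclidean_space \<Rightarrow> real)"
proof -
  have "bump_alg (bump e :: 'a \<Rightarrow> real)"
    using bump_alg_bump[of e 0] by (simp add: bump_minus)
  then show ?thesis using bump_alg_C_k[of "bump e :: 'a \<Rightarrow> real" 0] by simp
qed

lemma smooth_mollifier_bump:
  assumes e: "0 < e"
  obtains c B \<kappa>' L where "smooth_mollifier (\<lambda>x::'a::euclidean_space. c * bump e x) e B \<kappa>' L"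
proof -
  let ?b = "bump e :: 'a \<Rightarrow> real"
  have [measurable]: "?b \<in> borel_measurable borel"
    by (rule borel_measurable_continuous_onI[OF bump_continuous])
  have le1: "bump e x \<le> 1" for x :: 'a
    by (auto simp: bump_def flat_def)
  have int: "integrable lborel ?b"
    using le1 bump_nonneg[of e] bump_eq_0_iff[OF e, THEN iffD2, OF less_imp_le]
    by (intro integrable_bounded_support[where B = 1 and R = e]) (auto simp: abs_of_nonneg[OF bump_nonneg])
  have pos: "(\<integral>x. ?b x \<partial>lborel) > 0"
  proof -
    \<comment> \<open>If the integral vanished, the bump would be zero almost everywhere and the
      open ball on which it is positive would be negligible.\<close>
    have "(\<integral>x. ?b x \<partial>lborel) \<noteq> 0"
    proof
      assume "(\<integral>x. ?b x \<partial>lborel) = 0"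
      then have "AE x in lborel. ?b x = 0"
        using int by (subst (asm) integral_nonneg_eq_0_iff_AE) (auto simp: bump_nonneg)
      then have "AE x in lborel. x \<notin> ball (0::'a) e"
        by eventually_elim (auto simp: bump_eq_0_iff[OF e])
      then have "ball (0::'a) e \<in> null_sets lborel"
        by (subst (asm) AE_iff_null_sets[symmetric]) auto
      then have "negligible (ball (0::'a) e)"
        by (simp add: negligible_iff_null_sets null_sets_completionI)
      then show False using e open_not_negligible[of "ball (0::'a) e"] by simp
    qed
    moreover have "(\<integral>x. ?b x \<partial>lborel) \<ge> 0" by (rule integral_nonneg_AE) (simp add: bump_nonneg)
    ultimately show ?thesis by simp
  qed
  define c where "c = 1 / (\<integral>x. ?b x \<partial>lborel)"
  have c: "c > 0" using pos by (simp add: c_def)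
  define k where "k x = c * ?b x" for x
  have "bump_alg k"
    using bump_alg.mult[OF bump_alg.const[of c] bump_alg_bump[of e 0]]
    by (simp add: bump_minus k_def[abs_def])
  from bump_alg_derivative[OF this]
  obtain k' where k': "\<And>x. (k has_derivative k' x) (at x)" "\<And>b. bump_alg (\<lambda>x. k' x b)"
    by blast
  have cont: "continuous_on UNIV (\<lambda>x. k' x b)" for b
    using bump_alg_C_k[OF k'(2), of 0 b] by simp
  have zero: "k' x b = 0" if "e < norm x" for x b
  proof -
    have k0: "k y = 0" if "y \<in> - cball 0 e" for y
      using that bump_eq_0_iff[OF e, of y] by (simp add: k_def not_le)
    have op: "open (- cball (0::'a) e)" and mem: "x \<in> - cball 0 e" using that by auto
    have "((\<lambda>x. 0) has_derivative k' x) (at x)"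
      using has_derivative_transform_within_open[OF k'(1)[of x] op mem k0] .
    then have "k' x = (\<lambda>h. 0)"
      by (rule has_derivative_unique) simp
    then show ?thesis by simp
  qed
  have "\<exists>M. \<forall>x. \<bar>k' x b\<bar> \<le> M" for b
  proof -
    have "compact ((\<lambda>x. k' x b) ` cball 0 e)"
      by (intro compact_continuous_image continuous_on_subset[OF cont]) auto
    then have "bounded ((\<lambda>x. k' x b) ` cball 0 e)" by (rule compact_imp_bounded)
    then obtain M where M: "\<forall>x\<in>cball 0 e. \<bar>k' x b\<bar> \<le> M"
      by (auto simp: bounded_iff)
    moreover have "0 \<le> M"
      using M[rule_format, of 0] e abs_ge_zero[of "k' 0 b"] by simp
    ultimately have "\<bar>k' x b\<bar> \<le> M" for x using zero[of x b] by (cases "norm x \<le> e") auto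
    then show ?thesis by blast
  qed
  then have "\<forall>b. \<exists>M. \<forall>x. \<bar>k' x b\<bar> \<le> M" by blast
  from choice[OF this] obtain M where M: "\<And>b x. \<bar>k' x b\<bar> \<le> M b" by blast
  have bd: "\<bar>k' x h\<bar> \<le> (\<Sum>b\<in>Basis. M b) * norm h" for x h
  proof -
    have lin: "linear (k' x)" using k'(1) has_derivative_linear by blast
    have "k' x h = k' x (\<Sum>b\<in>Basis. (h \<bullet> b) *\<^sub>R b)" by (simp add: euclidean_representation)
    also have "\<dots> = (\<Sum>b\<in>Basis. (h \<bullet> b) * k' x b)"
      by (simp add: linear_sum[OF lin] linear_cmul[OF lin])
    finally have "\<bar>k' x h\<bar> \<le> (\<Sum>b\<in>Basis. \<bar>(h \<bullet> b) * k' x b\<bar>)" by (simp add: sum_abs)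
    also have "\<dots> \<le> (\<Sum>b\<in>Basis. norm h * M b)"
      unfolding abs_mult by (intro sum_mono mult_mono M Basis_le_norm) auto
    also have "\<dots> = (\<Sum>b\<in>Basis. M b) * norm h"
      by (subst sum_distrib_left[symmetric]) (rule mult.commute)
    finally show ?thesis .
  qed
  have "smooth_mollifier k e c k' (\<Sum>b\<in>Basis. M b)"
  proof
    show "continuous_on UNIV k" unfolding k_def by (intro continuous_intros bump_continuous)
    show "(\<integral>x. k x \<partial>lborel) = 1" using pos by (simp add: k_def c_def)
    show "0 \<le> k x" "k x \<le> c" "k (- x) = k x" for x
      using c le1[of x] by (auto simp: k_def bump_nonneg bump_minus)
    show "k x = 0" if "e \<le> norm x" for x using that bump_eq_0_iff[OF e, of x] by (simp add: k_def)
  qed (fact k' bd cont)+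
  then show ?thesis using that by (simp add: k_def[abs_def])
qed

section \<open>Borel representatives of functions on the ball\<close>

abbreviation ball_measure :: "'a::euclidean_space measure" where
  "ball_measure \<equiv> lebesgue_on (ball 0 1)"

lemma finite_ball_measure: "finite_measure (ball_measure :: 'a::euclidean_space measure)"
  by (rule finite_measure_lebesgue_on) simp

text \<open>Fubini and translations are used over \<open>lborel\<close>, whereas functions on the
  ball are only Lebesgue measurable. A Borel function that agrees almost everywhere and is extended
  by zero makes both available.\<close>

lemma borel_representative:
  fixes f :: "'a::euclidean_space \<Rightarrow> real"
  assumes f: "f \<in> borel_measurable ball_measure"
  obtains f0 where "f0 \<in> borel_measurable borel" "\<And>x. 1 \<le> norm x \<Longrightarrow> f0 x = 0"
    "AE x in ball_measure. f0 x = f x"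
proof -
  have "(\<lambda>x. if x \<in> ball 0 1 then f x else 0) \<in> borel_measurable lebesgue"
    using f by (intro borel_measurable_if_I) auto
  then obtain g where g: "g \<in> borel_measurable lborel"
    "AE x in lborel. (if x \<in> ball 0 1 then f x else 0) = g x"
    using completion_ex_borel_measurable_real by blast
  define f0 where "f0 x = indicator (ball 0 1) x * g x" for x
  have "f0 \<in> borel_measurable borel" using g(1) by (auto simp: f0_def[abs_def] intro!: borel_measurable_times borel_measurable_indicator)
  moreover have "f0 x = 0" if "1 \<le> norm x" for x using that by (simp add: f0_def)
  moreover have "AE x in ball_measure. f0 x = f x"
    using AE_completion[OF g(2)]
    by (subst AE_restrict_space_iff) (auto simp: f0_def elim!: AE_mp)
  ultimately show ?thesis using that by blast
qed

lemma ball_measure_borel: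
  fixes f :: "'a::euclidean_space \<Rightarrow> real"
  assumes [measurable]: "f \<in> borel_measurable borel" and supp: "\<And>x. 1 \<le> norm x \<Longrightarrow> f x = 0"
  shows "integrable ball_measure f \<longleftrightarrow> integrable lborel f"
    "(\<integral>x. f x \<partial>ball_measure) = (\<integral>x. f x \<partial>lborel)"
proof -
  have eq: "(\<lambda>x. indicator (ball 0 1) x *\<^sub>R f x) = f"
    using supp by (auto simp: indicator_def fun_eq_iff)
  show "integrable ball_measure f \<longleftrightarrow> integrable lborel f"
    using eq by (simp add: integrable_restrict_space integrable_completion)
  show "(\<integral>x. f x \<partial>ball_measure) = (\<integral>x. f x \<partial>lborel)"
    using eq by (simp add: integral_restrict_space integral_completion)
qed

lemma sq_int_ball_measure:
  fixes f :: "'a::euclidean_space \<Rightarrow> real"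
  assumes "sq_int lborel f"
  shows "sq_int ball_measure f" "(\<integral>x. (f x)\<^sup>2 \<partial>ball_measure) \<le> (\<integral>x. (f x)\<^sup>2 \<partial>lborel)"
proof -
  have [measurable]: "f \<in> borel_measurable borel" using assms by (simp add: sq_int_def)
  have int: "integrable lborel (\<lambda>x. indicator (ball 0 1) x * (f x)\<^sup>2)"
    using integrable_mult_indicator[of "ball 0 1" lborel "\<lambda>x. (f x)\<^sup>2"] assms by (simp add: sq_int_def)
  have "integrable ball_measure (\<lambda>x. (f x)\<^sup>2)"
    using int by (simp add: integrable_restrict_space integrable_completion)
  moreover have "f \<in> borel_measurable ball_measure"
    by (simp add: measurable_completion measurable_restrict_space1)
  ultimately show "sq_int ball_measure f" by (simp add: sq_int_def)
  have "(\<integral>x. (f x)\<^sup>2 \<partial>ball_measure) = (\<integral>x. indicator (ball 0 1) x * (f x)\<^sup>2 \<partial>lborel)"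
    by (subst integral_restrict_space, simp, subst integral_completion)
      (auto intro!: borel_measurable_times borel_measurable_indicator borel_measurable_power)
  also have "\<dots> \<le> (\<integral>x. (f x)\<^sup>2 \<partial>lborel)"
    using assms int by (intro integral_mono) (auto simp: sq_int_def indicator_def)
  finally show "(\<integral>x. (f x)\<^sup>2 \<partial>ball_measure) \<le> (\<integral>x. (f x)\<^sup>2 \<partial>lborel)" .
qed

lemma sq_int_representative:
  fixes f :: "'a::euclidean_space \<Rightarrow> real"
  assumes f: "sq_int ball_measure f"
  obtains f0 where "sq_int lborel f0" "integrable lborel f0" "\<And>x. 1 \<le> norm x \<Longrightarrow> f0 x = 0"
    "AE x in ball_measure. f0 x = f x"
proof -
  obtain f0 where f0: "f0 \<in> borel_measurable borel" "\<And>x. 1 \<le> norm x \<Longrightarrow> f0 x = 0"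
    "AE x in ball_measure. f0 x = f x"
    using borel_representative f by (metis sq_int_measurable)
  have m: "f0 \<in> borel_measurable ball_measure"
    using f0(1) by (simp add: measurable_completion measurable_restrict_space1)
  have "integrable ball_measure f"
    using sq_int_integrable[OF f finite_ball_measure] .
  then have "integrable ball_measure f0"
    using integrable_cong_AE[OF m _ f0(3)] by blast
  then have 1: "integrable lborel f0" using ball_measure_borel(1)[OF f0(1,2)] by simp
  have "AE x in ball_measure. (f0 x)\<^sup>2 = (f x)\<^sup>2" using f0(3) by eventually_elim simp
  then have "integrable ball_measure (\<lambda>x. (f0 x)\<^sup>2)"
    using f m integrable_cong_AE[of "\<lambda>x. (f0 x)\<^sup>2" ball_measure "\<lambda>x. (f x)\<^sup>2"]
    by (auto simp: sq_int_def)
  then have 2: "sq_int lborel f0"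
    using ball_measure_borel(1)[of "\<lambda>x. (f0 x)\<^sup>2"] f0(1,2) by (simp add: sq_int_def)
  from that[OF 2 1 f0(2,3)] show ?thesis .
qed

section \<open>Smooth approximation of weakly differentiable functions\<close>

text \<open>Test the weak gradient with \<open>\<kappa> (x - y)\<close> as a function of
  \<open>y\<close>. Differentiating in \<open>y\<close> produces a minus sign, which cancels the one
  in \<open>has_weak_grad\<close>; the claim is the component along \<open>b\<close>.\<close>

lemma weak_grad_mollified:
  fixes u :: "'a::euclidean_space \<Rightarrow> real" and G :: "'a \<Rightarrow> 'a"
  assumes wg: "has_weak_grad u G" and u: "integrable ball_measure u"
    and G: "\<And>b. b \<in> Basis \<Longrightarrow> integrable ball_measure (\<lambda>x. G x \<bullet> b)"
    and "smooth_mollifier \<kappa> e B \<kappa>' L" and test: "test_function (\<lambda>y. \<kappa> (x - y))" and b: "b \<in> Basis"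
  shows "(\<integral>y. \<kappa>' (x - y) b * u y \<partial>ball_measure) = (\<integral>y. \<kappa> (x - y) * (G y \<bullet> b) \<partial>ball_measure)"
proof -
  interpret smooth_mollifier \<kappa> e B \<kappa>' L by fact
  let ?\<phi> = "\<lambda>y. \<kappa> (x - y)"
  have "(?\<phi> has_derivative (\<lambda>h. \<kappa>' (x - y) (- h))) (at y)" for y
    by (rule has_derivative_compose[OF _ derivative]) (auto intro!: derivative_eq_intros)
  then have fd: "frechet_derivative ?\<phi> (at y) = (\<lambda>h. \<kappa>' (x - y) (- h))" for y
    using frechet_derivative_at by metis
  have egrad: "egrad ?\<phi> y = (\<Sum>c\<in>Basis. (- \<kappa>' (x - y) c) *\<^sub>R c)" for y
    by (simp add: egrad_def fd linear_neg[OF derivative_linear])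
  have int1: "integrable ball_measure (\<lambda>y. \<kappa>' (x - y) c * u y)" for c
  proof (rule Bochner_Integration.integrable_bound)
    show "integrable ball_measure (\<lambda>y. (\<bar>L\<bar> * norm c) * u y)" using u by simp
    have "(\<lambda>y. \<kappa>' (x - y) c) \<in> borel_measurable ball_measure"
      by (rule measurable_restrict_space1, rule measurable_completion) simp
    then show "(\<lambda>y. \<kappa>' (x - y) c * u y) \<in> borel_measurable ball_measure"
      using u by (intro borel_measurable_times) auto
    have "\<bar>\<kappa>' (x - y) c\<bar> \<le> \<bar>L\<bar> * norm c" for y
      by (rule order_trans[OF derivative_le]) (auto intro!: mult_right_mono)
    then show "AE y in ball_measure. norm (\<kappa>' (x - y) c * u y) \<le> norm ((\<bar>L\<bar> * norm c) * u y)"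
      by (auto simp: abs_mult intro!: AE_I2 mult_right_mono)
  qed
  have int2: "integrable ball_measure (\<lambda>y. \<kappa> (x - y) * (G y \<bullet> c))" if "c \<in> Basis" for c
  proof (rule Bochner_Integration.integrable_bound)
    show "integrable ball_measure (\<lambda>y. B * (G y \<bullet> c))" using G[OF that] by simp
    have "(\<lambda>y. \<kappa> (x - y)) \<in> borel_measurable ball_measure"
      by (rule measurable_restrict_space1, rule measurable_completion) simp
    then show "(\<lambda>y. \<kappa> (x - y) * (G y \<bullet> c)) \<in> borel_measurable ball_measure"
      using G[OF that] by (intro borel_measurable_times) auto
    show "AE y in ball_measure. norm (\<kappa> (x - y) * (G y \<bullet> c)) \<le> norm (B * (G y \<bullet> c))"
      by (auto simp: abs_mult intro!: AE_I2 mult_right_mono order_trans[OF abs_le_B abs_ge_self])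
  qed
  have "(\<integral>y. u y *\<^sub>R egrad ?\<phi> y \<partial>ball_measure)
      = (\<integral>y. (\<Sum>c\<in>Basis. (- (\<kappa>' (x - y) c * u y)) *\<^sub>R c) \<partial>ball_measure)"
    by (simp add: egrad scaleR_sum_right mult.commute)
  also have "\<dots> = (\<Sum>c\<in>Basis. (- (\<integral>y. \<kappa>' (x - y) c * u y \<partial>ball_measure)) *\<^sub>R c)"
    using int1 by (subst Bochner_Integration.integral_sum) (auto simp del: scaleR_minus_left)
  finally have 1: "(\<integral>y. u y *\<^sub>R egrad ?\<phi> y \<partial>ball_measure) \<bullet> b = - (\<integral>y. \<kappa>' (x - y) b * u y \<partial>ball_measure)"
    using b by (simp add: inner_sum_left inner_Basis if_distrib cong: if_cong)
  have "(\<integral>y. ?\<phi> y *\<^sub>R G y \<partial>ball_measure)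
      = (\<integral>y. (\<Sum>c\<in>Basis. (\<kappa> (x - y) * (G y \<bullet> c)) *\<^sub>R c) \<partial>ball_measure)"
    by (subst (1) euclidean_representation[symmetric]) (simp add: scaleR_sum_right)
  also have "\<dots> = (\<Sum>c\<in>Basis. (\<integral>y. \<kappa> (x - y) * (G y \<bullet> c) \<partial>ball_measure) *\<^sub>R c)"
    using int2 by (subst Bochner_Integration.integral_sum) auto
  finally have 2: "(\<integral>y. ?\<phi> y *\<^sub>R G y \<partial>ball_measure) \<bullet> b = (\<integral>y. \<kappa> (x - y) * (G y \<bullet> b) \<partial>ball_measure)"
    using b by (simp add: inner_sum_left inner_Basis if_distrib cong: if_cong)
  have "(\<integral>y. u y *\<^sub>R egrad ?\<phi> y \<partial>ball_measure) = - (\<integral>y. ?\<phi> y *\<^sub>R G y \<partial>ball_measure)"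
    using wg test by (simp add: has_weak_grad_def)
  then show ?thesis using 1 2 by simp
qed

lemma ball_measure_lborel_mult:
  fixes f f0 k :: "'a::euclidean_space \<Rightarrow> real"
  assumes f: "f \<in> borel_measurable ball_measure" and f0: "f0 \<in> borel_measurable borel" "\<And>x. 1 \<le> norm x \<Longrightarrow> f0 x = 0"
    "AE x in ball_measure. f0 x = f x" and k: "k \<in> borel_measurable borel"
  shows "(\<integral>x. k x * f x \<partial>ball_measure) = (\<integral>x. k x * f0 x \<partial>lborel)"
proof -
  have m: "h \<in> borel_measurable ball_measure" if "h \<in> borel_measurable borel" for h :: "'a \<Rightarrow> real"
    using that by (simp add: measurable_completion measurable_restrict_space1)
  have "(\<integral>x. k x * f x \<partial>ball_measure) = (\<integral>x. k x * f0 x \<partial>ball_measure)"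
    using f0(3) by (intro integral_cong_AE borel_measurable_times m f k f0) (auto elim: AE_mp)
  also have "\<dots> = (\<integral>x. k x * f0 x \<partial>lborel)"
    using f0 k by (intro ball_measure_borel) auto
  finally show ?thesis .
qed

lemma L2_lim_smooth:
  fixes f f0 :: "'a::euclidean_space \<Rightarrow> real"
  assumes f: "sq_int ball_measure f"
    and f0: "sq_int lborel f0" "integrable lborel f0" "\<And>x. 1 \<le> norm x \<Longrightarrow> f0 x = 0"
      "AE x in ball_measure. f0 x = f x"
    and moll: "\<And>n. smooth_mollifier (\<kappa> n) (e n) (B n) (\<kappa>' n) (L n)" and e: "e \<longlonglongrightarrow> 0"
  shows "L2_lim ball_measure (\<lambda>n. mollifier.smooth (\<kappa> n) f0) f"
proof -
  have mo: "mollifier (\<kappa> n) (e n) (B n)" for n using moll[of n] by (simp add: smooth_mollifier_def)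
  let ?S = "\<lambda>n. mollifier.smooth (\<kappa> n) f0"
  have sq_diff: "sq_int lborel (\<lambda>x. ?S n x - f0 x)" for n
  proof -
    \<comment> \<open>A crude bound for all shifts, whose purpose is to make every smoothed function
      square integrable. Smallness enters later through the continuity of translations.\<close>
    have "(\<integral>x. (f0 (x + z) - f0 x)\<^sup>2 \<partial>lborel) \<le> 4 * (\<integral>x. (f0 x)\<^sup>2 \<partial>lborel)" for z
    proof -
      note t = sq_int_translation[OF f0(1), of z]
      have "(\<integral>x. (f0 (x + z) - f0 x)\<^sup>2 \<partial>lborel) \<le> (\<integral>x. 2 * (f0 (x + z))\<^sup>2 + 2 * (f0 x)\<^sup>2 \<partial>lborel)"
      proof (rule integral_mono)
        have "(a - b)\<^sup>2 \<le> 2 * a\<^sup>2 + 2 * b\<^sup>2" for a b :: real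
          using zero_le_power2[of "a + b"] by (simp add: power2_diff power2_sum)
        then show "(f0 (x + z) - f0 x)\<^sup>2 \<le> 2 * (f0 (x + z))\<^sup>2 + 2 * (f0 x)\<^sup>2" for x .
      qed (use sq_int_diff[OF t f0(1)] t f0(1) in \<open>auto simp: sq_int_def\<close>)
      also have "\<dots> = 4 * (\<integral>x. (f0 x)\<^sup>2 \<partial>lborel)"
        using t f0(1) lborel_integral_translation[of "\<lambda>x. (f0 x)\<^sup>2" z]
        by (simp add: sq_int_def borel_measurable_power)
      finally show ?thesis .
    qed
    from mollifier.smooth_L2_dist(1)[OF mo f0(1,2) this] show ?thesis .
  qed
  have sq: "sq_int lborel (?S n)" for n
    using sq_int_add[OF sq_diff f0(1)] by simp
  have "(\<lambda>n. \<integral>x. (?S n x - f0 x)\<^sup>2 \<partial>lborel) \<longlonglongrightarrow> 0"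
  proof (rule LIMSEQ_I)
    fix r :: real assume "0 < r"
    then obtain d where d: "0 < d" "\<And>z. norm z < d \<Longrightarrow> (\<integral>x. (f0 (x + z) - f0 x)\<^sup>2 \<partial>lborel) < r / 2"
      using L2_translation_continuous[OF f0(1,3), of "r / 2"] by auto
    obtain N where N: "\<And>n. n \<ge> N \<Longrightarrow> e n < d"
      using order_tendstoD(2)[OF e d(1)] by (auto simp: eventually_sequentially)
    have "norm ((\<integral>x. (?S n x - f0 x)\<^sup>2 \<partial>lborel) - 0) < r" if "n \<ge> N" for n
    proof -
      have "(\<integral>x. (?S n x - f0 x)\<^sup>2 \<partial>lborel) \<le> r / 2"
        using N[OF that] by (intro mollifier.smooth_L2_dist(2)[OF mo f0(1,2)] less_imp_le d(2)) simp
      then show ?thesis using \<open>0 < r\<close> by simp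
    qed
    then show "\<exists>N. \<forall>n\<ge>N. norm ((\<integral>x. (?S n x - f0 x)\<^sup>2 \<partial>lborel) - 0) < r" by blast
  qed
  note lim = this
  have le: "(\<integral>x. (?S n x - f x)\<^sup>2 \<partial>ball_measure) \<le> (\<integral>x. (?S n x - f0 x)\<^sup>2 \<partial>lborel)" for n
  proof -
    have m: "?S n \<in> borel_measurable ball_measure" "f0 \<in> borel_measurable ball_measure"
      using sq_int_ball_measure(1)[OF sq] sq_int_ball_measure(1)[OF f0(1)] by (auto simp: sq_int_def)
    have "(\<integral>x. (?S n x - f x)\<^sup>2 \<partial>ball_measure) = (\<integral>x. (?S n x - f0 x)\<^sup>2 \<partial>ball_measure)"
      using f0(4) m f
      by (intro integral_cong_AE borel_measurable_power borel_measurable_diff)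
        (auto simp: sq_int_def elim: AE_mp)
    also have "\<dots> \<le> (\<integral>x. (?S n x - f0 x)\<^sup>2 \<partial>lborel)"
      by (rule sq_int_ball_measure(2)[OF sq_diff])
    finally show ?thesis .
  qed
  have "(\<lambda>n. \<integral>x. (?S n x - f x)\<^sup>2 \<partial>ball_measure) \<longlonglongrightarrow> 0"
    by (rule tendsto_sandwich[OF _ _ tendsto_const lim]) (auto simp: le)
  then show ?thesis
    using sq_int_ball_measure(1)[OF sq] f by (simp add: L2_lim_def)
qed

text \<open>\<open>V\<close> is the mollification of \<open>G\<close>, component by component, and
  not defined as the gradient of \<open>U\<close>. The two are shown to agree where the kernel
  centred at \<open>x\<close> fits inside the unit ball; hence differentiability is claimed for
  norms below \<open>s\<close>, while \<open>V\<close> is continuous everywhere.\<close>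

lemma smooth_approximation:
  fixes u :: "'a::euclidean_space \<Rightarrow> real" and G :: "'a \<Rightarrow> 'a"
  assumes wg: "has_weak_grad u G" and u: "sq_int ball_measure u"
    and G: "\<And>b. b \<in> Basis \<Longrightarrow> sq_int ball_measure (\<lambda>x. G x \<bullet> b)" and s: "s < 1"
  obtains U V where "\<And>n x. norm x < s \<Longrightarrow> (U n has_derivative (\<lambda>h. V n x \<bullet> h)) (at x)"
    "\<And>n. continuous_on UNIV (V n)" "L2_lim ball_measure U u"
    "\<And>b. b \<in> Basis \<Longrightarrow> L2_lim ball_measure (\<lambda>n x. V n x \<bullet> b) (\<lambda>x. G x \<bullet> b)"
proof -
  \<comment> \<open>Widths of at most \<open>1 - s\<close> make the kernels centred at points of
    norm below \<open>s\<close> test functions, for every \<open>n\<close>.\<close>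
  define e where "e n = (1 - s) * inverse (real (Suc n))" for n
  have e: "0 < e n" "e n \<le> 1 - s" for n
    using s mult_right_mono[of s 1 "real n"] by (auto simp: e_def field_simps)
  have e_lim: "e \<longlonglongrightarrow> 0"
    unfolding e_def[abs_def] using tendsto_mult_right_zero[OF LIMSEQ_inverse_real_of_nat] by simp
  have "\<exists>c B \<kappa>' L. smooth_mollifier (\<lambda>x::'a. c * bump (e n) x) (e n) B \<kappa>' L" for n
    using smooth_mollifier_bump[OF e(1)] by metis
  then obtain c B \<kappa>' L where "\<forall>n. smooth_mollifier (\<lambda>x::'a. c n * bump (e n) x) (e n) (B n) (\<kappa>' n) (L n)"
    by metis
  moreover define \<kappa> where "\<kappa> n x = c n * bump (e n) x" for n and x :: 'a
  ultimately have moll: "\<And>n. smooth_mollifier (\<kappa> n) (e n) (B n) (\<kappa>' n) (L n)"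
    by (simp add: \<kappa>_def[abs_def])
  obtain u0 where u0: "sq_int lborel u0" "integrable lborel u0" "\<And>x. 1 \<le> norm x \<Longrightarrow> u0 x = 0"
      "AE x in ball_measure. u0 x = u x"
    using sq_int_representative[OF u] by blast
  have "\<forall>b. \<exists>g. b \<in> Basis \<longrightarrow> sq_int lborel g \<and> integrable lborel g \<and> (\<forall>x. 1 \<le> norm x \<longrightarrow> g x = 0) \<and>
      (AE x in ball_measure. g x = G x \<bullet> b)"
    using sq_int_representative[OF G] by metis
  from choice[OF this] obtain G0 where G0: "\<And>b. b \<in> Basis \<Longrightarrow> sq_int lborel (G0 b)"
    "\<And>b. b \<in> Basis \<Longrightarrow> integrable lborel (G0 b)"
    "\<And>b x. b \<in> Basis \<Longrightarrow> 1 \<le> norm x \<Longrightarrow> G0 b x = 0"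
    "\<And>b. b \<in> Basis \<Longrightarrow> AE x in ball_measure. G0 b x = G x \<bullet> b"
    by blast
  define U where "U n = mollifier.smooth (\<kappa> n) u0" for n
  define V where "V n x = (\<Sum>b\<in>Basis. mollifier.smooth (\<kappa> n) (G0 b) x *\<^sub>R b)" for n x
  have V_b: "V n x \<bullet> b = mollifier.smooth (\<kappa> n) (G0 b) x" if "b \<in> Basis" for n x b
    using that by (simp add: V_def inner_sum_left inner_Basis if_distrib cong: if_cong)
  show ?thesis
  proof
    show "continuous_on UNIV (V n)" for n
      unfolding V_def
      by (intro continuous_intros smooth_mollifier.smooth_continuous[OF moll] G0)
    show "L2_lim ball_measure U u"
      unfolding U_def[abs_def] by (rule L2_lim_smooth[OF u u0 moll e_lim])
    show "L2_lim ball_measure (\<lambda>n x. V n x \<bullet> b) (\<lambda>x. G x \<bullet> b)" if "b \<in> Basis" for b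
      unfolding V_b[OF that] by (rule L2_lim_smooth[OF G[OF that] G0[OF that] moll e_lim])
    show "(U n has_derivative (\<lambda>h. V n x \<bullet> h)) (at x)" if x: "norm x < s" for n x
    proof -
      interpret smooth_mollifier "\<kappa> n" "e n" "B n" "\<kappa>' n" "L n" by (rule moll)
      have test: "test_function (\<lambda>y. \<kappa> n (x - y))"
        unfolding \<kappa>_def using x e[of n] by (intro test_function_bump) auto
      define D where "D h = (\<integral>y. \<kappa>' n (x - y) h * u0 y \<partial>lborel)" for h
      have D: "(U n has_derivative D) (at x)"
        using smooth_has_derivative[OF u0(2), of x] by (simp add: U_def D_def[abs_def])
      have D_b: "D b = V n x \<bullet> b" if b: "b \<in> Basis" for b
      proof -
        have "D b = (\<integral>y. \<kappa>' n (x - y) b * u y \<partial>ball_measure)"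
          unfolding D_def using u u0 by (subst ball_measure_lborel_mult[of u u0]) (auto simp: sq_int_def)
        also have "\<dots> = (\<integral>y. \<kappa> n (x - y) * (G y \<bullet> b) \<partial>ball_measure)"
          by (rule weak_grad_mollified[OF wg _ _ moll test b])
            (auto intro: sq_int_integrable[OF _ finite_ball_measure] u G)
        also have "\<dots> = (\<integral>y. \<kappa> n (x - y) * G0 b y \<partial>lborel)"
          using G[OF b] G0(1)[OF b]
          by (intro ball_measure_lborel_mult G0(3,4) b) (auto simp: sq_int_def)
        also have "\<dots> = V n x \<bullet> b" by (simp add: V_b b smooth_def)
        finally show ?thesis .
      qed
      have lin: "linear D" using D has_derivative_linear by blast
      have "D h = V n x \<bullet> h" for h
      proof -
        have "D h = D (\<Sum>b\<in>Basis. (h \<bullet> b) *\<^sub>R b)" by (simp add: euclidean_representation)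
        also have "\<dots> = (\<Sum>b\<in>Basis. (h \<bullet> b) * D b)"
          by (simp add: linear_sum[OF lin] linear_cmul[OF lin])
        also have "\<dots> = (\<Sum>b\<in>Basis. (V n x \<bullet> b) * (h \<bullet> b))"
          by (intro sum.cong) (auto simp: D_b mult.commute)
        finally show ?thesis by (simp add: euclidean_inner[of "V n x" h])
      qed
      then have "D = (\<lambda>h. V n x \<bullet> h)" by (rule ext)
      with D show ?thesis by simp
    qed
  qed
qed

section \<open>Divergence theorem for radial fields\<close>

text \<open>By translation invariance the difference quotients in direction \<open>b\<close> have
  integral 0. The mean value theorem bounds them uniformly on a fixed ball, so dominated convergence
  transfers this to the derivative.\<close>

lemma integral_directional_derivative_eq_0:
  fixes f :: "'a::euclidean_space \<Rightarrow> real"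
  assumes f: "\<And>x. (f has_derivative D x) (at x)" and cont: "continuous_on UNIV (\<lambda>x. D x b)"
    and supp: "\<And>x. R < norm x \<Longrightarrow> f x = 0" "\<And>x. R < norm x \<Longrightarrow> D x b = 0"
  shows "integrable lborel (\<lambda>x. D x b)" "(\<integral>x. D x b \<partial>lborel) = 0"
proof -
  have f_cont: "continuous_on UNIV f"
    by (meson continuous_at_imp_continuous_on has_derivative_continuous f)
  have [measurable]: "f \<in> borel_measurable borel" "(\<lambda>x. D x b) \<in> borel_measurable borel"
    by (rule borel_measurable_continuous_onI, fact)+
  have bounded: "\<exists>M\<ge>0. \<forall>x. \<bar>g x\<bar> \<le> M"
    if "continuous_on UNIV g" "\<And>x. R < norm x \<Longrightarrow> g x = 0" for g :: "'a \<Rightarrow> real"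
  proof -
    have "compact (g ` cball 0 R)"
      by (intro compact_continuous_image continuous_on_subset[OF that(1)]) auto
    then have "bounded (g ` cball 0 R)" by (rule compact_imp_bounded)
    then obtain M where M: "\<forall>x\<in>cball 0 R. \<bar>g x\<bar> \<le> M" by (auto simp: bounded_iff)
    have "\<bar>g x\<bar> \<le> max M 0" for x
      using M[rule_format, of x] that(2)[of x] by (cases "norm x \<le> R") (auto simp: max_def)
    then show ?thesis by (intro exI[of _ "max M 0"]) auto
  qed
  obtain M where M: "0 \<le> M" "\<And>x. \<bar>D x b\<bar> \<le> M" using bounded[OF cont supp(2)] by blast
  obtain M0 where M0: "\<And>x. \<bar>f x\<bar> \<le> M0" using bounded[OF f_cont supp(1)] by blast
  have f_int: "integrable lborel f"
    by (rule integrable_bounded_support[OF _ M0 supp(1)]) auto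
  show "integrable lborel (\<lambda>x. D x b)"
    by (rule integrable_bounded_support[OF _ M(2) supp(2)]) auto
  define t where "t n = inverse (real (Suc n))" for n
  have t: "0 < t n" "t n \<le> 1" for n by (auto simp: t_def field_simps)
  have t_lim: "t \<longlonglongrightarrow> 0" unfolding t_def[abs_def] by (rule LIMSEQ_inverse_real_of_nat)
  have line: "((\<lambda>s. f (x + s *\<^sub>R b)) has_real_derivative D (x + s *\<^sub>R b) b) (at s)" for x s
  proof -
    have "((\<lambda>s. x + s *\<^sub>R b) has_derivative (\<lambda>h. h *\<^sub>R b)) (at s)"
      by (auto intro!: derivative_eq_intros)
    from has_derivative_compose[OF this f]
    have "((\<lambda>s. f (x + s *\<^sub>R b)) has_derivative (\<lambda>h. D (x + s *\<^sub>R b) (h *\<^sub>R b))) (at s)" .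
    then show ?thesis
      unfolding has_field_derivative_def
      by (simp add: linear_cmul[OF has_derivative_linear[OF f]] mult.commute[of _ "D _ b"])
  qed
  have lip: "\<bar>(f (x + t n *\<^sub>R b) - f x) / t n\<bar> \<le> M" for n x
  proof -
    obtain z where "f (x + t n *\<^sub>R b) - f (x + 0 *\<^sub>R b) = (t n - 0) * D (x + z *\<^sub>R b) b"
      using MVT2[OF t(1)[of n], of "\<lambda>s. f (x + s *\<^sub>R b)" "\<lambda>s. D (x + s *\<^sub>R b) b"] line by blast
    then have "(f (x + t n *\<^sub>R b) - f x) / t n = D (x + z *\<^sub>R b) b"
      using t(1)[of n] by (simp add: field_simps)
    then show ?thesis using M(2) by simp
  qed
  have "(\<lambda>n. \<integral>x. (f (x + t n *\<^sub>R b) - f x) / t n \<partial>lborel) \<longlonglongrightarrow> (\<integral>x. D x b \<partial>lborel)"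
  proof (rule integral_dominated_convergence)
    show "integrable lborel (\<lambda>x::'a. M * indicator (cball 0 (R + norm b)) x)"
      using emeasure_bounded_finite[OF bounded_cball, of "0::'a" "R + norm b"]
      by (intro integrable_mult_right integrable_real_indicator) auto
    show "AE x in lborel. (\<lambda>n. (f (x + t n *\<^sub>R b) - f x) / t n) \<longlonglongrightarrow> D x b"
    proof (rule AE_I2)
      fix x
      have "((\<lambda>h. (f (x + h *\<^sub>R b) - f x) / h) \<longlongrightarrow> D x b) (at 0)"
        using line[of x 0] by (simp add: DERIV_def)
      moreover have "filterlim t (at 0) sequentially"
        using t t_lim by (intro filterlim_atI) (auto intro!: always_eventually simp: less_imp_neq[symmetric])
      ultimately show "(\<lambda>n. (f (x + t n *\<^sub>R b) - f x) / t n) \<longlonglongrightarrow> D x b"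
        by (rule filterlim_compose)
    qed
    show "AE x in lborel. norm ((f (x + t n *\<^sub>R b) - f x) / t n) \<le> M * indicator (cball 0 (R + norm b)) x" for n
    proof (rule AE_I2)
      fix x
      show "norm ((f (x + t n *\<^sub>R b) - f x) / t n) \<le> M * indicator (cball 0 (R + norm b)) x"
      proof (cases "norm x \<le> R + norm b")
        case True
        then show ?thesis using lip[of x n] by simp
      next
        case False
        have "norm (t n *\<^sub>R b) \<le> norm b" using t[of n] by (simp add: mult_left_le_one_le)
        then have "R < norm (x + t n *\<^sub>R b)" "R < norm x"
          using False norm_triangle_ineq2[of x "- (t n *\<^sub>R b)"] norm_ge_zero[of b] by (auto simp del: norm_ge_zero)
        then show ?thesis using False by (simp add: supp)
      qed
    qed
  qed auto
  moreover have "(\<lambda>n. \<integral>x. (f (x + t n *\<^sub>R b) - f x) / t n \<partial>lborel) = (\<lambda>n. 0)"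
    using f_int lborel_integrable_translation[OF f_int] lborel_integral_translation[of f] by simp
  ultimately show "(\<integral>x. D x b \<partial>lborel) = 0"
    by (simp add: LIMSEQ_const_iff)
qed

text \<open>The integrand is the Euclidean divergence of the field
  \<open>(U x)\<^sup>2 * k (norm x)\<close> times \<open>x\<close>; the divergence of
  \<open>k (norm x)\<close> times \<open>x\<close> alone is
  \<open>norm x * k' (norm x) + N * k (norm x)\<close>. The profile vanishes near the origin and
  beyond \<open>s0\<close>, which hides the singularity of the norm and the region where
  \<open>U\<close> need not be differentiable.\<close>

lemma radial_divergence:
  fixes U :: "'a::euclidean_space \<Rightarrow> real" and V :: "'a \<Rightarrow> 'a" and k k' :: "real \<Rightarrow> real"
  assumes U: "\<And>x. norm x < s \<Longrightarrow> (U has_derivative (\<lambda>h. V x \<bullet> h)) (at x)"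
    and V: "continuous_on (ball 0 s) V" and as: "0 < a" "s0 < s" "s \<le> 1"
    and k: "\<And>t. 0 < t \<Longrightarrow> t < s \<Longrightarrow> (k has_real_derivative k' t) (at t)"
    and k'_cont: "continuous_on {0<..<s} k'"
    and supp: "\<And>t. t < a \<or> s0 < t \<Longrightarrow> k t = 0" "\<And>t. t < a \<or> s0 < t \<Longrightarrow> k' t = 0"
  shows "(\<integral>x. 2 * (U x * ((V x \<bullet> x) * k (norm x)))
      + U x * (U x * (norm x * k' (norm x) + real DIM('a) * k (norm x))) \<partial>ball_measure) = 0"
proof -
  define f where "f b x = (U x)\<^sup>2 * k (norm x) * (x \<bullet> b)" for b x
  define D where "D b x h = 2 * U x * (V x \<bullet> h) * k (norm x) * (x \<bullet> b)
      + (U x)\<^sup>2 * (k' (norm x) * (x \<bullet> h / norm x)) * (x \<bullet> b) + (U x)\<^sup>2 * k (norm x) * (h \<bullet> b)" for b x h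
  \<comment> \<open>Three open regions covering the space: on the first the formulas hold by
    calculus, on the other two all terms are 0.\<close>
  have cover: "0 < norm x \<and> norm x < s \<or> norm x < a \<or> s0 < norm x" for x :: 'a
    using as by (cases "norm x < s") (auto simp: not_less)
  have outer: "open ({x::'a. norm x < a} \<union> {x. s0 < norm x})"
    by (intro open_Un open_Collect_less continuous_intros)
  have inner: "open (ball 0 s - {0::'a})" by (intro open_delete open_ball)
  have k_cont: "continuous_on {0<..<s} k"
    using k by (auto intro!: continuous_at_imp_continuous_on DERIV_isCont)
  have der: "(f b has_derivative D b x) (at x)" for b x
  proof (cases "0 < norm x \<and> norm x < s")
    case True
    then have "((\<lambda>x. norm x) has_derivative (\<lambda>h. (x \<bullet> h) / norm x)) (at x)"
      by (intro has_derivative_eq_rhs[OF has_derivative_norm])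
        (auto simp: sgn_div_norm inner_commute divide_inverse mult.commute)
    from has_derivative_compose[OF this k[unfolded has_field_derivative_def]] True
    have "((\<lambda>x. k (norm x)) has_derivative (\<lambda>h. k' (norm x) * (x \<bullet> h / norm x))) (at x)" by simp
    with U[of x] True show ?thesis
      unfolding f_def D_def
      by (auto intro!: derivative_eq_intros simp: power2_eq_square algebra_simps)
  next
    case False
    with cover[of x] have x: "norm x < a \<or> s0 < norm x" by blast
    then have "D b x = (\<lambda>h. 0)" by (auto simp: D_def supp)
    moreover have "(f b has_derivative (\<lambda>h. 0)) (at x)"
      by (rule has_derivative_transform_within_open[OF _ outer, of "\<lambda>x. 0"])
        (use x in \<open>auto simp: f_def supp\<close>)
    ultimately show ?thesis by simp
  qed
  have U_cont: "continuous_on (ball 0 s) U"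
    using U by (auto intro!: continuous_at_imp_continuous_on has_derivative_continuous)
  have cont: "continuous_on UNIV (\<lambda>x. D b x b)" for b
  proof -
    have "continuous_on (ball 0 s - {0}) (\<lambda>x. D b x b)"
      unfolding D_def
      by (intro continuous_intros continuous_on_subset[OF U_cont] continuous_on_subset[OF V]
            continuous_on_compose2[OF k_cont] continuous_on_compose2[OF k'_cont]) auto
    moreover have "continuous_on ({x. norm x < a} \<union> {x. s0 < norm x}) (\<lambda>x. D b x b)"
      by (rule continuous_on_eq[of _ "\<lambda>x. 0"]) (auto simp: D_def supp)
    ultimately have "continuous_on ((ball 0 s - {0}) \<union> ({x. norm x < a} \<union> {x. s0 < norm x})) (\<lambda>x. D b x b)"
      by (rule continuous_on_open_Un[OF inner outer])
    moreover have "x \<in> (ball 0 s - {0}) \<union> ({x. norm x < a} \<union> {x. s0 < norm x})" for x :: 'a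
      using cover[of x] by auto
    then have "(ball 0 s - {0}) \<union> ({x. norm x < a} \<union> {x. s0 < norm x}) = (UNIV :: 'a set)"
      by blast
    ultimately show ?thesis by simp
  qed
  have zero: "f b x = 0" "D b x b = 0" if "s0 < norm x" for b x
    using that by (auto simp: f_def D_def supp)
  note I = integral_directional_derivative_eq_0[OF der cont zero]
  have sum_D: "(\<Sum>b\<in>Basis. D b x b) = 2 * (U x * ((V x \<bullet> x) * k (norm x)))
      + U x * (U x * (norm x * k' (norm x) + real DIM('a) * k (norm x)))" for x
  proof -
    have "(\<Sum>b\<in>Basis. D b x b) = 2 * U x * k (norm x) * (\<Sum>b\<in>Basis. (V x \<bullet> b) * (x \<bullet> b))
      + (U x)\<^sup>2 * k' (norm x) / norm x * (\<Sum>b\<in>Basis. (x \<bullet> b) * (x \<bullet> b)) + (\<Sum>b\<in>(Basis::'a set). (U x)\<^sup>2 * k (norm x))"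
      unfolding D_def sum.distrib sum_distrib_left
      by (intro arg_cong2[where f = "(+)"] sum.cong) (auto simp: inner_Basis)
    also have "\<dots> = 2 * U x * k (norm x) * (V x \<bullet> x) + (U x)\<^sup>2 * k' (norm x) / norm x * (x \<bullet> x)
      + real DIM('a) * ((U x)\<^sup>2 * k (norm x))"
      by (simp add: euclidean_inner[symmetric])
    also have "(U x)\<^sup>2 * k' (norm x) / norm x * (x \<bullet> x) = (U x)\<^sup>2 * k' (norm x) * norm x"
      by (cases "x = 0") (auto simp: power2_norm_eq_inner[symmetric] power2_eq_square)
    finally show ?thesis by (simp add: power2_eq_square algebra_simps)
  qed
  have "(\<integral>x. (\<Sum>b\<in>Basis. D b x b) \<partial>ball_measure) = (\<integral>x. (\<Sum>b\<in>Basis. D b x b) \<partial>lborel)"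
    using as borel_measurable_integrable[OF I(1)]
    by (intro ball_measure_borel(2) borel_measurable_sum sum.neutral ballI zero(2)) auto
  also have "\<dots> = 0"
    using I by (subst Bochner_Integration.integral_sum) auto
  finally show ?thesis unfolding sum_D .
qed

section \<open>The hyperbolic metric in polar form\<close>

text \<open>In the ball model \<open>conf (norm x)\<close> is the conformal factor, and \<open>unrad r = tanh (r / 2)\<close> inverts the hyperbolic
  radius \<open>rad\<close>. Both \<open>conf\<close> and \<open>rad\<close> are meaningful only for \<open>\<bar>t\<bar> < 1\<close>.\<close>

definition conf :: "real \<Rightarrow> real" where
  "conf t = 2 / (1 - t\<^sup>2)"

definition rad :: "real \<Rightarrow> real" where
  "rad t = ln ((1 + t) / (1 - t))"

definition unrad :: "real \<Rightarrow> real" where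
  "unrad r = (exp r - 1) / (exp r + 1)"

lemma hyp_rho_eq: "hyp_rho x = rad (norm x)"
  by (simp add: hyp_rho_def rad_def)

lemma one_minus_square_pos: "\<bar>t\<bar> < 1 \<Longrightarrow> 0 < 1 - (t::real)\<^sup>2"
  by (simp add: abs_square_less_1)

lemma conf_pos: "\<bar>t\<bar> < 1 \<Longrightarrow> 0 < conf t"
  by (simp add: conf_def abs_square_less_1)

lemma conf_ge_2: "\<bar>t\<bar> < 1 \<Longrightarrow> 2 \<le> conf t"
  using one_minus_square_pos[of t] by (simp add: conf_def field_simps)

lemma exp_rad: "\<bar>t\<bar> < 1 \<Longrightarrow> exp (rad t) = (1 + t) / (1 - t)"
  by (auto simp: rad_def)

lemma rad_pos: "0 < t \<Longrightarrow> t < 1 \<Longrightarrow> 0 < rad t"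
  by (simp add: rad_def ln_gt_zero field_simps)

lemma rad_nonneg: "0 \<le> t \<Longrightarrow> t < 1 \<Longrightarrow> 0 \<le> rad t"
  by (cases "t = 0") (auto simp: rad_def[of 0] intro: less_imp_le[OF rad_pos])

lemma unrad_bounds: "0 < r \<Longrightarrow> 0 < unrad r" "unrad r < 1"
  by (auto simp: unrad_def field_simps add_pos_pos)

lemma rad_le_iff:
  assumes "0 \<le> t" "t < 1"
  shows "rad t \<le> r \<longleftrightarrow> t \<le> unrad r"
proof -
  have "rad t \<le> r \<longleftrightarrow> exp (rad t) \<le> exp r" by simp
  also have "\<dots> \<longleftrightarrow> t \<le> unrad r"
    using assms by (simp add: exp_rad unrad_def pos_divide_le_eq pos_le_divide_eq add_pos_pos algebra_simps)
  finally show ?thesis .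
qed

text \<open>Bounds the volume density by an exponential of the hyperbolic radius, the form in which
  Gaussian decay can absorb it.\<close>

lemma conf_le_exp_rad:
  assumes "0 \<le> t" "t < 1"
  shows "conf t \<le> 2 * exp (rad t)"
proof -
  have "1 - t\<^sup>2 = (1 + t) * (1 - t)" by (simp add: power2_eq_square algebra_simps)
  then have "conf t = (2 / (1 - t)) * (1 / (1 + t))" by (simp add: conf_def)
  also have "\<dots> \<le> (2 / (1 - t)) * (1 + t)"
  proof (rule mult_left_mono)
    have "1 / (1 + t) \<le> 1" using assms by simp
    then show "1 / (1 + t) \<le> 1 + t" using assms by linarith
  qed (use assms in simp)
  finally show ?thesis using assms by (simp add: exp_rad)
qed

lemma cosh_rad: "\<bar>t\<bar> < 1 \<Longrightarrow> cosh (rad t) = (1 + t\<^sup>2) / (1 - t\<^sup>2)"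
  and sinh_rad: "\<bar>t\<bar> < 1 \<Longrightarrow> sinh (rad t) = 2 * t / (1 - t\<^sup>2)"
proof -
  assume t: "\<bar>t\<bar> < 1"
  then have p: "1 + t > 0" "1 - t > 0" by auto
  have e: "1 - t\<^sup>2 = (1 + t) * (1 - t)" by (simp add: power2_eq_square algebra_simps)
  have q: "(x / y + y / x) / 2 = (x\<^sup>2 + y\<^sup>2) / 2 / (x * y)" "(x / y - y / x) / 2 = (x\<^sup>2 - y\<^sup>2) / 2 / (x * y)"
    if "0 < x" "0 < y" for x y :: real
    using that by (simp_all add: field_simps power2_eq_square)
  have "exp (- rad t) = (1 - t) / (1 + t)" by (simp add: exp_minus exp_rad[OF t])
  then have h: "cosh (rad t) = ((1 + t) / (1 - t) + (1 - t) / (1 + t)) / 2"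
    "sinh (rad t) = ((1 + t) / (1 - t) - (1 - t) / (1 + t)) / 2"
    by (simp_all add: cosh_field_def sinh_field_def exp_rad[OF t])
  have "((1 + t)\<^sup>2 + (1 - t)\<^sup>2) / 2 = 1 + t\<^sup>2" "((1 + t)\<^sup>2 - (1 - t)\<^sup>2) / 2 = 2 * t"
    by (simp_all add: power2_eq_square algebra_simps)
  then show "cosh (rad t) = (1 + t\<^sup>2) / (1 - t\<^sup>2)" "sinh (rad t) = 2 * t / (1 - t\<^sup>2)"
    by (simp_all only: h q[OF p] e)
qed

lemma coth_rad: "\<bar>t\<bar> < 1 \<Longrightarrow> cosh (rad t) / sinh (rad t) = (1 + t\<^sup>2) / (2 * t)"
  using one_minus_square_pos[of t] by (simp add: cosh_rad sinh_rad)

lemma rad_has_derivative: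
  assumes "\<bar>t\<bar> < 1"
  shows "(rad has_real_derivative conf t) (at t)"
proof -
  have p: "1 + t > 0" "1 - t > 0" using assms by auto
  have e: "1 - t\<^sup>2 = (1 + t) * (1 - t)" by (simp add: power2_eq_square algebra_simps)
  have "((\<lambda>t. ln (1 + t) - ln (1 - t)) has_real_derivative 1 / (1 + t) + 1 / (1 - t)) (at t)"
    using p by (auto intro!: derivative_eq_intros)
  moreover have "1 / (1 + t) + 1 / (1 - t) = conf t"
    unfolding conf_def e using p by (simp add: field_simps)
  ultimately have "((\<lambda>t. ln (1 + t) - ln (1 - t)) has_real_derivative conf t) (at t)" by simp
  then show ?thesis
    by (rule has_field_derivative_transform_within_open[where S = "{-1<..<1}"])
      (use assms in \<open>auto simp: rad_def ln_div\<close>)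
qed

lemma conf_has_derivative:
  assumes "\<bar>t\<bar> < 1"
  shows "(conf has_real_derivative t * (conf t)\<^sup>2) (at t)"
  unfolding conf_def[abs_def] using one_minus_square_pos[OF assms]
  by (auto intro!: derivative_eq_intros simp: power2_eq_square field_simps)

text \<open>Multiplied out, the claim is \<open>r * exp (- r) \<le> sinh r\<close>, that is
  \<open>1 + 2 * r \<le> exp (2 * r)\<close> divided by \<open>2 * exp r\<close>. It controls the
  Laplacian of \<open>r\<^sup>2/2\<close>, which is \<open>1 + (N - 1) r coth r\<close>.\<close>

lemma r_coth_le: "0 < r \<Longrightarrow> r * (cosh r / sinh r) \<le> 1 + (r::real)"
proof -
  assume r: "0 < r"
  then have s: "0 < sinh r" by simp
  have "1 + 2 * r \<le> exp (2 * r)" using exp_ge_add_one_self[of "2 * r"] by simp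
  also have "exp (2 * r) = exp r * exp r" by (simp add: exp_add[symmetric])
  finally have "(1 + 2 * r) * exp (- r) \<le> exp r"
    by (simp add: exp_minus field_simps)
  then have "r * exp (- r) \<le> sinh r" by (simp add: sinh_field_def algebra_simps)
  moreover have "cosh r = sinh r + exp (- r)" by (simp add: cosh_field_def sinh_field_def field_simps)
  ultimately have "r * cosh r \<le> (1 + r) * sinh r" by (simp add: algebra_simps)
  then show ?thesis using s by (simp add: pos_divide_le_eq)
qed

lemma one_le_r_coth: "0 < r \<Longrightarrow> 1 \<le> r * (cosh r / sinh r)" for r :: real
proof -
  assume r: "0 < r"
  have "0 * cosh 0 - sinh 0 \<le> r * cosh r - sinh r"
  proof (rule DERIV_nonneg_imp_nondecreasing[of 0 r "\<lambda>x. x * cosh x - sinh x"])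
    fix x :: real assume "0 \<le> x" "x \<le> r"
    have "((\<lambda>x. x * cosh x - sinh x) has_real_derivative x * sinh x) (at x)"
      by (auto intro!: derivative_eq_intros)
    moreover have "0 \<le> x * sinh x" using \<open>0 \<le> x\<close> by simp
    ultimately show "\<exists>y. ((\<lambda>x. x * cosh x - sinh x) has_real_derivative y) (at x) \<and> 0 \<le> y" by blast
  qed (use r in simp)
  then have "sinh r \<le> r * cosh r" by simp
  moreover have "0 < sinh r" using r by simp
  ultimately show ?thesis by (simp add: pos_le_divide_eq)
qed

lemma one_le_coth: "0 < r \<Longrightarrow> 1 \<le> cosh r / sinh r" for r :: real
  using sinh_less_cosh_real[of r] by (simp add: pos_le_divide_eq)

section \<open>Logarithmic cutoffs and compactly supported radial profiles\<close>

lemma max_0_square_has_derivative: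
  "((\<lambda>t. (max 0 t)\<^sup>2) has_real_derivative 2 * max 0 t) (at t)"
proof (cases t "0::real" rule: linorder_cases)
  case less
  have "((\<lambda>t::real. 0) has_real_derivative 2 * max 0 t) (at t)" using less by simp
  then show ?thesis
    by (rule has_field_derivative_transform_within_open[where S = "{..<0}"]) (use less in auto)
next
  case equal
  have "((\<lambda>h::real. (max 0 h)\<^sup>2 / h) \<longlongrightarrow> 0) (at 0)"
    by (rule Lim_null_comparison[where g = abs])
      (auto intro!: always_eventually tendsto_rabs_zero simp: power2_eq_square max_def)
  then show ?thesis using equal by (simp add: DERIV_def)
next
  case greater
  have "((\<lambda>t. t\<^sup>2) has_real_derivative 2 * max 0 t) (at t)"
    using greater by (auto intro!: derivative_eq_intros)
  then show ?thesis
    by (rule has_field_derivative_transform_within_open[where S = "{0<..}"]) (use greater in auto)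
qed

text \<open>A cutoff in \<open>ln r\<close>: it localises away from both the origin and infinity, and
  \<open>r * cut' n r\<close> tends to 0 uniformly.\<close>

definition cut :: "nat \<Rightarrow> real \<Rightarrow> real" where
  "cut n r = (max 0 (1 - (ln r / real (Suc n))\<^sup>2))\<^sup>2"

definition cut' :: "nat \<Rightarrow> real \<Rightarrow> real" where
  "cut' n r = 2 * max 0 (1 - (ln r / real (Suc n))\<^sup>2) * (- (2 * (ln r / real (Suc n)) / (real (Suc n) * r)))"

lemma cut_has_derivative: "0 < r \<Longrightarrow> (cut n has_real_derivative cut' n r) (at r)"
proof -
  assume r: "0 < r"
  have "((\<lambda>r. 1 - (ln r / m)\<^sup>2) has_real_derivative - (2 * (ln r / m) / (m * r))) (at r)" if "0 < m" for m
    using r that by (auto intro!: derivative_eq_intros simp: power2_eq_square field_simps)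
  then have "((\<lambda>r. 1 - (ln r / real (Suc n))\<^sup>2) has_real_derivative - (2 * (ln r / real (Suc n)) / (real (Suc n) * r))) (at r)"
    by (simp del: of_nat_Suc)
  from DERIV_chain2[OF max_0_square_has_derivative this] show ?thesis
    by (simp add: cut_def[abs_def] cut'_def)
qed

lemma cut_bounds: "0 \<le> cut n r" "cut n r \<le> 1"
  by (auto simp: cut_def max_def power_le_one_iff)

text \<open>With \<open>l\<close> the scaled logarithm, \<open>r * cut' n r\<close> is
  \<open>- 4 * max 0 (1 - l\<^sup>2) * l / real (Suc n)\<close>: the factor \<open>1 / r\<close>
  from differentiating the logarithm cancels, which makes the bound uniform in
  \<open>r\<close>.\<close>

lemma r_cut'_le: "0 < r \<Longrightarrow> r * \<bar>cut' n r\<bar> \<le> 4 / real (Suc n)"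
proof -
  assume r: "0 < r"
  define l where "l = ln r / real (Suc n)"
  have "max 0 (1 - l\<^sup>2) * \<bar>l\<bar> \<le> 1"
  proof (cases "\<bar>l\<bar> \<le> 1")
    case True
    then show ?thesis by (intro mult_le_one) auto
  next
    case False
    then have "1 - l\<^sup>2 \<le> 0" using abs_square_le_1[of l] by simp
    then show ?thesis by (simp add: max_def)
  qed
  then have "4 * (max 0 (1 - l\<^sup>2) * \<bar>l\<bar>) / real (Suc n) \<le> 4 / real (Suc n)"
    by (intro divide_right_mono) auto
  then show ?thesis
    using r by (simp add: cut'_def l_def[symmetric] abs_mult field_simps del: of_nat_Suc)
qed

lemma cut_eq_0:
  assumes "0 < r" "r \<le> exp (- real (Suc n)) \<or> exp (real (Suc n)) \<le> r"
  shows "cut n r = 0" "cut' n r = 0"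
proof -
  have "real (Suc n) \<le> \<bar>ln r\<bar>"
  proof (cases "exp (real (Suc n)) \<le> r")
    case True
    then have "real (Suc n) \<le> ln r" using assms(1) by (simp add: ln_ge_iff del: of_nat_Suc)
    then show ?thesis by linarith
  next
    case False
    then have "ln r \<le> ln (exp (- real (Suc n)))"
      using assms by (subst ln_le_cancel_iff) auto
    then show ?thesis by simp
  qed
  then have "1 \<le> \<bar>ln r / real (Suc n)\<bar>"
    by (simp add: abs_divide pos_le_divide_eq del: of_nat_Suc)
  then have "1 - (ln r / real (Suc n))\<^sup>2 \<le> 0"
    using abs_le_square_iff[of 1 "ln r / real (Suc n)"] by simp
  then show "cut n r = 0" "cut' n r = 0" by (auto simp: cut_def cut'_def max_def)
qed

lemma cut_tendsto:
  assumes "0 < r"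
  shows "(\<lambda>n. cut n r) \<longlonglongrightarrow> 1" "(\<lambda>n. cut' n r) \<longlonglongrightarrow> 0"
proof -
  have l: "(\<lambda>n. ln r / real (Suc n)) \<longlonglongrightarrow> 0"
    using tendsto_mult_right_zero[OF LIMSEQ_inverse_real_of_nat, of "ln r"] by (simp add: divide_inverse)
  show "(\<lambda>n. cut n r) \<longlonglongrightarrow> 1"
  proof -
    have "(\<lambda>n. cut n r) \<longlonglongrightarrow> (max 0 (1 - 0\<^sup>2))\<^sup>2"
      unfolding cut_def by (intro tendsto_intros l)
    then show ?thesis by simp
  qed
  have "(\<lambda>n. 4 / r / real (Suc n)) \<longlonglongrightarrow> 0"
    using tendsto_mult_right_zero[OF LIMSEQ_inverse_real_of_nat, of "4 / r"] by (simp add: divide_inverse)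
  then show "(\<lambda>n. cut' n r) \<longlonglongrightarrow> 0"
    by (rule Lim_null_comparison[rotated])
      (use r_cut'_le[OF assms] assms in \<open>auto intro!: always_eventually simp: field_simps simp del: of_nat_Suc\<close>)
qed

lemma cut'_continuous: "continuous_on {0<..} (cut' n)"
  unfolding cut'_def[abs_def] by (intro continuous_intros) auto

lemma compactly_supported_continuous:
  fixes g :: "real \<Rightarrow> real"
  assumes g: "continuous_on {0<..<1} g" and ab: "0 < a" "b < 1"
    and supp: "\<And>t. t < a \<or> b < t \<Longrightarrow> g t = 0"
  shows "continuous_on UNIV g" "\<exists>B. \<forall>t. \<bar>g t\<bar> \<le> B"
proof -
  have outer: "continuous_on ({..<a} \<union> {b<..}) g"
    by (rule continuous_on_eq[of _ "\<lambda>x. 0"]) (auto simp: supp)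
  have "continuous_on ({0<..<1} \<union> ({..<a} \<union> {b<..})) g"
    by (rule continuous_on_open_Un[OF _ _ g outer]) auto
  moreover have "t \<in> {0<..<1} \<union> ({..<a} \<union> {b<..})" for t using ab by auto
  then have "{0<..<1} \<union> ({..<a} \<union> {b<..}) = UNIV" by blast
  ultimately show cont: "continuous_on UNIV g" by simp
  have "compact (g ` {a..b})"
    by (intro compact_continuous_image continuous_on_subset[OF cont]) auto
  then have "bounded (g ` {a..b})" by (rule compact_imp_bounded)
  then obtain B where B: "\<forall>t\<in>{a..b}. \<bar>g t\<bar> \<le> B" by (auto simp: bounded_iff)
  have "\<bar>g t\<bar> \<le> max B 0" for t
    using B[rule_format, of t] supp[of t] by (cases "t \<in> {a..b}") (auto simp: max_def)
  then show "\<exists>B. \<forall>t. \<bar>g t\<bar> \<le> B" by blast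
qed

text \<open>The approximants may depend on \<open>s\<close>, because mollification yields gradients
  only away from the boundary. Working with a pair \<open>u\<close>, \<open>G\<close> lets a smooth
  function be subtracted together with its gradient, without identifying a new weak
  gradient.\<close>

definition C1_approximable :: "('a::euclidean_space \<Rightarrow> real) \<Rightarrow> ('a \<Rightarrow> 'a) \<Rightarrow> bool" where
  "C1_approximable u G \<longleftrightarrow> (\<forall>s<1. \<exists>U V.
     (\<forall>n x. norm x < s \<longrightarrow> (U n has_derivative (\<lambda>h. V n x \<bullet> h)) (at x)) \<and>
     (\<forall>n. continuous_on (ball 0 s) (V n)) \<and> L2_lim ball_measure U u \<and>
     (\<forall>b\<in>Basis. L2_lim ball_measure (\<lambda>n x. V n x \<bullet> b) (\<lambda>x. G x \<bullet> b)))"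

lemma ball_measure_borel_measurable:
  "f \<in> borel_measurable borel \<Longrightarrow> f \<in> borel_measurable (ball_measure :: 'a::euclidean_space measure)"
  by (simp add: measurable_completion measurable_restrict_space1)

lemma L2_lim_sum:
  assumes "\<And>i. i \<in> A \<Longrightarrow> L2_lim M (F i) (f i)"
  shows "L2_lim M (\<lambda>n x. \<Sum>i\<in>A. F i n x) (\<lambda>x. \<Sum>i\<in>A. f i x)"
  using assms
  by (induction A rule: infinite_finite_induct)
    (auto intro: L2_lim_add simp: L2_lim_def[of _ "\<lambda>n x. 0"] sq_int_def)

text \<open>For the approximants this is \<open>radial_divergence\<close>. The identity is quadratic
  in function and gradient with bounded radial multipliers, so it survives the limit in the square
  norm.\<close>

lemma radial_divergence_weak:
  fixes u :: "'a::euclidean_space \<Rightarrow> real" and G :: "'a \<Rightarrow> 'a"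
  assumes app: "C1_approximable u G" and ab: "0 < a" "b < 1"
    and k: "\<And>t. 0 < t \<Longrightarrow> t < 1 \<Longrightarrow> (k has_real_derivative k' t) (at t)"
    and k'_cont: "continuous_on {0<..<1} k'"
    and supp: "\<And>t. t < a \<or> b < t \<Longrightarrow> k t = 0" "\<And>t. t < a \<or> b < t \<Longrightarrow> k' t = 0"
  shows "(\<integral>x. 2 * (u x * ((G x \<bullet> x) * k (norm x)))
      + u x * (u x * (norm x * k' (norm x) + real DIM('a) * k (norm x))) \<partial>ball_measure) = 0"
proof -
  define m where "m t = t * k' t + real DIM('a) * k t" for t
  have k_cont: "continuous_on {0<..<1} k"
    using k by (auto intro!: continuous_at_imp_continuous_on DERIV_isCont)
  note kb = compactly_supported_continuous[OF k_cont ab supp(1)]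
  have m_cont: "continuous_on {0<..<1} m"
    unfolding m_def by (intro continuous_intros k_cont k'_cont)
  have m_supp: "m t = 0" if "t < a \<or> b < t" for t using supp[OF that] by (simp add: m_def)
  note mb = compactly_supported_continuous[OF m_cont ab m_supp]
  obtain Bk where Bk: "\<And>t. \<bar>k t\<bar> \<le> Bk" using kb(2) by blast
  obtain Bm where Bm: "\<And>x::'a. \<bar>m (norm x)\<bar> \<le> Bm" using mb(2) by blast
  have meas: "(\<lambda>x::'a. m (norm x)) \<in> borel_measurable ball_measure"
    "\<And>c. (\<lambda>x::'a. (x \<bullet> c) * k (norm x)) \<in> borel_measurable ball_measure"
    by (intro ball_measure_borel_measurable borel_measurable_continuous_onI continuous_intros
        continuous_on_compose2[OF mb(1)] continuous_on_compose2[OF kb(1)]; simp)+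
  \<comment> \<open>A radius strictly between the support of the profile and the unit sphere;
    \<open>max 0 b\<close> keeps it positive.\<close>
  define s where "s = (max 0 b + 1) / 2"
  have s: "b < s" "s < 1" "0 < s" using ab by (auto simp: s_def)
  obtain U V where UV: "\<And>n x. norm x < s \<Longrightarrow> (U n has_derivative (\<lambda>h. V n x \<bullet> h)) (at x)"
     "\<And>n. continuous_on (ball 0 s) (V n)" "L2_lim ball_measure U u"
     "\<And>b. b \<in> Basis \<Longrightarrow> L2_lim ball_measure (\<lambda>n x. V n x \<bullet> b) (\<lambda>x. G x \<bullet> b)"
    using app s(2) unfolding C1_approximable_def by blast
  have 0: "(\<integral>x. 2 * (U n x * ((V n x \<bullet> x) * k (norm x))) + U n x * (U n x * m (norm x)) \<partial>ball_measure) = 0" for n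
    unfolding m_def
    using s by (intro radial_divergence[OF UV(1,2) ab(1) s(1) _ k _ supp] continuous_on_subset[OF k'_cont]) auto
  have L1: "L2_lim ball_measure (\<lambda>n x. m (norm x) * U n x) (\<lambda>x. m (norm x) * u x)"
    by (rule L2_lim_bounded_mult[OF UV(3) meas(1) Bm])
  have L2: "L2_lim ball_measure (\<lambda>n x. \<Sum>c\<in>Basis. ((x \<bullet> c) * k (norm x)) * (V n x \<bullet> c))
      (\<lambda>x. \<Sum>c\<in>Basis. ((x \<bullet> c) * k (norm x)) * (G x \<bullet> c))"
  proof (intro L2_lim_sum L2_lim_bounded_mult[OF UV(4) meas(2)])
    fix x c :: 'a assume "x \<in> space ball_measure" "c \<in> Basis"
    then have "\<bar>x \<bullet> c\<bar> \<le> 1" using Basis_le_norm[of c x] by simp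
    then have "\<bar>x \<bullet> c\<bar> * \<bar>k (norm x)\<bar> \<le> 1 * Bk" using Bk by (intro mult_mono) auto
    then show "\<bar>(x \<bullet> c) * k (norm x)\<bar> \<le> Bk" by (simp add: abs_mult)
  qed
  have eq: "(\<Sum>c\<in>Basis. ((x \<bullet> c) * k (norm x)) * (W \<bullet> c)) = (W \<bullet> x) * k (norm x)" for x W :: 'a
    by (subst (3) euclidean_inner) (simp add: sum_distrib_left mult_ac)
  note L2 = L2[unfolded eq]
  have I1: "integrable ball_measure (\<lambda>x. f x * (m (norm x) * f x))" if "sq_int ball_measure f" for f :: "'a \<Rightarrow> real"
    using sq_int_mult[OF that sq_int_bounded_mult[OF that meas(1) Bm]] .
  have si: "sq_int ball_measure u" "sq_int ball_measure (U n)"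
    "sq_int ball_measure (\<lambda>x. (G x \<bullet> x) * k (norm x))" "sq_int ball_measure (\<lambda>x. (V n x \<bullet> x) * k (norm x))" for n
    using UV(3) L2 by (auto simp: L2_lim_def)
  have split: "(\<integral>x. 2 * (f x * h x) + f x * (f x * m (norm x)) \<partial>ball_measure)
      = 2 * (\<integral>x. f x * h x \<partial>ball_measure) + (\<integral>x. f x * (m (norm x) * f x) \<partial>ball_measure)"
    if "sq_int ball_measure f" "sq_int ball_measure h" for f h :: "'a \<Rightarrow> real"
    using I1[OF that(1)] sq_int_mult[OF that] by (simp add: mult.commute[of "m _"])
  have "(\<lambda>n. 2 * (\<integral>x. U n x * ((V n x \<bullet> x) * k (norm x)) \<partial>ball_measure)
      + (\<integral>x. U n x * (m (norm x) * U n x) \<partial>ball_measure)) \<longlonglongrightarrow>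
      2 * (\<integral>x. u x * ((G x \<bullet> x) * k (norm x)) \<partial>ball_measure) + (\<integral>x. u x * (m (norm x) * u x) \<partial>ball_measure)"
    by (intro tendsto_intros L2_lim_integral_mult UV(3) L1 L2)
  then show ?thesis
    unfolding split[OF si(2,4), symmetric] split[OF si(1,3), symmetric] 0
    by (simp add: m_def LIMSEQ_const_iff)
qed

section \<open>Hyperbolic integration by parts along radial fields\<close>

lemma C1_approximable_sq_int:
  assumes "C1_approximable u G"
  shows "sq_int ball_measure u" "b \<in> Basis \<Longrightarrow> sq_int ball_measure (\<lambda>x. G x \<bullet> b)"
  using assms unfolding C1_approximable_def L2_lim_def by (meson zero_less_one)+

lemma AE_ball_measure_nonzero: "AE x in (ball_measure :: 'a::euclidean_space measure). x \<noteq> 0 \<and> norm x < 1"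
proof -
  have "AE x in lborel. x \<noteq> (0::'a)" by (rule AE_lborel_singleton)
  then have "AE x in lebesgue. x \<noteq> (0::'a)" by (rule AE_completion)
  then show ?thesis by (subst AE_restrict_space_iff) (auto elim: AE_mp)
qed

lemma measurable_rad[measurable]: "rad \<in> borel_measurable borel"
  and measurable_conf[measurable]: "conf \<in> borel_measurable borel"
  and measurable_cut[measurable]: "cut n \<in> borel_measurable borel" "cut' n \<in> borel_measurable borel"
  by (simp_all add: rad_def[abs_def] conf_def[abs_def] cut_def[abs_def] cut'_def[abs_def])

lemma measurable_cosh_sinh[measurable]:
  "(cosh :: real \<Rightarrow> real) \<in> borel_measurable borel" "(sinh :: real \<Rightarrow> real) \<in> borel_measurable borel"
  by (auto intro!: borel_measurable_continuous_onI continuous_intros)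

text \<open>For a Euclidean gradient \<open>G\<close> of \<open>u\<close> this is the hyperbolic inner product of the gradients of \<open>u\<close> and \<open>r\<close>.\<close>

definition radial_part :: "('a::euclidean_space \<Rightarrow> 'a) \<Rightarrow> 'a \<Rightarrow> real" where
  "radial_part G x = (G x \<bullet> x) / (norm x * conf (norm x))"

text \<open>The three weighted integrals are mass, second moment and energy, the last for an
  arbitrary Euclidean field \<open>G\<close>. The notion is stable under subtracting a Gaussian and
  its gradient, which \<open>gauss_distance\<close> relies on.\<close>

definition hyp_pair :: "('a::euclidean_space \<Rightarrow> real) \<Rightarrow> ('a \<Rightarrow> 'a) \<Rightarrow> bool" where
  "hyp_pair u G \<longleftrightarrow> C1_approximable u G \<and>
     integrable ball_measure (\<lambda>x. conf (norm x) ^ DIM('a) * (u x)\<^sup>2) \<and>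
     integrable ball_measure (\<lambda>x. conf (norm x) ^ DIM('a) * ((rad (norm x))\<^sup>2 * (u x)\<^sup>2)) \<and>
     integrable ball_measure (\<lambda>x. conf (norm x) ^ DIM('a) * (norm (G x) / conf (norm x))\<^sup>2)"

lemma radial_part_le:
  assumes "norm x < 1"
  shows "\<bar>radial_part G x\<bar> \<le> norm (G x) / conf (norm x)"
proof (cases "x = 0")
  case True
  then show ?thesis using conf_pos[of "norm x"] assms by (simp add: radial_part_def)
next
  case False
  have c: "0 < conf (norm x)" using assms by (intro conf_pos) auto
  have "\<bar>G x \<bullet> x\<bar> / (norm x * conf (norm x)) \<le> norm (G x) * norm x / (norm x * conf (norm x))"
    using c by (intro divide_right_mono Cauchy_Schwarz_ineq2) auto
  then show ?thesis using False c by (simp add: radial_part_def abs_mult)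
qed

lemma inner_self_measurable:
  assumes "C1_approximable u G"
  shows "(\<lambda>x. G x \<bullet> x) \<in> borel_measurable ball_measure"
proof -
  have "(\<lambda>x. (G x \<bullet> b) * (x \<bullet> b)) \<in> borel_measurable ball_measure" if "b \<in> Basis" for b
    using C1_approximable_sq_int(2)[OF assms that]
    by (intro borel_measurable_times[OF _ ball_measure_borel_measurable]) (auto simp: sq_int_def)
  then have "(\<lambda>x. \<Sum>b\<in>Basis. (G x \<bullet> b) * (x \<bullet> b)) \<in> borel_measurable ball_measure"
    by (rule borel_measurable_sum)
  then show ?thesis by (simp add: euclidean_inner[symmetric])
qed

lemma radial_part_measurable:
  assumes "C1_approximable u G"
  shows "radial_part G \<in> borel_measurable ball_measure"
proof -
  have "(\<lambda>x. norm x * conf (norm x)) \<in> borel_measurable (ball_measure :: 'a measure)"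
    by (intro ball_measure_borel_measurable) simp
  then show ?thesis
    unfolding radial_part_def[abs_def] by (intro borel_measurable_divide inner_self_measurable[OF assms])
qed

text \<open>The definition of the conformal factor gives \<open>c * t\<^sup>2 = c - 2\<close>, which
  eliminates \<open>t\<^sup>2\<close>; the quotient \<open>(1 + t\<^sup>2) / (2 * t)\<close> is coth
  of the hyperbolic radius.\<close>

lemma radial_profile_algebra:
  fixes t c q q' m :: real
  assumes t: "t \<noteq> 0" and c: "c * (1 - t\<^sup>2) = 2"
  shows "(m + 1) * c * q + c * q' / t - q / t\<^sup>2
    = (c * (q' + (m + 1) * (q * ((1 + t\<^sup>2) / (2 * t)))) - (m + 2) * (q / t)) / t"
proof -
  have c': "c * t\<^sup>2 = c - 2" using c by (simp add: algebra_simps)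
  have "(m + 1) * c * q + c * q' / t - q / t\<^sup>2 = ((m + 1) * (c * t\<^sup>2) * q + c * q' * t - q) / t\<^sup>2"
    using t by (simp add: field_simps power2_eq_square)
  also have "\<dots> = (c * q' * t + (m + 1) * q * (c + c * t\<^sup>2) / 2 - (m + 2) * q) / t\<^sup>2"
    unfolding c' by (rule arg_cong[where f = "\<lambda>z. z / t\<^sup>2"]) (simp add: field_simps)
  also have "\<dots> = (c * (q' + (m + 1) * (q * ((1 + t\<^sup>2) / (2 * t)))) - (m + 2) * (q / t)) / t"
    using t by (simp add: field_simps power2_eq_square)
  finally show ?thesis .
qed

text \<open>Read in Euclidean terms, the field \<open>Q(r) grad r\<close> times the hyperbolic
  density has the profile \<open>conf t ^ (N - 1) * Q (rad t) / t\<close> along \<open>x\<close>.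
  Its Euclidean divergence \<open>t k' + N k\<close> is the density times
  \<open>Q' + (N - 1) Q coth r\<close>, the hyperbolic divergence. Writing \<open>N = m + 2\<close>
  avoids truncated subtraction in the exponents.\<close>

lemma radial_profile_has_derivative:
  assumes t: "0 < t" "t < 1" and Q: "(Q has_real_derivative Q' (rad t)) (at (rad t))" and N: "N = m + 2"
  shows "((\<lambda>t. conf t ^ (N - 1) * Q (rad t) / t) has_real_derivative
    (conf t ^ N * (Q' (rad t) + (real N - 1) * (Q (rad t) * (cosh (rad t) / sinh (rad t))))
      - real N * (conf t ^ (N - 1) * Q (rad t) / t)) / t) (at t)"
proof -
  have t': "\<bar>t\<bar> < 1" "t \<noteq> 0" using t by auto
  define c where "c = conf t"
  have c: "c * (1 - t\<^sup>2) = 2"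
    using one_minus_square_pos[OF t'(1)] unfolding c_def conf_def times_divide_eq_left
    by (intro nonzero_mult_div_cancel_right) simp
  have dQ: "((\<lambda>t. Q (rad t)) has_real_derivative Q' (rad t) * c) (at t)"
    unfolding c_def by (rule DERIV_chain2[OF Q rad_has_derivative[OF t'(1)]])
  have dc: "((\<lambda>t. conf t ^ (m + 1)) has_real_derivative (1 + real m) * (t * c\<^sup>2) * c ^ m) (at t)"
    using DERIV_power[OF conf_has_derivative[OF t'(1)], of "m + 1"] by (simp add: c_def mult_ac)
  have "((\<lambda>t. conf t ^ (m + 1) * Q (rad t) / t) has_real_derivative
    (((1 + real m) * (t * c\<^sup>2) * c ^ m * Q (rad t) + Q' (rad t) * c * c ^ (m + 1)) * t
      - c ^ (m + 1) * Q (rad t) * 1) / (t * t)) (at t)"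
    unfolding c_def[symmetric]
    by (rule DERIV_divide[OF DERIV_mult[OF dc[folded c_def] dQ, folded c_def] DERIV_ident t'(2), folded c_def])
  also have "(((1 + real m) * (t * c\<^sup>2) * c ^ m * Q (rad t) + Q' (rad t) * c * c ^ (m + 1)) * t
      - c ^ (m + 1) * Q (rad t) * 1) / (t * t)
    = c ^ (m + 1) * ((real m + 1) * c * Q (rad t) + c * Q' (rad t) / t - Q (rad t) / t\<^sup>2)"
    using t' by (simp add: field_simps power2_eq_square)
  also have "\<dots> = c ^ (m + 1) * ((c * (Q' (rad t) + (real m + 1) * (Q (rad t) * ((1 + t\<^sup>2) / (2 * t))))
      - (real m + 2) * (Q (rad t) / t)) / t)"
    by (simp only: radial_profile_algebra[OF t'(2) c])
  also have "\<dots> = (c ^ N * (Q' (rad t) + (real N - 1) * (Q (rad t) * (cosh (rad t) / sinh (rad t))))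
      - real N * (c ^ (N - 1) * Q (rad t) / t)) / t"
    unfolding coth_rad[OF t'(1)] N
    by (simp add: right_diff_distrib mult.assoc add.commute)
  finally show ?thesis by (simp add: N c_def)
qed

lemma integrable_ball_measure_bound:
  fixes f g :: "'a::euclidean_space \<Rightarrow> real"
  assumes "integrable ball_measure g" "f \<in> borel_measurable ball_measure"
    and "\<And>x. x \<noteq> 0 \<Longrightarrow> norm x < 1 \<Longrightarrow> \<bar>f x\<bar> \<le> g x"
  shows "integrable ball_measure f"
  using assms(1,2)
  by (rule Bochner_Integration.integrable_bound)
    (use AE_ball_measure_nonzero in \<open>eventually_elim, auto intro!: order_trans[OF assms(3) abs_ge_self]\<close>)

text \<open>The divergence of \<open>u\<^sup>2 M(r) grad r\<close> integrates to 0. This is first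
  obtained for \<open>M * cut n\<close>. The growth bounds are those under which \<open>I2\<close>
  is dominated by second moment and energy and \<open>I1\<close> by mass and second moment, so the
  cutoffs can be removed by dominated convergence.\<close>

lemma hyp_ibp:
  fixes u :: "'a::euclidean_space \<Rightarrow> real" and G :: "'a \<Rightarrow> 'a"
  assumes dim: "2 \<le> DIM('a)" and hp: "hyp_pair u G"
    and M: "\<And>r. 0 < r \<Longrightarrow> (M has_real_derivative M' r) (at r)"
    and M'_cont: "continuous_on {0<..} M'"
    and [measurable]: "M \<in> borel_measurable borel" "M' \<in> borel_measurable borel"
    and M_le: "\<And>r. 0 < r \<Longrightarrow> \<bar>M r\<bar> \<le> C * r" and M'_le: "\<And>r. 0 < r \<Longrightarrow> \<bar>M' r\<bar> \<le> C * (1 + r\<^sup>2)"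
  defines "I1 \<equiv> \<lambda>x. conf (norm x) ^ DIM('a) * ((u x)\<^sup>2 *
      (M' (rad (norm x)) + (real DIM('a) - 1) * (M (rad (norm x)) * (cosh (rad (norm x)) / sinh (rad (norm x))))))"
    and "I2 \<equiv> \<lambda>x. conf (norm x) ^ DIM('a) * (u x * radial_part G x * M (rad (norm x)))"
  shows "integrable ball_measure I1" "integrable ball_measure I2"
    "(\<integral>x. I1 x \<partial>ball_measure) = - 2 * (\<integral>x. I2 x \<partial>ball_measure)"
proof -
  obtain m where N: "DIM('a) = m + 2" using dim by (metis add.commute le_Suc_ex)
  let ?N = "DIM('a)"
  have app: "C1_approximable u G" using hp by (simp add: hyp_pair_def)
  have u_meas[measurable]: "u \<in> borel_measurable ball_measure"
    using C1_approximable_sq_int(1)[OF app] by (simp add: sq_int_def)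
  have gr_meas[measurable]: "radial_part G \<in> borel_measurable ball_measure"
    by (rule radial_part_measurable[OF app])
  have norm_meas: "(\<lambda>x. g (norm x)) \<in> borel_measurable (ball_measure :: 'a measure)"
    if "g \<in> borel_measurable borel" for g :: "real \<Rightarrow> real"
    by (rule ball_measure_borel_measurable, rule measurable_compose[OF _ that]) simp
  have C: "0 \<le> C" using order_trans[OF abs_ge_zero M_le[of 1]] by simp
  \<comment> \<open>\<open>D * (1 + r\<^sup>2)\<close> has to cover
    \<open>C * (5 + r\<^sup>2)\<close> from the derivative and
    \<open>(N - 1) * C * (2 + r\<^sup>2)\<close> from the coth term.\<close>
  define D where "D = C * (5 + 2 * real ?N)"
  define W1 where "W1 x = C * (conf (norm x) ^ ?N * ((rad (norm x))\<^sup>2 * (u x)\<^sup>2))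
      + C * (conf (norm x) ^ ?N * (norm (G x) / conf (norm x))\<^sup>2)" for x
  define W2 where "W2 x = D * (conf (norm x) ^ ?N * (u x)\<^sup>2)
      + D * (conf (norm x) ^ ?N * ((rad (norm x))\<^sup>2 * (u x)\<^sup>2))" for x
  have W: "integrable ball_measure W1" "integrable ball_measure W2"
    unfolding W1_def W2_def using hp by (auto simp: hyp_pair_def)
  have bound1: "2 * \<bar>conf (norm x) ^ ?N * (u x * radial_part G x * q)\<bar> \<le> W1 x"
    if x: "x \<noteq> 0" "norm x < 1" and q: "\<bar>q\<bar> \<le> C * rad (norm x)" for x q
  proof -
    define r g where "r = rad (norm x)" and "g = norm (G x) / conf (norm x)"
    have c: "0 \<le> conf (norm x) ^ ?N" using conf_pos[of "norm x"] x by simp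
    have "\<bar>u x * radial_part G x * q\<bar> \<le> \<bar>u x\<bar> * g * (C * r)"
    proof -
      have "\<bar>radial_part G x\<bar> \<le> g" "\<bar>q\<bar> \<le> C * r" "0 \<le> g"
        using radial_part_le[OF x(2), of G] q conf_pos[of "norm x"] x by (simp_all add: g_def r_def)
      then show ?thesis unfolding abs_mult by (intro mult_mono) auto
    qed
    also have "2 * (\<bar>u x\<bar> * g * (C * r)) \<le> C * (r\<^sup>2 * (u x)\<^sup>2 + g\<^sup>2)"
    proof -
      have "2 * (r * \<bar>u x\<bar> * g) \<le> r\<^sup>2 * (u x)\<^sup>2 + g\<^sup>2"
        using zero_le_power2[of "r * \<bar>u x\<bar> - g"] by (simp add: power2_diff power_mult_distrib)
      from mult_left_mono[OF this C] show ?thesis by (simp add: mult_ac)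
    qed
    finally have "2 * \<bar>u x * radial_part G x * q\<bar> \<le> C * (r\<^sup>2 * (u x)\<^sup>2 + g\<^sup>2)" by simp
    from mult_left_mono[OF this c] show ?thesis
      using c by (simp add: abs_mult W1_def r_def g_def algebra_simps)
  qed
  \<comment> \<open>The allowance 5 in place of 1 for \<open>q'\<close> accommodates the extra term
    \<open>M * cut' n\<close> in the derivative of the cut-off field, which is at most
    \<open>4 * C\<close>.\<close>
  have bound2: "\<bar>conf (norm x) ^ ?N * ((u x)\<^sup>2 * (q' + (real ?N - 1) * (q * (cosh (rad (norm x)) / sinh (rad (norm x))))))\<bar> \<le> W2 x"
    if x: "x \<noteq> 0" "norm x < 1" and q: "\<bar>q\<bar> \<le> C * rad (norm x)" "\<bar>q'\<bar> \<le> C * (5 + (rad (norm x))\<^sup>2)" for x q q'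
  proof -
    define r h where "r = rad (norm x)" and "h = cosh r / sinh r"
    have r: "0 < r" using x by (simp add: r_def rad_pos)
    have h: "0 < h" "r * h \<le> 1 + r" using r r_coth_le[OF r] by (simp_all add: h_def)
    have c: "0 \<le> conf (norm x) ^ ?N" using conf_pos[of "norm x"] x by simp
    have "\<bar>q * h\<bar> \<le> C * (r * h)" using mult_right_mono[OF q(1), of h] h by (simp add: abs_mult r_def mult_ac)
    also have "\<dots> \<le> C * (2 + r\<^sup>2)"
    proof (rule mult_left_mono[OF _ C])
      have "0 \<le> (r - 1)\<^sup>2" by simp
      then have "r \<le> 1 + r\<^sup>2" using r unfolding power2_diff by (simp add: power2_eq_square)
      with h show "r * h \<le> 2 + r\<^sup>2" by linarith
    qed
    finally have "\<bar>(real ?N - 1) * (q * h)\<bar> \<le> (real ?N - 1) * (C * (2 + r\<^sup>2))"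
      using dim unfolding abs_mult[of "real ?N - 1"] by (intro mult_mono) auto
    then have "\<bar>q' + (real ?N - 1) * (q * h)\<bar> \<le> C * (5 + r\<^sup>2) + (real ?N - 1) * (C * (2 + r\<^sup>2))"
      using q(2) unfolding r_def by linarith
    also have "\<dots> \<le> D * (1 + r\<^sup>2)"
    proof -
      have "C * (5 + r\<^sup>2) + (real ?N - 1) * (C * (2 + r\<^sup>2)) + C * (2 + 5 * r\<^sup>2 + r\<^sup>2 * real ?N)
          = C * (5 + 2 * real ?N) * (1 + r\<^sup>2)"
        by (simp add: algebra_simps)
      moreover have "0 \<le> C * (2 + 5 * r\<^sup>2 + r\<^sup>2 * real ?N)" using C by simp
      ultimately show ?thesis unfolding D_def by linarith
    qed
    finally have "(u x)\<^sup>2 * \<bar>q' + (real ?N - 1) * (q * h)\<bar> \<le> (u x)\<^sup>2 * (D * (1 + r\<^sup>2))"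
      by (intro mult_left_mono) auto
    from mult_left_mono[OF this c]
    have "conf (norm x) ^ ?N * ((u x)\<^sup>2 * \<bar>q' + (real ?N - 1) * (q * h)\<bar>) \<le> W2 x"
      by (simp add: W2_def r_def distrib_left mult_ac)
    then show ?thesis
      using c unfolding abs_mult h_def r_def by simp
  qed
  have I_meas: "I1 \<in> borel_measurable ball_measure" "I2 \<in> borel_measurable ball_measure"
  proof -
    have g: "(\<lambda>t. conf t ^ ?N) \<in> borel_measurable borel" "(\<lambda>t. M (rad t)) \<in> borel_measurable borel"
      "(\<lambda>t. M' (rad t) + (real ?N - 1) * (M (rad t) * (cosh (rad t) / sinh (rad t)))) \<in> borel_measurable borel"
      by measurable
    show "I1 \<in> borel_measurable ball_measure"
      unfolding I1_def by (intro borel_measurable_times borel_measurable_power u_meas norm_meas[OF g(1)] norm_meas[OF g(3)])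
    show "I2 \<in> borel_measurable ball_measure"
      unfolding I2_def by (intro borel_measurable_times u_meas gr_meas norm_meas[OF g(1)] norm_meas[OF g(2)])
  qed
  have M'_le5: "\<bar>M' r\<bar> \<le> C * (5 + r\<^sup>2)" if "0 < r" for r
    using order_trans[OF M'_le[OF that] mult_left_mono[OF _ C]] by simp
  show int1: "integrable ball_measure I1"
    by (rule integrable_ball_measure_bound[OF W(2) I_meas(1)])
      (unfold I1_def, intro bound2 M_le M'_le5 rad_pos; simp)
  show int2: "integrable ball_measure I2"
  proof (rule integrable_ball_measure_bound[OF W(1) I_meas(2)])
    fix x :: 'a assume x: "x \<noteq> 0" "norm x < 1"
    have "2 * \<bar>I2 x\<bar> \<le> W1 x" unfolding I2_def using x by (intro bound1 M_le rad_pos) auto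
    then show "\<bar>I2 x\<bar> \<le> W1 x" using abs_ge_zero[of "I2 x"] by linarith
  qed
  define Q where "Q n r = M r * cut n r" for n r
  define Q' where "Q' n r = M' r * cut n r + M r * cut' n r" for n r
  have dQ: "(Q n has_real_derivative Q' n r) (at r)" if "0 < r" for n r
    using DERIV_mult[OF M[OF that] cut_has_derivative[OF that, of n]]
    by (simp add: Q_def[abs_def] Q'_def mult.commute)
  have Q'_cont: "continuous_on {0<..} (Q' n)" for n
    unfolding Q'_def
    by (intro continuous_intros M'_cont cut'_continuous continuous_at_imp_continuous_on ballI
        DERIV_isCont[OF M] DERIV_isCont[OF cut_has_derivative]) auto
  have Q_le: "\<bar>Q n r\<bar> \<le> C * r" if "0 < r" for n r
    using mult_mono[OF M_le[OF that] cut_bounds(2)[of n r]] that C cut_bounds(1)[of n r]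
    by (simp add: Q_def abs_mult)
  have Q'_le: "\<bar>Q' n r\<bar> \<le> C * (5 + r\<^sup>2)" if r: "0 < r" for n r
  proof -
    have "\<bar>M' r * cut n r\<bar> \<le> C * (1 + r\<^sup>2)"
      using mult_mono[OF M'_le[OF r] cut_bounds(2)[of n r]] C cut_bounds(1)[of n r]
      by (simp add: abs_mult)
    moreover have "\<bar>M r * cut' n r\<bar> \<le> C * r * \<bar>cut' n r\<bar>"
      unfolding abs_mult by (intro mult_right_mono M_le r) auto
    moreover have "C * (r * \<bar>cut' n r\<bar>) \<le> C * 4"
    proof (rule mult_left_mono[OF _ C])
      have "4 / real (Suc n) \<le> 4" by (simp add: field_simps)
      then show "r * \<bar>cut' n r\<bar> \<le> 4" using r_cut'_le[OF r, of n] by linarith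
    qed
    ultimately show ?thesis unfolding Q'_def by (simp add: algebra_simps)
  qed
  \<comment> \<open>Outside the interval from 0 to 1 the formula for \<open>rad\<close> has no
    meaning. The value 0 there is consistent because the cutoff vanishes near both ends.\<close>
  define k where "k n t = (if 0 < t \<and> t < 1 then conf t ^ (?N - 1) * Q n (rad t) / t else 0)" for n t
  define k' where "k' n t = (if 0 < t \<and> t < 1 then
      (conf t ^ ?N * (Q' n (rad t) + (real ?N - 1) * (Q n (rad t) * (cosh (rad t) / sinh (rad t))))
      - real ?N * (conf t ^ (?N - 1) * Q n (rad t) / t)) / t else 0)" for n t
  have dk: "(k n has_real_derivative k' n t) (at t)" if t: "0 < t" "t < 1" for n t
  proof -
    have "((\<lambda>t. conf t ^ (?N - 1) * Q n (rad t) / t) has_real_derivative k' n t) (at t)"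
      using radial_profile_has_derivative[where Q = "Q n" and Q' = "Q' n", OF t dQ[OF rad_pos[OF t]] N] t
      by (simp add: k'_def)
    then show ?thesis
      by (rule has_field_derivative_transform_within_open[where S = "{0<..<1}"]) (use t in \<open>auto simp: k_def\<close>)
  qed
  have k'_cont: "continuous_on {0<..<1} (k' n)" for n
  proof -
    have rad_cont: "continuous_on {0<..<1} rad" "continuous_on {0<..<1} conf"
      by (auto intro!: continuous_at_imp_continuous_on DERIV_isCont[OF rad_has_derivative]
          DERIV_isCont[OF conf_has_derivative])
    have Q_cont: "continuous_on {0<..} (Q n)"
      by (auto intro!: continuous_at_imp_continuous_on DERIV_isCont[OF dQ])
    have "continuous_on {0<..<1} (\<lambda>t. (conf t ^ ?N * (Q' n (rad t) + (real ?N - 1) * (Q n (rad t) * (cosh (rad t) / sinh (rad t))))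
      - real ?N * (conf t ^ (?N - 1) * Q n (rad t) / t)) / t)"
      by (intro continuous_intros rad_cont continuous_on_compose2[OF Q_cont] continuous_on_compose2[OF Q'_cont])
        (auto simp: rad_pos less_imp_neq[OF rad_pos, symmetric])
    then show ?thesis by (rule continuous_on_eq) (auto simp: k'_def)
  qed
  \<comment> \<open>The Euclidean radii at which the hyperbolic radius is
    \<open>exp (- (n + 1))\<close> and \<open>exp (n + 1)\<close>, the ends of the support of
    \<open>cut n\<close>.\<close>
  define a b where "a n = unrad (exp (- real (Suc n)))" and "b n = unrad (exp (real (Suc n)))" for n
  have ab: "0 < a n" "b n < 1" for n by (auto simp: a_def b_def unrad_bounds)
  have supp: "k n t = 0" "k' n t = 0" if "t < a n \<or> b n < t" for n t
  proof -
    have "Q n (rad t) = 0 \<and> Q' n (rad t) = 0" if "0 < t" "t < 1"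
    proof -
      have "rad t \<le> exp (- real (Suc n)) \<or> \<not> rad t \<le> exp (real (Suc n))"
        using \<open>t < a n \<or> b n < t\<close> that by (subst (1 2) rad_le_iff) (auto simp: a_def b_def)
      then show ?thesis
        using cut_eq_0[OF rad_pos[OF that], of n] by (auto simp: Q_def Q'_def)
    qed
    then show "k n t = 0" "k' n t = 0" by (auto simp: k_def k'_def)
  qed
  have k_cont: "continuous_on {0<..<1} (k n)" for n
    using dk by (auto intro!: continuous_at_imp_continuous_on DERIV_isCont)
  have k_meas: "k n \<in> borel_measurable borel" "k' n \<in> borel_measurable borel" for n
    using compactly_supported_continuous(1)[OF k_cont ab supp(1)]
      compactly_supported_continuous(1)[OF k'_cont ab supp(2)]
    by (auto intro: borel_measurable_continuous_onI)
  define F where "F n x = 2 * (u x * ((G x \<bullet> x) * k n (norm x)))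
      + u x * (u x * (norm x * k' n (norm x) + real ?N * k n (norm x)))" for n x
  have F_0: "(\<integral>x. F n x \<partial>ball_measure) = 0" for n
    unfolding F_def by (rule radial_divergence_weak[OF app ab dk k'_cont supp])
  have F_meas: "F n \<in> borel_measurable ball_measure" for n
    unfolding F_def
    by (intro borel_measurable_times borel_measurable_add borel_measurable_const u_meas inner_self_measurable[OF app]
        norm_meas k_meas norm_meas[of "\<lambda>t. t"]) simp
  have F_eq: "F n x = 2 * (conf (norm x) ^ ?N * (u x * radial_part G x * Q n (rad (norm x))))
      + conf (norm x) ^ ?N * ((u x)\<^sup>2 * (Q' n (rad (norm x))
         + (real ?N - 1) * (Q n (rad (norm x)) * (cosh (rad (norm x)) / sinh (rad (norm x))))))"
    if x: "x \<noteq> 0" "norm x < 1" for n x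
  proof -
    have c: "conf (norm x) \<noteq> 0" using conf_pos[of "norm x"] x by simp
    have "(G x \<bullet> x) * k n (norm x) = conf (norm x) ^ ?N * (radial_part G x * Q n (rad (norm x)))"
      using x c by (simp add: k_def radial_part_def N field_simps)
    moreover have "norm x * k' n (norm x) + real ?N * k n (norm x) = conf (norm x) ^ ?N * (Q' n (rad (norm x))
         + (real ?N - 1) * (Q n (rad (norm x)) * (cosh (rad (norm x)) / sinh (rad (norm x)))))"
      using x by (simp add: k_def k'_def)
    ultimately show ?thesis unfolding F_def by (simp add: power2_eq_square mult_ac)
  qed
  have "(\<lambda>n. \<integral>x. F n x \<partial>ball_measure) \<longlonglongrightarrow> (\<integral>x. 2 * I2 x + I1 x \<partial>ball_measure)"
  proof (rule integral_dominated_convergence)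
    show "integrable ball_measure (\<lambda>x. W1 x + W2 x)" using W by simp
    show "AE x in ball_measure. norm (F n x) \<le> W1 x + W2 x" for n
      using AE_ball_measure_nonzero
    proof eventually_elim
      fix x :: 'a assume "x \<noteq> 0 \<and> norm x < 1"
      then have x: "x \<noteq> 0" "norm x < 1" by auto
      then have r: "0 < rad (norm x)" by (simp add: rad_pos)
      show "norm (F n x) \<le> W1 x + W2 x"
      proof -
        have "\<bar>2 * A + B\<bar> \<le> w1 + w2" if "2 * \<bar>A\<bar> \<le> w1" "\<bar>B\<bar> \<le> w2" for A B w1 w2 :: real
          using that by linarith
        from this[OF bound1[OF x Q_le[OF r]] bound2[OF x Q_le[OF r] Q'_le[OF r]]] show ?thesis
          unfolding F_eq[OF x] real_norm_def .
      qed
    qed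
    show "AE x in ball_measure. (\<lambda>n. F n x) \<longlonglongrightarrow> 2 * I2 x + I1 x"
      using AE_ball_measure_nonzero
    proof eventually_elim
      fix x :: 'a assume "x \<noteq> 0 \<and> norm x < 1"
      then have x: "x \<noteq> 0" "norm x < 1" by auto
      then have r: "0 < rad (norm x)" by (simp add: rad_pos)
      have q: "(\<lambda>n. Q n (rad (norm x))) \<longlonglongrightarrow> M (rad (norm x)) * 1"
        "(\<lambda>n. Q' n (rad (norm x))) \<longlonglongrightarrow> M' (rad (norm x)) * 1 + M (rad (norm x)) * 0"
        unfolding Q_def Q'_def by (intro tendsto_intros cut_tendsto r)+
      show "(\<lambda>n. F n x) \<longlonglongrightarrow> 2 * I2 x + I1 x"
        unfolding F_eq[OF x] I1_def I2_def
        by (intro tendsto_intros q[simplified])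
    qed
  qed (use F_meas I_meas in auto)
  then have "(\<integral>x. 2 * I2 x + I1 x \<partial>ball_measure) = 0"
    unfolding F_0 by (simp add: LIMSEQ_const_iff)
  then show "(\<integral>x. I1 x \<partial>ball_measure) = - 2 * (\<integral>x. I2 x \<partial>ball_measure)"
    using int1 int2 by simp
qed

section \<open>Completing the square in the deficits\<close>

text \<open>As \<open>conf (norm x) / norm x *\<^sub>R x\<close> is the Euclidean gradient of \<open>r\<close>, this is \<open>G + u w(r) grad r\<close>.\<close>

definition twist :: "(real \<Rightarrow> real) \<Rightarrow> ('a::euclidean_space \<Rightarrow> real) \<Rightarrow> ('a \<Rightarrow> 'a) \<Rightarrow> 'a \<Rightarrow> 'a" where
  "twist w u G x = G x + (u x * w (rad (norm x)) * conf (norm x) / norm x) *\<^sub>R x"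

text \<open>The squared Riemannian norm of the gradient, times the density of the hyperbolic volume.\<close>

definition grad_sq :: "('a::euclidean_space \<Rightarrow> 'a) \<Rightarrow> 'a \<Rightarrow> real" where
  "grad_sq G x = conf (norm x) ^ DIM('a) * (norm (G x) / conf (norm x))\<^sup>2"

lemma radial_part_twist:
  assumes "x \<noteq> 0" "norm x < 1"
  shows "radial_part (twist w u G) x = radial_part G x + u x * w (rad (norm x))"
proof -
  have "conf (norm x) \<noteq> 0" using conf_pos[of "norm x"] assms by simp
  moreover have "x \<bullet> x = norm x * norm x" by (simp add: power2_norm_eq_inner[symmetric] power2_eq_square)
  ultimately show ?thesis
    using assms by (simp add: radial_part_def twist_def inner_add_left field_simps)
qed

lemma grad_sq_twist:
  fixes x :: "'a::euclidean_space"
  assumes "x \<noteq> 0" "norm x < 1"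
  shows "grad_sq (twist w u G) x = grad_sq G x
    + 2 * (conf (norm x) ^ DIM('a) * (u x * radial_part G x * w (rad (norm x))))
    + conf (norm x) ^ DIM('a) * ((w (rad (norm x)))\<^sup>2 * (u x)\<^sup>2)"
proof -
  define c p where "c = conf (norm x)" and "p = u x * w (rad (norm x))"
  have c: "c \<noteq> 0" using conf_pos[of "norm x"] assms by (simp add: c_def)
  have "(norm (twist w u G x))\<^sup>2 = (norm (G x))\<^sup>2 + 2 * (p * c / norm x * (G x \<bullet> x)) + (p * c / norm x)\<^sup>2 * (norm x)\<^sup>2"
    unfolding twist_def c_def[symmetric] p_def[symmetric] power2_norm_eq_inner
    by (simp add: inner_add_left inner_add_right inner_commute power2_eq_square mult_ac)
  then have "(norm (twist w u G x) / c)\<^sup>2 = (norm (G x) / c)\<^sup>2 + 2 * (p * radial_part G x) + p\<^sup>2"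
    using assms c by (simp add: radial_part_def c_def[symmetric] power_divide field_simps power2_eq_square)
  then show ?thesis
    by (simp add: grad_sq_def c_def[symmetric] p_def power_mult_distrib algebra_simps)
qed

section \<open>From the hyperbolic definitions to integrals over the Euclidean ball\<close>

lemma hyp_vol_integral:
  fixes f :: "'a::euclidean_space \<Rightarrow> real"
  assumes "f \<in> borel_measurable ball_measure"
  shows "integrable hyp_vol f \<longleftrightarrow> integrable ball_measure (\<lambda>x. conf (norm x) ^ DIM('a) * f x)"
    "(\<integral>x. f x \<partial>hyp_vol) = (\<integral>x. conf (norm x) ^ DIM('a) * f x \<partial>ball_measure)"
proof -
  have m: "(\<lambda>x::'a. conf (norm x) ^ DIM('a)) \<in> borel_measurable ball_measure"
    by (intro ball_measure_borel_measurable) measurable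
  have nn: "AE x in ball_measure. 0 \<le> conf (norm x) ^ DIM('a)"
    using AE_ball_measure_nonzero by eventually_elim (auto intro!: less_imp_le[OF conf_pos] zero_le_power)
  have eq: "(hyp_vol :: 'a measure) = density ball_measure (\<lambda>x. ennreal (conf (norm x) ^ DIM('a)))"
    by (simp add: hyp_vol_def conf_def)
  show "integrable hyp_vol f \<longleftrightarrow> integrable ball_measure (\<lambda>x. conf (norm x) ^ DIM('a) * f x)"
    unfolding eq using integrable_density[OF assms m nn] by simp
  show "(\<integral>x. f x \<partial>hyp_vol) = (\<integral>x. conf (norm x) ^ DIM('a) * f x \<partial>ball_measure)"
    unfolding eq using integral_density[OF assms m nn] by simp
qed

lemma borel_measurable_hyp_vol:
  "f \<in> borel_measurable (hyp_vol :: 'a::euclidean_space measure) \<longleftrightarrow> f \<in> borel_measurable ball_measure"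
  by (simp add: hyp_vol_def)

lemma AE_hyp_vol:
  "(AE x in hyp_vol. P (x::'a::euclidean_space)) \<longleftrightarrow> (AE x in ball_measure. P x)"
proof -
  have "(\<lambda>x::'a. ennreal ((2 / (1 - (norm x)\<^sup>2)) ^ DIM('a))) \<in> borel_measurable ball_measure"
    by (intro measurable_compose[OF _ measurable_ennreal] ball_measure_borel_measurable) measurable
  then have "(AE x in hyp_vol. P x) \<longleftrightarrow> (AE x in ball_measure. 0 < ennreal ((2 / (1 - (norm x)\<^sup>2)) ^ DIM('a)) \<longrightarrow> P x)"
    unfolding hyp_vol_def by (rule AE_density)
  also have "\<dots> \<longleftrightarrow> (AE x in ball_measure. P x)"
  proof -
    have "AE x in (ball_measure :: 'a measure). 0 < ennreal ((2 / (1 - (norm x)\<^sup>2)) ^ DIM('a))"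
      using AE_ball_measure_nonzero
    proof eventually_elim
      fix x :: 'a assume "x \<noteq> 0 \<and> norm x < 1"
      then have "0 < conf (norm x)" by (intro conf_pos) simp
      then show "0 < ennreal ((2 / (1 - (norm x)\<^sup>2)) ^ DIM('a))" by (simp add: conf_def)
    qed
    then show ?thesis by (auto elim: AE_mp)
  qed
  finally show ?thesis .
qed

text \<open>Local integrability gives measurability on compact subsets. The ball is exhausted by the
  closed balls \<open>C n\<close>, and the zero extensions from them converge pointwise.\<close>

lemma loc_integrable_measurable:
  fixes G :: "'a::euclidean_space \<Rightarrow> 'a"
  assumes "loc_integrable G"
  shows "(\<lambda>x. G x \<bullet> b) \<in> borel_measurable ball_measure"
proof -
  define C where "C n = cball (0::'a) (1 - inverse (real (Suc n)))" for n
  have "G absolutely_integrable_on C n" for n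
    using assms unfolding loc_integrable_def C_def by (auto simp: cball_subset_ball_iff)
  then have "G \<in> borel_measurable (lebesgue_on (C n))" for n
    by (intro absolutely_integrable_measurable[THEN iffD1, THEN conjunct1]) (auto simp: C_def)
  then have m: "(\<lambda>x. G x \<bullet> b) \<in> borel_measurable (lebesgue_on (C n))" for n
    by (intro borel_measurable_inner) auto
  have "(\<lambda>x. if x \<in> ball 0 1 then G x \<bullet> b else 0) \<in> borel_measurable lebesgue"
  proof (rule borel_measurable_LIMSEQ_real)
    show "(\<lambda>x. if x \<in> C n then G x \<bullet> b else 0) \<in> borel_measurable lebesgue" for n
      by (rule borel_measurable_if_I[OF m]) (simp add: C_def)
    show "(\<lambda>n. if x \<in> C n then G x \<bullet> b else 0) \<longlonglongrightarrow> (if x \<in> ball 0 1 then G x \<bullet> b else 0)" for x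
    proof (cases "norm x < 1")
      case True
      then have "\<forall>\<^sub>F n in sequentially. inverse (real (Suc n)) < 1 - norm x"
        using order_tendstoD(2)[OF LIMSEQ_inverse_real_of_nat, of "1 - norm x"] by simp
      then have "\<forall>\<^sub>F n in sequentially. (if x \<in> C n then G x \<bullet> b else 0) = G x \<bullet> b"
        by eventually_elim (simp add: C_def)
      then show ?thesis
        using True by (simp add: tendsto_eventually)
    next
      case False
      have "\<not> norm x \<le> 1 - inverse (real (Suc n))" for n
      proof -
        have "0 < inverse (real (Suc n))" by simp
        then show ?thesis using False by linarith
      qed
      then have "x \<notin> C n" for n by (simp add: C_def)
      then show ?thesis using False by simp
    qed
  qed
  then show ?thesis by (rule borel_measurable_if_D)
qed

lemma norm_measurable_ball:
  fixes G :: "'a::euclidean_space \<Rightarrow> 'a"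
  assumes "\<And>b. b \<in> Basis \<Longrightarrow> (\<lambda>x. G x \<bullet> b) \<in> borel_measurable ball_measure"
  shows "(\<lambda>x. norm (G x)) \<in> borel_measurable ball_measure"
proof -
  have [measurable]: "G \<in> borel_measurable ball_measure"
    using assms by (subst borel_measurable_euclidean_space) auto
  show ?thesis by measurable
qed

lemma radial_measurable:
  fixes g :: "real \<Rightarrow> real"
  assumes "g \<in> borel_measurable borel"
  shows "(\<lambda>x. g (norm x)) \<in> borel_measurable (ball_measure :: 'a::euclidean_space measure)"
  by (rule ball_measure_borel_measurable, rule measurable_compose[OF _ assms]) simp

text \<open>Raising the index contributes the inverse square of the conformal factor and the
  Riemannian norm restores one factor, which leaves a single inverse factor on the Euclidean
  norm.\<close>

lemma hyp_norm_hyp_grad: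
  assumes "norm x < 1"
  shows "(hyp_norm x (hyp_grad u x))\<^sup>2 = (norm (weak_grad u x) / conf (norm x))\<^sup>2"
proof -
  define c where "c = conf (norm x)"
  have c: "0 < c" unfolding c_def by (rule conf_pos) (use assms in simp)
  have i: "(1 - (norm x)\<^sup>2) / 2 = 1 / c" by (simp add: c_def conf_def)
  have s: "2 / (1 - (norm x)\<^sup>2) = c" by (simp add: c_def conf_def)
  have "(hyp_norm x (hyp_grad u x))\<^sup>2 = c\<^sup>2 * ((1 / c)\<^sup>2 * (1 / c)\<^sup>2 * (norm (weak_grad u x))\<^sup>2)"
    unfolding hyp_norm_def hyp_inner_def hyp_grad_def i s
    by (simp add: power2_norm_eq_inner mult.assoc)
  also have "\<dots> = (norm (weak_grad u x) / c)\<^sup>2"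
    using c by (simp add: power2_eq_square field_simps)
  finally show ?thesis by (simp add: c_def)
qed

lemma egrad_hyp_rho:
  assumes "x \<noteq> 0" "norm x < 1"
  shows "egrad hyp_rho x = (conf (norm x) / norm x) *\<^sub>R x"
proof -
  have "(norm has_derivative (\<lambda>h. (x \<bullet> h) / norm x)) (at x)"
    using assms(1)
    by (intro has_derivative_eq_rhs[OF has_derivative_norm])
      (auto simp: sgn_div_norm inner_commute divide_inverse mult.commute)
  from has_derivative_compose[OF this rad_has_derivative[unfolded has_field_derivative_def]] assms
  have "(hyp_rho has_derivative (\<lambda>h. conf (norm x) * (x \<bullet> h / norm x))) (at x)"
    by (simp add: hyp_rho_eq[abs_def])
  from frechet_derivative_at[OF this]
  have "frechet_derivative hyp_rho (at x) = (\<lambda>h. conf (norm x) * (x \<bullet> h / norm x))" by simp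
  then have "egrad hyp_rho x = (\<Sum>b\<in>Basis. (conf (norm x) / norm x) *\<^sub>R ((x \<bullet> b) *\<^sub>R b))"
    by (simp add: egrad_def mult.commute)
  also have "\<dots> = (conf (norm x) / norm x) *\<^sub>R (\<Sum>b\<in>Basis. (x \<bullet> b) *\<^sub>R b)"
    by (simp only: scaleR_sum_right)
  finally show ?thesis by (simp only: euclidean_representation)
qed

lemma hyp_inner_grad_rho:
  assumes "x \<noteq> 0" "norm x < 1"
  shows "hyp_inner x (hyp_grad u x) (hyp_grad_rho x) = radial_part (weak_grad u) x"
proof -
  define c where "c = conf (norm x)"
  have c: "0 < c" unfolding c_def by (rule conf_pos) (use assms in simp)
  have i: "(1 - (norm x)\<^sup>2) / 2 = 1 / c" by (simp add: c_def conf_def)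
  have s: "2 / (1 - (norm x)\<^sup>2) = c" by (simp add: c_def conf_def)
  show ?thesis
    unfolding hyp_inner_def hyp_grad_def hyp_grad_rho_def egrad_hyp_rho[OF assms] i s radial_part_def
    unfolding c_def[symmetric]
    using c by (simp add: field_simps power2_eq_square)
qed

lemma heis_dom_hyp_pair:
  fixes u :: "'a::euclidean_space \<Rightarrow> real"
  assumes dim: "2 \<le> DIM('a)" and u: "u \<in> heis_dom"
  shows "hyp_pair u (weak_grad u)"
    and "energy u = (\<integral>x. grad_sq (weak_grad u) x \<partial>ball_measure)"
    and "second_moment u = (\<integral>x. conf (norm x) ^ DIM('a) * ((rad (norm x))\<^sup>2 * (u x)\<^sup>2) \<partial>ball_measure)"
    and "\<not> (AE x in ball_measure. u x = 0)"
proof -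
  let ?G = "weak_grad u"
  have wg: "has_weak_grad u ?G"
  proof -
    have "\<exists>G. has_weak_grad u G" using u by (simp add: heis_dom_def W12_def)
    from someI_ex[OF this] show ?thesis by (simp add: weak_grad_def)
  qed
  have um: "u \<in> borel_measurable ball_measure"
    using u by (simp add: heis_dom_def W12_def borel_measurable_hyp_vol)
  have Gm: "(\<lambda>x. ?G x \<bullet> b) \<in> borel_measurable ball_measure" for b
    using wg loc_integrable_measurable by (auto simp: has_weak_grad_def)
  have nGm: "(\<lambda>x. norm (?G x)) \<in> borel_measurable ball_measure"
    by (rule norm_measurable_ball[OF Gm])
  have conf_m: "(\<lambda>x::'a. conf (norm x)) \<in> borel_measurable ball_measure"
    by (rule radial_measurable) simp
  have rad_m: "(\<lambda>x::'a. rad (norm x)) \<in> borel_measurable ball_measure"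
    by (rule radial_measurable) simp
  have m1: "(\<lambda>x. (u x)\<^sup>2) \<in> borel_measurable ball_measure"
    by (intro borel_measurable_power um)
  have m2: "(\<lambda>x. (rad (norm x))\<^sup>2 * (u x)\<^sup>2) \<in> borel_measurable ball_measure"
    by (intro borel_measurable_times borel_measurable_power um rad_m)
  have m3: "(\<lambda>x. (norm (?G x) / conf (norm x))\<^sup>2) \<in> borel_measurable ball_measure"
    by (intro borel_measurable_power borel_measurable_divide nGm conf_m)
  have m4: "(\<lambda>x. (hyp_norm x (hyp_grad u x))\<^sup>2) \<in> borel_measurable ball_measure"
    using m3 by (rule measurable_cong[THEN iffD1, rotated]) (simp add: hyp_norm_hyp_grad)
  have I1: "integrable ball_measure (\<lambda>x. conf (norm x) ^ DIM('a) * (u x)\<^sup>2)"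
    using u hyp_vol_integral(1)[OF m1] by (simp add: heis_dom_def W12_def)
  have I2: "integrable ball_measure (\<lambda>x. conf (norm x) ^ DIM('a) * ((rad (norm x))\<^sup>2 * (u x)\<^sup>2))"
    using u hyp_vol_integral(1)[OF m2] by (simp add: heis_dom_def hyp_rho_eq)
  have "integrable ball_measure (\<lambda>x. conf (norm x) ^ DIM('a) * (hyp_norm x (hyp_grad u x))\<^sup>2)"
    using u hyp_vol_integral(1)[OF m4] by (simp add: heis_dom_def W12_def)
  then have I3: "integrable ball_measure (\<lambda>x. conf (norm x) ^ DIM('a) * (norm (?G x) / conf (norm x))\<^sup>2)"
    by (rule Bochner_Integration.integrable_cong[THEN iffD1, OF refl, rotated]) (simp add: hyp_norm_hyp_grad)
  \<comment> \<open>The density is at least 1, so weighted integrability implies plain integrability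
    on the ball. For the gradient the net weight is \<open>conf (norm x) ^ (N - 2)\<close>, and here
    dimension at least 2 enters.\<close>
  have c1: "1 \<le> conf (norm x) ^ n" if "norm x < 1" for x :: 'a and n
    using conf_ge_2[of "norm x"] that by (intro one_le_power) auto
  have "integrable ball_measure (\<lambda>x. (u x)\<^sup>2)"
    by (rule integrable_ball_measure_bound[OF I1 m1]) (use c1 mult_right_mono[OF c1] in fastforce)
  then have su: "sq_int ball_measure u" using um by (simp add: sq_int_def)
  have sG: "sq_int ball_measure (\<lambda>x. ?G x \<bullet> b)" if b: "b \<in> Basis" for b
  proof -
    have "integrable ball_measure (\<lambda>x. (?G x \<bullet> b)\<^sup>2)"
    proof (rule integrable_ball_measure_bound[OF I3])
      show "(\<lambda>x. (?G x \<bullet> b)\<^sup>2) \<in> borel_measurable ball_measure"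
        by (intro borel_measurable_power Gm)
      fix x :: 'a assume x: "x \<noteq> 0" "norm x < 1"
      have "0 < conf (norm x)" using x by (intro conf_pos) simp
      moreover obtain m where "DIM('a) = m + 2" using dim by (metis add.commute le_Suc_ex)
      ultimately have "conf (norm x) ^ DIM('a) * (norm (?G x) / conf (norm x))\<^sup>2 = conf (norm x) ^ m * (norm (?G x))\<^sup>2"
        by (simp add: power_divide power2_eq_square)
      moreover have "(norm (?G x))\<^sup>2 \<le> conf (norm x) ^ m * (norm (?G x))\<^sup>2"
        using mult_right_mono[OF c1[OF x(2), of m], of "(norm (?G x))\<^sup>2"] by simp
      moreover have "\<bar>?G x \<bullet> b\<bar>\<^sup>2 \<le> (norm (?G x))\<^sup>2"
        by (intro power_mono Basis_le_norm b) simp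
      ultimately show "\<bar>(?G x \<bullet> b)\<^sup>2\<bar> \<le> conf (norm x) ^ DIM('a) * (norm (?G x) / conf (norm x))\<^sup>2" by simp
    qed
    then show ?thesis using Gm by (simp add: sq_int_def)
  qed
  have "C1_approximable u ?G"
    unfolding C1_approximable_def
  proof (intro allI impI)
    fix s :: real assume "s < 1"
    from smooth_approximation[OF wg su sG this] obtain U V where
      "\<And>n x. norm x < s \<Longrightarrow> (U n has_derivative (\<lambda>h. V n x \<bullet> h)) (at x)"
      "\<And>n. continuous_on UNIV (V n)" "L2_lim ball_measure U u"
      "\<And>b. b \<in> Basis \<Longrightarrow> L2_lim ball_measure (\<lambda>n x. V n x \<bullet> b) (\<lambda>x. ?G x \<bullet> b)"
      by metis
    then show "\<exists>U V. (\<forall>n x. norm x < s \<longrightarrow> (U n has_derivative (\<bullet>) (V n x)) (at x)) \<and>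
             (\<forall>n. continuous_on (ball 0 s) (V n)) \<and>
             L2_lim ball_measure U u \<and> (\<forall>b\<in>Basis. L2_lim ball_measure (\<lambda>n x. V n x \<bullet> b) (\<lambda>x. ?G x \<bullet> b))"
      by (intro exI[of _ U] exI[of _ V]) (auto intro: continuous_on_subset)
  qed
  with I1 I2 I3 show "hyp_pair u ?G" by (simp add: hyp_pair_def)
  show "energy u = (\<integral>x. grad_sq (weak_grad u) x \<partial>ball_measure)"
    unfolding energy_def hyp_vol_integral(2)[OF m4] grad_sq_def
    by (intro Bochner_Integration.integral_cong) (auto simp: hyp_norm_hyp_grad)
  show "second_moment u = (\<integral>x. conf (norm x) ^ DIM('a) * ((rad (norm x))\<^sup>2 * (u x)\<^sup>2) \<partial>ball_measure)"
    unfolding second_moment_def hyp_rho_eq hyp_vol_integral(2)[OF m2] ..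
  show "\<not> (AE x in ball_measure. u x = 0)"
    using u by (simp add: heis_dom_def AE_hyp_vol)
qed

text \<open>Integrates the expansion in \<open>grad_sq_twist\<close>. Linear growth of
  \<open>w\<close> bounds the quadratic term by the second moment and the cross term by that and the
  energy, so the integral may be split.\<close>

lemma twist_energy:
  fixes u :: "'a::euclidean_space \<Rightarrow> real"
  assumes hp: "hyp_pair u G" and [measurable]: "w \<in> borel_measurable borel"
    and w: "\<And>r. 0 < r \<Longrightarrow> \<bar>w r\<bar> \<le> C * r"
  shows "integrable ball_measure (\<lambda>x. conf (norm x) ^ DIM('a) * (u x * radial_part G x * w (rad (norm x))))"
    and "integrable ball_measure (\<lambda>x. conf (norm x) ^ DIM('a) * ((w (rad (norm x)))\<^sup>2 * (u x)\<^sup>2))"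
    and "integrable ball_measure (grad_sq (twist w u G))"
    and "(\<integral>x. grad_sq (twist w u G) x \<partial>ball_measure) = (\<integral>x. grad_sq G x \<partial>ball_measure)
      + 2 * (\<integral>x. conf (norm x) ^ DIM('a) * (u x * radial_part G x * w (rad (norm x))) \<partial>ball_measure)
      + (\<integral>x. conf (norm x) ^ DIM('a) * ((w (rad (norm x)))\<^sup>2 * (u x)\<^sup>2) \<partial>ball_measure)"
proof -
  let ?N = "DIM('a)"
  have app: "C1_approximable u G" using hp by (simp add: hyp_pair_def)
  have um: "u \<in> borel_measurable ball_measure"
    using C1_approximable_sq_int(1)[OF app] by (simp add: sq_int_def)
  have gm: "radial_part G \<in> borel_measurable ball_measure" by (rule radial_part_measurable[OF app])
  have Gm: "(\<lambda>x. norm (G x)) \<in> borel_measurable ball_measure"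
    using C1_approximable_sq_int(2)[OF app] by (intro norm_measurable_ball) (simp add: sq_int_def)
  have rm: "(\<lambda>x::'a. conf (norm x)) \<in> borel_measurable ball_measure"
    "(\<lambda>x::'a. conf (norm x) ^ ?N) \<in> borel_measurable ball_measure"
    "(\<lambda>x::'a. w (rad (norm x))) \<in> borel_measurable ball_measure"
    by (intro radial_measurable[of "\<lambda>t. conf t"] radial_measurable[of "\<lambda>t. conf t ^ ?N"]
        radial_measurable[of "\<lambda>t. w (rad t)"]; measurable)+
  have I0: "integrable ball_measure (\<lambda>x. conf (norm x) ^ ?N * ((rad (norm x))\<^sup>2 * (u x)\<^sup>2))"
    "integrable ball_measure (grad_sq G)"
    using hp by (simp_all add: hyp_pair_def grad_sq_def[abs_def])
  let ?p = "\<lambda>x. conf (norm x) ^ ?N * (u x * radial_part G x * w (rad (norm x)))"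
  let ?q = "\<lambda>x. conf (norm x) ^ ?N * ((w (rad (norm x)))\<^sup>2 * (u x)\<^sup>2)"
  have pm: "?p \<in> borel_measurable ball_measure" "?q \<in> borel_measurable ball_measure"
    by (intro borel_measurable_times borel_measurable_power um gm rm)+
  have w2: "(w (rad (norm x)))\<^sup>2 \<le> C\<^sup>2 * (rad (norm x))\<^sup>2" if "x \<noteq> 0" "norm x < 1" for x :: 'a
    using power_mono[OF w[of "rad (norm x)"], of 2] that rad_pos[of "norm x"]
    by (simp add: power_mult_distrib)
  have cN: "0 \<le> conf (norm x) ^ ?N" if "norm x < 1" for x :: 'a
    using conf_pos[of "norm x"] that by simp
  show q: "integrable ball_measure ?q"
  proof (rule integrable_ball_measure_bound[OF integrable_mult_right[of "C\<^sup>2", OF I0(1)] pm(2)])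
    fix x :: 'a assume x: "x \<noteq> 0" "norm x < 1"
    have "?q x \<le> conf (norm x) ^ ?N * ((C\<^sup>2 * (rad (norm x))\<^sup>2) * (u x)\<^sup>2)"
      by (intro mult_left_mono mult_right_mono w2 x cN) simp
    then show "\<bar>?q x\<bar> \<le> C\<^sup>2 * (conf (norm x) ^ ?N * ((rad (norm x))\<^sup>2 * (u x)\<^sup>2))"
      using cN[OF x(2)] by (simp add: abs_mult mult_ac)
  qed
  show p: "integrable ball_measure ?p"
  proof (rule integrable_ball_measure_bound[OF Bochner_Integration.integrable_add[OF q I0(2)] pm(1)])
    fix x :: 'a assume x: "x \<noteq> 0" "norm x < 1"
    define g where "g = norm (G x) / conf (norm x)"
    define v where "v = \<bar>w (rad (norm x))\<bar> * \<bar>u x\<bar>"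
    have "\<bar>u x * radial_part G x * w (rad (norm x))\<bar> \<le> v * g"
      using mult_left_mono[OF radial_part_le[OF x(2), of G], of v]
      by (simp add: v_def g_def abs_mult mult_ac)
    also have "v * g \<le> v\<^sup>2 + g\<^sup>2"
    proof -
      have "0 \<le> (v - g)\<^sup>2" "0 \<le> v * g"
        using conf_pos[of "norm x"] x by (simp_all add: v_def g_def)
      then show ?thesis unfolding power2_diff by linarith
    qed
    finally have "conf (norm x) ^ ?N * \<bar>u x * radial_part G x * w (rad (norm x))\<bar> \<le> conf (norm x) ^ ?N * (v\<^sup>2 + g\<^sup>2)"
      by (rule mult_left_mono[OF _ cN[OF x(2)]])
    then show "\<bar>?p x\<bar> \<le> ?q x + grad_sq G x"
      using cN[OF x(2)] by (simp add: abs_mult v_def g_def grad_sq_def power_mult_distrib distrib_left)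
  qed
  have eq: "AE x in ball_measure. grad_sq (twist w u G) x = grad_sq G x + 2 * ?p x + ?q x"
    using AE_ball_measure_nonzero by eventually_elim (simp add: grad_sq_twist)
  have tm: "grad_sq (twist w u G) \<in> borel_measurable ball_measure"
  proof -
    have "(\<lambda>x. twist w u G x \<bullet> b) \<in> borel_measurable ball_measure" if b: "b \<in> Basis" for b
    proof -
      have "(\<lambda>x::'a. norm x) \<in> borel_measurable ball_measure" "(\<lambda>x::'a. x \<bullet> b) \<in> borel_measurable ball_measure"
        by (intro ball_measure_borel_measurable; simp)+
      then show ?thesis
        using C1_approximable_sq_int(2)[OF app b]
        unfolding twist_def inner_add_left inner_scaleR_left
        by (intro borel_measurable_add borel_measurable_times borel_measurable_divide um rm) (auto simp: sq_int_def)
    qed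
    from norm_measurable_ball[OF this] show ?thesis
      unfolding grad_sq_def[abs_def] by (intro borel_measurable_times borel_measurable_power borel_measurable_divide rm)
  qed
  have int: "integrable ball_measure (\<lambda>x. grad_sq G x + 2 * ?p x + ?q x)"
    using p q I0(2) by simp
  have sm: "(\<lambda>x. grad_sq G x + 2 * ?p x + ?q x) \<in> borel_measurable ball_measure"
    using int by (rule borel_measurable_integrable)
  show "integrable ball_measure (grad_sq (twist w u G))"
    using integrable_cong_AE[OF tm sm eq] int by blast
  have "(\<integral>x. grad_sq (twist w u G) x \<partial>ball_measure) = (\<integral>x. grad_sq G x + 2 * ?p x + ?q x \<partial>ball_measure)"
    by (rule integral_cong_AE[OF tm sm eq])
  also have "\<dots> = (\<integral>x. grad_sq G x \<partial>ball_measure) + 2 * (\<integral>x. ?p x \<partial>ball_measure) + (\<integral>x. ?q x \<partial>ball_measure)"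
    using p q I0(2) by simp
  finally show "(\<integral>x. grad_sq (twist w u G) x \<partial>ball_measure) = (\<integral>x. grad_sq G x \<partial>ball_measure)
      + 2 * (\<integral>x. ?p x \<partial>ball_measure) + (\<integral>x. ?q x \<partial>ball_measure)" .
qed

text \<open>The weight is the Laplacian of \<open>r\<^sup>2/2\<close>; dividing out
  \<open>sinh\<close> in the definition of \<open>deficit\<close> gives the same weight.\<close>

lemma hyp_ibp_identity:
  fixes u :: "'a::euclidean_space \<Rightarrow> real"
  assumes dim: "2 \<le> DIM('a)" and hp: "hyp_pair u G"
  shows "integrable ball_measure (\<lambda>x. conf (norm x) ^ DIM('a) * ((u x)\<^sup>2 *
      (1 + (real DIM('a) - 1) * (rad (norm x) * (cosh (rad (norm x)) / sinh (rad (norm x)))))))"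
    and "(\<integral>x. conf (norm x) ^ DIM('a) * ((u x)\<^sup>2 *
      (1 + (real DIM('a) - 1) * (rad (norm x) * (cosh (rad (norm x)) / sinh (rad (norm x)))))) \<partial>ball_measure)
    = - 2 * (\<integral>x. conf (norm x) ^ DIM('a) * (u x * radial_part G x * rad (norm x)) \<partial>ball_measure)"
  by (rule hyp_ibp[OF dim hp, where M = "\<lambda>r. r" and M' = "\<lambda>r. 1" and C = 1];
      auto intro!: derivative_eq_intros)+

text \<open>With \<open>a\<close> and \<open>b\<close> the square roots of energy and second moment,
  \<open>(lambda_u u)\<^sup>2\<close> is \<open>b / a\<close>, and both right-hand sides become
  \<open>a * b\<close>.\<close>

lemma lambda_u_props:
  assumes "0 < energy u" "0 < second_moment u"
  shows "0 < lambda_u u"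
    and "sqrt (energy u) * sqrt (second_moment u) = (lambda_u u)\<^sup>2 * energy u"
    and "sqrt (energy u) * sqrt (second_moment u) = second_moment u / (lambda_u u)\<^sup>2"
proof -
  define a b where "a = sqrt (energy u)" and "b = sqrt (second_moment u)"
  have ab: "0 < a" "0 < b" "energy u = a * a" "second_moment u = b * b"
    using assms by (auto simp: a_def b_def)
  define l where "l = lambda_u u"
  show "0 < lambda_u u" using assms by (simp add: lambda_u_def)
  have "(l\<^sup>2)\<^sup>2 = (b / a)\<^sup>2"
  proof -
    have "l ^ 4 = (b * b) / (a * a)"
      using ab unfolding l_def lambda_u_def by simp
    then show ?thesis by (simp add: power2_eq_square eval_nat_numeral field_simps)
  qed
  then have "l\<^sup>2 = b / a"
    using ab power2_eq_imp_eq[of "l\<^sup>2" "b / a"] by simp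
  then show "sqrt (energy u) * sqrt (second_moment u) = (lambda_u u)\<^sup>2 * energy u"
    "sqrt (energy u) * sqrt (second_moment u) = second_moment u / (lambda_u u)\<^sup>2"
    using ab unfolding l_def[symmetric] a_def[symmetric] b_def[symmetric] by simp_all
qed

lemma deficit_eq:
  fixes u :: "'a::euclidean_space \<Rightarrow> real"
  assumes dim: "2 \<le> DIM('a)" and u: "u \<in> heis_dom" and pos: "0 < energy u" "0 < second_moment u"
  shows "deficit u = (lambda_u u)\<^sup>2 / 2 * energy u + second_moment u / (2 * (lambda_u u)\<^sup>2)
      + (\<integral>x. conf (norm x) ^ DIM('a) * (u x * radial_part (weak_grad u) x * rad (norm x)) \<partial>ball_measure)"
proof -
  note hp = heis_dom_hyp_pair(1)[OF dim u]
  have app: "C1_approximable u (weak_grad u)" using hp by (simp add: hyp_pair_def)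
  have um: "u \<in> borel_measurable ball_measure"
    using C1_approximable_sq_int(1)[OF app] by (simp add: sq_int_def)
  let ?g = "\<lambda>t. real DIM('a) + (real DIM('a) - 1) * ((rad t * cosh (rad t) - sinh (rad t)) / sinh (rad t))"
  have gm: "(\<lambda>x::'a. ?g (norm x)) \<in> borel_measurable ball_measure"
    by (rule radial_measurable) measurable
  have fm: "(\<lambda>x. ?g (norm x) * (u x)\<^sup>2) \<in> borel_measurable ball_measure"
    by (intro borel_measurable_times borel_measurable_power gm um)
  have cm: "(\<lambda>x::'a. conf (norm x) ^ DIM('a)) \<in> borel_measurable ball_measure"
    by (rule radial_measurable) measurable
  have "(\<integral>x. (let \<rho> = hyp_rho x; N = real DIM('a) in
         (N + (N - 1) * ((\<rho> * cosh \<rho> - sinh \<rho>) / sinh \<rho>)) * (u x)\<^sup>2) \<partial>hyp_vol)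
    = (\<integral>x. conf (norm x) ^ DIM('a) * (?g (norm x) * (u x)\<^sup>2) \<partial>ball_measure)"
    unfolding Let_def hyp_rho_eq by (rule hyp_vol_integral(2)[OF fm])
  also have "\<dots> = (\<integral>x. conf (norm x) ^ DIM('a) * ((u x)\<^sup>2 *
      (1 + (real DIM('a) - 1) * (rad (norm x) * (cosh (rad (norm x)) / sinh (rad (norm x)))))) \<partial>ball_measure)"
  proof (rule integral_cong_AE)
    show "(\<lambda>x. conf (norm x) ^ DIM('a) * (?g (norm x) * (u x)\<^sup>2)) \<in> borel_measurable ball_measure"
      by (intro borel_measurable_times cm fm)
    show "(\<lambda>x. conf (norm x) ^ DIM('a) * ((u x)\<^sup>2 *
      (1 + (real DIM('a) - 1) * (rad (norm x) * (cosh (rad (norm x)) / sinh (rad (norm x)))))))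
      \<in> borel_measurable ball_measure"
      by (rule borel_measurable_integrable[OF hyp_ibp_identity(1)[OF dim hp]])
    show "AE x in ball_measure. conf (norm x) ^ DIM('a) * (?g (norm x) * (u x)\<^sup>2) = conf (norm x) ^ DIM('a) * ((u x)\<^sup>2 *
      (1 + (real DIM('a) - 1) * (rad (norm x) * (cosh (rad (norm x)) / sinh (rad (norm x))))))"
      using AE_ball_measure_nonzero
    proof eventually_elim
      fix x :: 'a assume "x \<noteq> 0 \<and> norm x < 1"
      then have "0 < sinh (rad (norm x))" by (simp add: rad_pos)
      then show "conf (norm x) ^ DIM('a) * (?g (norm x) * (u x)\<^sup>2) = conf (norm x) ^ DIM('a) * ((u x)\<^sup>2 *
      (1 + (real DIM('a) - 1) * (rad (norm x) * (cosh (rad (norm x)) / sinh (rad (norm x))))))"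
        by (simp add: diff_divide_distrib algebra_simps)
    qed
  qed
  also note hyp_ibp_identity(2)[OF dim hp]
  finally have "deficit u = sqrt (energy u) * sqrt (second_moment u)
    + (\<integral>x. conf (norm x) ^ DIM('a) * (u x * radial_part (weak_grad u) x * rad (norm x)) \<partial>ball_measure)"
    unfolding deficit_def by simp
  moreover have "sqrt (energy u) * sqrt (second_moment u)
      = (lambda_u u)\<^sup>2 / 2 * energy u + second_moment u / (2 * (lambda_u u)\<^sup>2)"
    using lambda_u_props(2,3)[OF pos] by (simp add: field_simps)
  ultimately show ?thesis by simp
qed

text \<open>The bracket in the last integral of \<open>mod_deficit\<close> is
  \<open>r - dpsi N r\<close>; the powers are written as they occur there, and
  \<open>powr_ratio_eqs\<close> brings them to a workable form.\<close>

definition dpsi :: "nat \<Rightarrow> real \<Rightarrow> real" where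
  "dpsi N r = (real N + 3) / 4 * (r powr ((real N + 1) / 2) / sinh r powr ((real N - 1) / 2))
     - (real N - 1) / 4 * (r powr ((real N + 3) / 2) / sinh r powr ((real N + 1) / 2)) * cosh r"

lemma twist_deficit:
  fixes u :: "'a::euclidean_space \<Rightarrow> real"
  assumes dim: "2 \<le> DIM('a)" and u: "u \<in> heis_dom" and pos: "0 < energy u" "0 < second_moment u"
  shows "deficit u = (lambda_u u)\<^sup>2 / 2 *
    (\<integral>x. grad_sq (twist (\<lambda>r. r / (lambda_u u)\<^sup>2) u (weak_grad u)) x \<partial>ball_measure)"
proof -
  define l where "l = (lambda_u u)\<^sup>2"
  have l: "0 < l" using lambda_u_props(1)[OF pos] by (simp add: l_def)
  note hp = heis_dom_hyp_pair[OF dim u]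
  have "(\<integral>x. grad_sq (twist (\<lambda>r. r / l) u (weak_grad u)) x \<partial>ball_measure) = energy u
      + 2 * (\<integral>x. conf (norm x) ^ DIM('a) * (u x * radial_part (weak_grad u) x * (rad (norm x) / l)) \<partial>ball_measure)
      + (\<integral>x. conf (norm x) ^ DIM('a) * ((rad (norm x) / l)\<^sup>2 * (u x)\<^sup>2) \<partial>ball_measure)"
    unfolding hp(2) using l by (intro twist_energy(4)[OF hp(1), where C = "1 / l"]) auto
  also have "(\<integral>x. conf (norm x) ^ DIM('a) * (u x * radial_part (weak_grad u) x * (rad (norm x) / l)) \<partial>ball_measure)
     = 1 / l * (\<integral>x. conf (norm x) ^ DIM('a) * (u x * radial_part (weak_grad u) x * rad (norm x)) \<partial>ball_measure)"
    by (subst integral_mult_right_zero[symmetric]) (simp add: field_simps)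
  also have "(\<integral>x. conf (norm x) ^ DIM('a) * ((rad (norm x) / l)\<^sup>2 * (u x)\<^sup>2) \<partial>ball_measure) = 1 / l\<^sup>2 * second_moment u"
    unfolding hp(3) by (subst integral_mult_right_zero[symmetric]) (simp add: power_divide field_simps)
  finally show ?thesis
    unfolding deficit_eq[OF assms] l_def[symmetric] using l by (simp add: field_simps power2_eq_square)
qed

section \<open>The modified weight and a Hardy inequality\<close>

text \<open>A single term of the power series, whose terms are all nonnegative for nonnegative
  \<open>r\<close>.\<close>

lemma sinh_ge_power:
  assumes "0 \<le> r" "odd n"
  shows "r ^ n / fact n \<le> sinh (r::real)"
proof -
  define f where "f k = (if even k then 0 else r ^ k / fact k)" for k
  have f: "f sums sinh r"
    using sinh_converges[of r] by (simp add: f_def[abs_def] scaleR_conv_of_real field_simps cong: if_cong)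
  have "sum f {n} \<le> suminf f"
    using f assms by (intro sum_le_suminf) (auto simp: f_def sums_iff)
  then show ?thesis using f assms by (simp add: f_def sums_iff)
qed

lemma sinh_ge_self: "0 \<le> r \<Longrightarrow> r \<le> sinh (r::real)"
  using sinh_ge_power[of r 1] by simp

lemma sinh_ge_cube: "0 \<le> r \<Longrightarrow> r ^ 3 / 6 \<le> sinh (r::real)"
  using sinh_ge_power[of r 3] by (simp add: fact_numeral)

lemma sinh_ge_fifth: "0 \<le> r \<Longrightarrow> r ^ 5 / 120 \<le> sinh (r::real)"
  using sinh_ge_power[of r 5] by (simp add: fact_numeral)

text \<open>The exponent of \<^const>\<open>mod_gauss\<close> is \<open>- psi N r / \<lambda>\<^sup>2\<close>, and \<^const>\<open>dpsi\<close> is the derivative of \<open>psi N\<close>.\<close>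

definition psi :: "nat \<Rightarrow> real \<Rightarrow> real" where
  "psi N r = 1 / 2 * (r powr ((real N + 3) / 2) / sinh r powr ((real N - 1) / 2))"

text \<open>Collects the fractional powers: \<open>psi\<close> and \<open>dpsi\<close> are this
  factor times integer powers of \<open>r\<close>, \<open>sinh r\<close> and
  \<open>cosh r\<close>.\<close>

definition ratio_pow :: "nat \<Rightarrow> real \<Rightarrow> real" where
  "ratio_pow N r = (r / sinh r) powr ((real N - 1) / 2)"

lemma ratio_pow_props:
  assumes r: "0 < r" and N: "2 \<le> N"
  shows "0 \<le> ratio_pow N r" "ratio_pow N r \<le> 1" "ratio_pow N r \<le> sqrt (r / sinh r)"
proof -
  have s: "0 < sinh r" "r \<le> sinh r" using r sinh_ge_self[of r] by auto
  have x: "0 \<le> r / sinh r" "r / sinh r \<le> 1" using r s by auto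
  show "0 \<le> ratio_pow N r" by (simp add: ratio_pow_def)
  show "ratio_pow N r \<le> 1" using x N by (auto simp: ratio_pow_def intro!: powr_le1)
  \<comment> \<open>For \<open>N\<close> at least 2 the exponent is at least 1/2, and the base is at
    most 1. This makes the bounds derived from it independent of \<open>N\<close>.\<close>
  have "ratio_pow N r \<le> (r / sinh r) powr (1 / 2)"
    unfolding ratio_pow_def using x N by (intro powr_mono') auto
  then show "ratio_pow N r \<le> sqrt (r / sinh r)" using x by (simp add: powr_half_sqrt)
qed

lemma powr_ratio_eqs:
  assumes r: "0 < r"
  shows "r powr ((real N + 1) / 2) / sinh r powr ((real N - 1) / 2) = r * ratio_pow N r"
    "r powr ((real N + 3) / 2) / sinh r powr ((real N - 1) / 2) = r\<^sup>2 * ratio_pow N r"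
    "r powr ((real N + 3) / 2) / sinh r powr ((real N + 1) / 2) = r\<^sup>2 * ratio_pow N r / sinh r"
proof -
  have s: "0 < sinh r" using r by simp
  define a where "a = r powr ((real N - 1) / 2)"
  define b where "b = sinh r powr ((real N - 1) / 2)"
  have "r powr ((real N + 1) / 2) = r powr (1 + (real N - 1) / 2)" by (simp add: field_simps)
  then have a1: "r powr ((real N + 1) / 2) = r * a" using r by (simp add: powr_add a_def)
  have "r powr ((real N + 3) / 2) = r powr (2 + (real N - 1) / 2)" by (simp add: field_simps)
  then have a3: "r powr ((real N + 3) / 2) = r\<^sup>2 * a" using r by (simp add: powr_add a_def powr_numeral)
  have "sinh r powr ((real N + 1) / 2) = sinh r powr (1 + (real N - 1) / 2)" by (simp add: field_simps)
  then have b1: "sinh r powr ((real N + 1) / 2) = sinh r * b" using s by (simp add: powr_add b_def)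
  have q: "ratio_pow N r = a / b" using r s by (simp add: ratio_pow_def a_def b_def powr_divide)
  show "r powr ((real N + 1) / 2) / sinh r powr ((real N - 1) / 2) = r * ratio_pow N r"
    "r powr ((real N + 3) / 2) / sinh r powr ((real N - 1) / 2) = r\<^sup>2 * ratio_pow N r"
    "r powr ((real N + 3) / 2) / sinh r powr ((real N + 1) / 2) = r\<^sup>2 * ratio_pow N r / sinh r"
    by (simp_all add: a1 a3 b1 q b_def[symmetric])
qed

lemma psi_bounds:
  assumes r: "0 < r" and N: "2 \<le> N"
  shows "0 \<le> psi N r" "psi N r \<le> 6"
proof -
  have s: "0 < sinh r" using r by simp
  note p = ratio_pow_props[OF assms]
  have e: "psi N r = 1 / 2 * (r\<^sup>2 * ratio_pow N r)"
    by (simp only: psi_def powr_ratio_eqs[OF r])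
  show "0 \<le> psi N r" using p(1) unfolding e by simp
  have "r\<^sup>2 * ratio_pow N r \<le> r\<^sup>2 * sqrt (r / sinh r)" by (intro mult_left_mono p) simp
  also have "\<dots> = sqrt (r ^ 5 / sinh r)"
    using r s by (simp add: real_sqrt_divide real_sqrt_mult eval_nat_numeral)
  \<comment> \<open>The fifth-order term of sinh gives \<open>r ^ 5 \<le> 120 * sinh r\<close>; 144
    is the next square, and half of its root 12 is the bound 6.\<close>
  also have "\<dots> \<le> sqrt 144"
  proof (rule real_sqrt_le_mono)
    have "r ^ 5 \<le> 144 * sinh r" using sinh_ge_fifth[of r] r s by linarith
    then show "r ^ 5 / sinh r \<le> 144" using s by (simp add: pos_divide_le_eq)
  qed
  finally show "psi N r \<le> 6" unfolding e by simp
qed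

text \<open>In the second term of \<open>dpsi\<close> the factor \<open>r coth r\<close> may grow
  linearly, but the decay of \<open>ratio_pow\<close> absorbs it:
  \<open>1 + sqrt (r ^ 3 / sinh r)\<close> is at most 4 by the cubic term of sinh, with 9 in place
  of 6 for an exact root. Linear growth of \<open>dpsi\<close> is what \<open>twist_energy\<close>
  asks for.\<close>

lemma dpsi_bound:
  assumes r: "0 < r" and N: "2 \<le> N"
  shows "\<bar>dpsi N r\<bar> \<le> 2 * real N * r"
proof -
  have s: "0 < sinh r" using r by simp
  note p = ratio_pow_props[OF assms]
  have e: "dpsi N r = (real N + 3) / 4 * (r * ratio_pow N r)
      - (real N - 1) / 4 * (r * (ratio_pow N r * (r * (cosh r / sinh r))))"
    unfolding dpsi_def powr_ratio_eqs[OF r] using s by (simp add: field_simps power2_eq_square)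
  have 1: "0 \<le> r * ratio_pow N r" "r * ratio_pow N r \<le> r"
    using p r mult_left_mono[OF p(2), of r] by auto
  have c: "0 \<le> r * (cosh r / sinh r)" using r s by simp
  have "ratio_pow N r * (r * (cosh r / sinh r)) \<le> ratio_pow N r * (1 + r)"
    by (intro mult_left_mono p r_coth_le r)
  also have "\<dots> \<le> 1 + sqrt (r / sinh r) * r"
    using add_mono[OF p(2) mult_right_mono[OF p(3), of r]] r by (simp add: distrib_left)
  also have "sqrt (r / sinh r) * r = sqrt (r ^ 3 / sinh r)"
    using r s by (simp add: real_sqrt_divide real_sqrt_mult eval_nat_numeral)
  also have "\<dots> \<le> sqrt 9"
  proof (rule real_sqrt_le_mono)
    have "r ^ 3 \<le> 9 * sinh r" using sinh_ge_cube[of r] r s by linarith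
    then show "r ^ 3 / sinh r \<le> 9" using s by (simp add: pos_divide_le_eq)
  qed
  finally have "ratio_pow N r * (r * (cosh r / sinh r)) \<le> 4" by simp
  then have 2: "r * (ratio_pow N r * (r * (cosh r / sinh r))) \<le> r * 4"
    using r by (intro mult_left_mono) auto
  have 3: "0 \<le> r * (ratio_pow N r * (r * (cosh r / sinh r)))"
    using p(1) c r by simp
  have "\<bar>dpsi N r\<bar> \<le> (real N + 3) / 4 * r + (real N - 1) / 4 * (r * 4)"
  proof -
    have AB: "0 \<le> (real N + 3) / 4" "0 \<le> (real N - 1) / 4" using N by auto
    show ?thesis
      using mult_nonneg_nonneg[OF AB(1) 1(1)] mult_left_mono[OF 1(2) AB(1)]
        mult_nonneg_nonneg[OF AB(2) 3] mult_left_mono[OF 2 AB(2)]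
      unfolding e by linarith
  qed
  also have "\<dots> = (5 * real N - 1) / 4 * r" by (simp add: field_simps)
  also have "\<dots> \<le> 2 * real N * r" using r by (intro mult_right_mono) auto
  finally show ?thesis .
qed

lemma psi_has_derivative:
  assumes r: "0 < r"
  shows "(psi N has_real_derivative dpsi N r) (at r)"
proof -
  have s: "0 < sinh r" using r by simp
  define a b where "a = (real N + 3) / 2" and "b = (real N - 1) / 2"
  have "((\<lambda>r. 1 / 2 * (r powr a * sinh r powr (- b))) has_real_derivative
      1 / 2 * (a * r powr (a - 1) * sinh r powr (- b) + (- b) * sinh r powr (- b - 1) * cosh r * r powr a)) (at r)"
  proof -
    have 1: "((\<lambda>r. r powr a) has_real_derivative a * r powr (a - 1)) (at r)"
      using r by (rule has_real_derivative_powr)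
    have "((\<lambda>x. x powr (- b)) has_real_derivative (- b) * sinh r powr (- b - 1)) (at (sinh r))"
      using s by (rule has_real_derivative_powr)
    moreover have "(sinh has_real_derivative cosh r) (at r)"
      by (auto intro!: derivative_eq_intros)
    ultimately
    have 2: "((\<lambda>r. sinh r powr (- b)) has_real_derivative (- b) * sinh r powr (- b - 1) * cosh r) (at r)"
      by (rule DERIV_chain2)
    show ?thesis by (rule DERIV_cmult[OF DERIV_mult[OF 1 2]])
  qed
  moreover have "1 / 2 * (r powr a * sinh r powr (- b)) = psi N r" for r
    by (simp only: psi_def powr_minus divide_inverse a_def b_def)
  moreover have "1 / 2 * (a * r powr (a - 1) * sinh r powr (- b) + (- b) * sinh r powr (- b - 1) * cosh r * r powr a) = dpsi N r"
  proof -
    have "a - 1 = (real N + 1) / 2" "- b - 1 = - ((real N + 1) / 2)" by (simp_all add: a_def b_def field_simps)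
    moreover have "1 / 2 * ((n + 3) / 2 * p * inverse y + (- ((n - 1) / 2)) * inverse z * c * q)
        = (n + 3) / 4 * (p * inverse y) - (n - 1) / 4 * (q * inverse z) * c" for n p y z c q :: real
      by (simp add: algebra_simps add_divide_distrib diff_divide_distrib)
    ultimately show ?thesis
      by (simp only: powr_minus dpsi_def a_def b_def divide_inverse[of "r powr _" "sinh r powr _"])
  qed
  ultimately show ?thesis by simp
qed

lemma measurable_psi[measurable]: "psi N \<in> borel_measurable borel" "dpsi N \<in> borel_measurable borel"
  unfolding psi_def[abs_def] dpsi_def[abs_def] by measurable

lemma dpsi_continuous: "continuous_on {0<..} (dpsi N)"
  unfolding dpsi_def[abs_def] by (intro continuous_intros) auto

text \<open>The bracket in the first correction of \<open>mod_deficit\<close> is a disguised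
  \<open>8 (dpsi\<^sup>2 - r\<^sup>2)\<close>. Squaring doubles the exponent of
  \<open>ratio_pow\<close> to \<open>n - 1\<close>, so only natural powers remain.\<close>

lemma dpsi_square:
  assumes r: "0 < r" and n: "2 \<le> n"
  shows "(real n - 1)\<^sup>2 / 2 * (r ^ (n + 3) / (sinh r) ^ (n + 1)) * (cosh r)\<^sup>2
             + (real n + 3)\<^sup>2 / 2 * (r ^ (n + 1) / (sinh r) ^ (n - 1))
             - (real n - 1) * (real n + 3) * (r ^ (n + 2) / (sinh r) ^ n) * cosh r
             - 8 * r\<^sup>2 = 8 * (dpsi n r)\<^sup>2 - 8 * r\<^sup>2"
proof -
  define s c q where "s = sinh r" and "c = cosh r" and "q = ratio_pow n r"
  have s: "0 < s" using r by (simp add: s_def)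
  obtain m where m: "n = m + 2" using n by (metis add.commute le_Suc_ex)
  have "q * q = (r / s) powr (real n - 1)"
    unfolding q_def ratio_pow_def s_def by (simp add: powr_add[symmetric])
  also have "\<dots> = (r / s) ^ (m + 1)"
    using r s by (subst powr_realpow[symmetric]) (auto simp: m)
  finally have qq: "r ^ (m + 1) = q * q * s ^ (m + 1)" using s by (simp add: power_divide)
  have "r ^ (n + 1) = r\<^sup>2 * r ^ (m + 1)" "r ^ (n + 2) = r ^ 3 * r ^ (m + 1)" "r ^ (n + 3) = r ^ 4 * r ^ (m + 1)"
    "s ^ (n - 1) = s ^ (m + 1)" "s ^ n = s * s ^ (m + 1)" "s ^ (n + 1) = s\<^sup>2 * s ^ (m + 1)"
    by (simp_all add: m eval_nat_numeral)
  then have e: "r ^ (n + 1) / s ^ (n - 1) = r\<^sup>2 * (q * q)" "r ^ (n + 2) / s ^ n = r ^ 3 * (q * q) / s"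
    "r ^ (n + 3) / s ^ (n + 1) = r ^ 4 * (q * q) / s\<^sup>2"
    using s unfolding qq by simp_all
  have d: "dpsi n r = (real n + 3) / 4 * (r * q) - (real n - 1) / 4 * (r\<^sup>2 * q / s) * c"
    unfolding dpsi_def powr_ratio_eqs[OF r] by (simp add: s_def c_def q_def)
  have "8 * (A / 4 * (r * q) - B / 4 * (r\<^sup>2 * q / s) * c)\<^sup>2
      = B\<^sup>2 / 2 * (r ^ 4 * (q * q) / s\<^sup>2) * c\<^sup>2 + A\<^sup>2 / 2 * (r\<^sup>2 * (q * q)) - B * A * (r ^ 3 * (q * q) / s) * c" for A B
    using s by (simp add: field_simps power2_eq_square eval_nat_numeral)
  then show ?thesis
    unfolding s_def[symmetric] c_def[symmetric] e d by simp
qed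

text \<open>Both corrections trade \<open>r\<close> for \<open>dpsi\<close>: the first replaces the
  second moment over \<open>2 \<lambda>\<^sup>2\<close> by the integral of
  \<open>dpsi\<^sup>2 u\<^sup>2\<close> over \<open>2 \<lambda>\<^sup>2\<close>, the second replaces
  the cross term. The result is again a complete square.\<close>

lemma twist_mod_deficit:
  fixes u :: "'a::euclidean_space \<Rightarrow> real"
  assumes dim: "2 \<le> DIM('a)" and u: "u \<in> heis_dom" and pos: "0 < energy u" "0 < second_moment u"
  shows "mod_deficit u = (lambda_u u)\<^sup>2 / 2 *
    (\<integral>x. grad_sq (twist (\<lambda>r. dpsi DIM('a) r / (lambda_u u)\<^sup>2) u (weak_grad u)) x \<partial>ball_measure)"
proof -
  define l where "l = (lambda_u u)\<^sup>2"
  have l: "0 < l" using lambda_u_props(1)[OF pos] by (simp add: l_def)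
  let ?N = "DIM('a)"
  let ?G = "weak_grad u"
  note hp = heis_dom_hyp_pair[OF dim u]
  have app: "C1_approximable u ?G" using hp(1) by (simp add: hyp_pair_def)
  have um: "u \<in> borel_measurable ball_measure"
    using C1_approximable_sq_int(1)[OF app] by (simp add: sq_int_def)
  have gm: "radial_part ?G \<in> borel_measurable ball_measure" by (rule radial_part_measurable[OF app])
  define P where "P w = (\<integral>x. conf (norm x) ^ ?N * (u x * radial_part ?G x * w (rad (norm x))) \<partial>ball_measure)" for w
  define S where "S w = (\<integral>x. conf (norm x) ^ ?N * ((w (rad (norm x)))\<^sup>2 * (u x)\<^sup>2) \<partial>ball_measure)" for w
  have db: "\<bar>dpsi ?N r\<bar> \<le> 2 * real ?N * r" if "0 < r" for r
    by (rule dpsi_bound[OF that dim])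
  note te_psi = twist_energy[OF hp(1) measurable_psi(2) db]
  note te_id = twist_energy[OF hp(1), where w = "\<lambda>r. r" and C = 1, simplified]
  define A where "A r = (real ?N - 1)\<^sup>2 / 2 * (r ^ (?N + 3) / (sinh r) ^ (?N + 1)) * (cosh r)\<^sup>2
             + (real ?N + 3)\<^sup>2 / 2 * (r ^ (?N + 1) / (sinh r) ^ (?N - 1))
             - (real ?N - 1) * (real ?N + 3) * (r ^ (?N + 2) / (sinh r) ^ ?N) * cosh r - 8 * r\<^sup>2" for r
  have Am[measurable]: "A \<in> borel_measurable borel" unfolding A_def[abs_def] by measurable
  have cm: "(\<lambda>x::'a. conf (norm x) ^ ?N) \<in> borel_measurable ball_measure"
    by (rule radial_measurable) measurable
  have f1: "(\<lambda>x. (u x)\<^sup>2 * A (rad (norm x))) \<in> borel_measurable ball_measure"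
    by (intro borel_measurable_times borel_measurable_power um radial_measurable[of "\<lambda>t. A (rad t)"]) measurable
  have T1: "(\<integral>x. (u x)\<^sup>2 * A (hyp_rho x) \<partial>hyp_vol) = 8 * S (dpsi ?N) - 8 * second_moment u"
  proof -
    have "(\<integral>x. (u x)\<^sup>2 * A (hyp_rho x) \<partial>hyp_vol) = (\<integral>x. conf (norm x) ^ ?N * ((u x)\<^sup>2 * A (rad (norm x))) \<partial>ball_measure)"
      unfolding hyp_rho_eq by (rule hyp_vol_integral(2)[OF f1])
    also have "\<dots> = (\<integral>x. 8 * (conf (norm x) ^ ?N * ((dpsi ?N (rad (norm x)))\<^sup>2 * (u x)\<^sup>2))
        - 8 * (conf (norm x) ^ ?N * ((rad (norm x))\<^sup>2 * (u x)\<^sup>2)) \<partial>ball_measure)"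
    proof (rule integral_cong_AE)
      show "(\<lambda>x. conf (norm x) ^ ?N * ((u x)\<^sup>2 * A (rad (norm x)))) \<in> borel_measurable ball_measure"
        by (intro borel_measurable_times cm f1)
      show "(\<lambda>x. 8 * (conf (norm x) ^ ?N * ((dpsi ?N (rad (norm x)))\<^sup>2 * (u x)\<^sup>2))
        - 8 * (conf (norm x) ^ ?N * ((rad (norm x))\<^sup>2 * (u x)\<^sup>2))) \<in> borel_measurable ball_measure"
        using te_psi(2) te_id(2) by (intro borel_measurable_integrable) simp
      show "AE x in ball_measure. conf (norm x) ^ ?N * ((u x)\<^sup>2 * A (rad (norm x)))
        = 8 * (conf (norm x) ^ ?N * ((dpsi ?N (rad (norm x)))\<^sup>2 * (u x)\<^sup>2))
        - 8 * (conf (norm x) ^ ?N * ((rad (norm x))\<^sup>2 * (u x)\<^sup>2))"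
        using AE_ball_measure_nonzero
      proof eventually_elim
        fix x :: 'a assume "x \<noteq> 0 \<and> norm x < 1"
        then have A: "A (rad (norm x)) = 8 * (dpsi ?N (rad (norm x)))\<^sup>2 - 8 * (rad (norm x))\<^sup>2"
          unfolding A_def by (intro dpsi_square dim rad_pos) auto
        show "conf (norm x) ^ ?N * ((u x)\<^sup>2 * A (rad (norm x)))
        = 8 * (conf (norm x) ^ ?N * ((dpsi ?N (rad (norm x)))\<^sup>2 * (u x)\<^sup>2))
        - 8 * (conf (norm x) ^ ?N * ((rad (norm x))\<^sup>2 * (u x)\<^sup>2))"
          unfolding A by (simp add: algebra_simps)
      qed
    qed
    also have "\<dots> = 8 * S (dpsi ?N) - 8 * second_moment u"
      unfolding S_def hp(3) using te_psi(2) te_id(2) by simp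
    finally show ?thesis .
  qed
  have T2: "(\<integral>x. u x * hyp_inner x (hyp_grad u x) (hyp_grad_rho x) * (hyp_rho x - dpsi ?N (hyp_rho x)) \<partial>hyp_vol)
      = P (\<lambda>r. r) - P (dpsi ?N)"
  proof -
    let ?h = "\<lambda>x. hyp_inner x (hyp_grad u x) (hyp_grad_rho x)"
    \<comment> \<open>At the origin \<open>hyp_grad_rho\<close> is built from an unspecified
      derivative of a function that is not differentiable there, so measurability is obtained by
      altering \<open>radial_part\<close> at that single point.\<close>
    have "(\<lambda>x. if x = 0 then ?h 0 else radial_part ?G x) \<in> borel_measurable ball_measure"
    proof (rule measurable_If[OF _ gm])
      have "{x \<in> space ball_measure. x = 0} = {0::'a}" by auto
      then show "{x \<in> space ball_measure. x = (0::'a)} \<in> sets ball_measure"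
        by (simp add: sets_restrict_space_iff)
    qed simp
    then have hm: "?h \<in> borel_measurable ball_measure"
      by (rule measurable_cong[THEN iffD1, rotated]) (simp add: hyp_inner_grad_rho)
    have fm: "(\<lambda>x. u x * ?h x * (rad (norm x) - dpsi ?N (rad (norm x)))) \<in> borel_measurable ball_measure"
      by (intro borel_measurable_times um hm radial_measurable[of "\<lambda>t. rad t - dpsi ?N (rad t)"]) measurable
    have "(\<integral>x. u x * ?h x * (hyp_rho x - dpsi ?N (hyp_rho x)) \<partial>hyp_vol)
      = (\<integral>x. conf (norm x) ^ ?N * (u x * ?h x * (rad (norm x) - dpsi ?N (rad (norm x)))) \<partial>ball_measure)"
      unfolding hyp_rho_eq by (rule hyp_vol_integral(2)[OF fm])
    also have "\<dots> = (\<integral>x. conf (norm x) ^ ?N * (u x * radial_part ?G x * rad (norm x))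
        - conf (norm x) ^ ?N * (u x * radial_part ?G x * dpsi ?N (rad (norm x))) \<partial>ball_measure)"
    proof (rule integral_cong_AE)
      show "(\<lambda>x. conf (norm x) ^ ?N * (u x * ?h x * (rad (norm x) - dpsi ?N (rad (norm x))))) \<in> borel_measurable ball_measure"
        by (intro borel_measurable_times[OF cm] fm)
      show "(\<lambda>x. conf (norm x) ^ ?N * (u x * radial_part ?G x * rad (norm x))
        - conf (norm x) ^ ?N * (u x * radial_part ?G x * dpsi ?N (rad (norm x)))) \<in> borel_measurable ball_measure"
        using te_psi(1) te_id(1) by (intro borel_measurable_integrable) simp
      show "AE x in ball_measure. conf (norm x) ^ ?N * (u x * ?h x * (rad (norm x) - dpsi ?N (rad (norm x))))
        = conf (norm x) ^ ?N * (u x * radial_part ?G x * rad (norm x))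
        - conf (norm x) ^ ?N * (u x * radial_part ?G x * dpsi ?N (rad (norm x)))"
        using AE_ball_measure_nonzero by eventually_elim (simp add: hyp_inner_grad_rho algebra_simps)
    qed
    also have "\<dots> = P (\<lambda>r. r) - P (dpsi ?N)"
      unfolding P_def using te_psi(1) te_id(1) by simp
    finally show ?thesis .
  qed
  have "mod_deficit u = deficit u + 1 / (16 * l) * (8 * S (dpsi ?N) - 8 * second_moment u) - (P (\<lambda>r. r) - P (dpsi ?N))"
  proof -
    have "mod_deficit u = deficit u + 1 / (16 * l) * (\<integral>x. (u x)\<^sup>2 * A (hyp_rho x) \<partial>hyp_vol)
      - (\<integral>x. u x * hyp_inner x (hyp_grad u x) (hyp_grad_rho x) * (hyp_rho x - dpsi ?N (hyp_rho x)) \<partial>hyp_vol)"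
      unfolding mod_deficit_def Let_def l_def A_def dpsi_def by (simp add: algebra_simps)
    then show ?thesis unfolding T1 T2 .
  qed
  also have "deficit u = l / 2 * energy u + second_moment u / (2 * l) + P (\<lambda>r. r)"
    unfolding l_def P_def by (rule deficit_eq[OF assms])
  moreover have "1 / (16 * l) * (8 * a - 8 * b) = a / (2 * l) - b / (2 * l)" for a b
    using l by (simp add: field_simps)
  ultimately have 1: "mod_deficit u = l / 2 * energy u + P (dpsi ?N) + S (dpsi ?N) / (2 * l)"
    by simp
  have "(\<integral>x. grad_sq (twist (\<lambda>r. dpsi ?N r / l) u ?G) x \<partial>ball_measure)
      = energy u + 2 * P (\<lambda>r. dpsi ?N r / l) + S (\<lambda>r. dpsi ?N r / l)"
    unfolding hp(2) P_def S_def
  proof (rule twist_energy(4)[OF hp(1), where C = "2 * real ?N / l"])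
    show "\<bar>dpsi ?N r / l\<bar> \<le> 2 * real ?N / l * r" if "0 < r" for r
      using db[OF that] l by (simp add: abs_divide divide_right_mono)
  qed measurable
  also have "P (\<lambda>r. dpsi ?N r / l) = 1 / l * P (dpsi ?N)"
    unfolding P_def by (subst integral_mult_right_zero[symmetric]) (simp add: field_simps)
  also have "S (\<lambda>r. dpsi ?N r / l) = 1 / l\<^sup>2 * S (dpsi ?N)"
    unfolding S_def by (subst integral_mult_right_zero[symmetric]) (simp add: power_divide field_simps)
  finally show ?thesis
    unfolding 1 l_def[symmetric] using l by (simp add: field_simps power2_eq_square)
qed

text \<open>The exponential in \<open>M\<close> is an integrating factor: its derivative contributes
  \<open>2 \<kappa> dpsi M u\<^sup>2\<close>, which turns the cross term with
  \<open>radial_part G\<close> into \<open>2 M u \<tau>\<close>, where \<tau> is the radial part of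
  the twisted gradient. The factor \<open>r / (1 + r)\<close> makes \<open>M\<close> vanish linearly
  at the origin and stay bounded, while \<open>r / (1 + r) * coth r\<close> remains at least 1/2 and
  keeps the coefficient of \<open>u\<^sup>2\<close> positive.\<close>

lemma hardy:
  fixes u :: "'a::euclidean_space \<Rightarrow> real"
  assumes dim: "2 \<le> DIM('a)" and hp: "hyp_pair u G" and \<kappa>: "0 \<le> \<kappa>"
  shows "(\<integral>x. conf (norm x) ^ DIM('a) * (u x)\<^sup>2 \<partial>ball_measure)
    \<le> 16 * exp (12 * \<kappa>) * (\<integral>x. grad_sq (twist (\<lambda>r. \<kappa> * dpsi DIM('a) r) u G) x \<partial>ball_measure)"
proof -
  let ?N = "DIM('a)"
  \<comment> \<open>The exponent \<open>12 * \<kappa>\<close> is \<open>2 * \<kappa>\<close> times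
    the bound 6 for \<open>psi\<close>.\<close>
  define E where "E = exp (12 * \<kappa>)"
  define e where "e r = exp (2 * \<kappa> * psi ?N r)" for r
  define M where "M r = r / (1 + r) * e r" for r
  define M' where "M' r = e r * (1 / (1 + r)\<^sup>2 + r / (1 + r) * (2 * \<kappa> * dpsi ?N r))" for r
  define C where "C = E * (1 + 4 * \<kappa> * real ?N)"
  have e_bounds: "1 \<le> e r" "e r \<le> E" if "0 < r" for r
  proof -
    have "0 \<le> 2 * \<kappa> * psi ?N r" "2 * \<kappa> * psi ?N r \<le> 2 * \<kappa> * 6"
      using psi_bounds[OF that dim] \<kappa> by (intro mult_nonneg_nonneg mult_left_mono; simp)+
    then show "1 \<le> e r" "e r \<le> E" by (simp_all add: e_def E_def)
  qed
  have E1: "1 \<le> E" using \<kappa> by (simp add: E_def)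
  have dM: "(M has_real_derivative M' r) (at r)" if r: "0 < r" for r
  proof -
    have "((\<lambda>r. r / (1 + r)) has_real_derivative 1 / (1 + r)\<^sup>2) (at r)"
      using r by (auto intro!: derivative_eq_intros simp: power2_eq_square field_simps)
    moreover have "(e has_real_derivative e r * (2 * \<kappa> * dpsi ?N r)) (at r)"
      unfolding e_def[abs_def] by (rule DERIV_fun_exp, rule DERIV_cmult, rule psi_has_derivative[OF r])
    ultimately have "((\<lambda>r. r / (1 + r) * e r) has_real_derivative
        1 / (1 + r)\<^sup>2 * e r + e r * (2 * \<kappa> * dpsi ?N r) * (r / (1 + r))) (at r)"
      by (rule DERIV_mult)
    then show ?thesis unfolding M_def[abs_def] M'_def by (simp add: algebra_simps)
  qed
  have M'_cont: "continuous_on {0<..} M'"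
  proof -
    have "continuous_on {0<..} (psi ?N)"
      by (auto intro!: continuous_at_imp_continuous_on DERIV_isCont[OF psi_has_derivative])
    then show ?thesis
      unfolding M'_def[abs_def] e_def by (intro continuous_intros dpsi_continuous) auto
  qed
  have meas: "M \<in> borel_measurable borel" "M' \<in> borel_measurable borel"
    unfolding M_def[abs_def] M'_def[abs_def] e_def by measurable
  have EC: "E \<le> C" using E1 \<kappa> mult_left_mono[of 1 "1 + 4 * \<kappa> * real ?N" E] by (simp add: C_def)
  have M_le: "\<bar>M r\<bar> \<le> C * r" if r: "0 < r" for r
  proof -
    have "r / (1 + r) \<le> r" using r by (simp add: field_simps)
    then have "r / (1 + r) * e r \<le> r * C"
      using r e_bounds[OF r] EC by (intro mult_mono) auto
    then show ?thesis using r e_bounds[OF r] by (simp add: M_def abs_mult mult.commute)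
  qed
  have M'_le: "\<bar>M' r\<bar> \<le> C * (1 + r\<^sup>2)" if r: "0 < r" for r
  proof -
    have rr: "1 \<le> 1 + r\<^sup>2" "r \<le> 1 + r\<^sup>2"
      using zero_le_power2[of "r - 1"] r unfolding power2_diff by auto
    have a1: "\<bar>1 / (1 + r)\<^sup>2\<bar> \<le> 1 + r\<^sup>2"
    proof -
      have "1 / (1 + r)\<^sup>2 \<le> 1" using r by (simp add: one_le_power)
      from order_trans[OF this rr(1)] show ?thesis by simp
    qed
    have a2: "\<bar>r / (1 + r) * (2 * \<kappa> * dpsi ?N r)\<bar> \<le> 1 * (2 * \<kappa> * (2 * real ?N * (1 + r\<^sup>2)))"
    proof -
      have "\<bar>dpsi ?N r\<bar> \<le> 2 * real ?N * (1 + r\<^sup>2)"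
        using order_trans[OF dpsi_bound[OF r dim] mult_left_mono[OF rr(2)]] by simp
      then have "2 * \<kappa> * \<bar>dpsi ?N r\<bar> \<le> 2 * \<kappa> * (2 * real ?N * (1 + r\<^sup>2))"
        using \<kappa> by (intro mult_left_mono) auto
      moreover have "\<bar>r / (1 + r)\<bar> \<le> 1" using r by simp
      ultimately have "\<bar>r / (1 + r)\<bar> * (2 * \<kappa> * \<bar>dpsi ?N r\<bar>) \<le> 1 * (2 * \<kappa> * (2 * real ?N * (1 + r\<^sup>2)))"
        using \<kappa> by (intro mult_mono[where b = 1]) auto
      moreover have "\<bar>q * (2 * \<kappa> * d)\<bar> = \<bar>q\<bar> * (2 * \<kappa> * \<bar>d\<bar>)" for q d :: real
        using \<kappa> by (simp add: abs_mult)
      ultimately show ?thesis by (simp only:)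
    qed
    have "\<bar>1 / (1 + r)\<^sup>2 + r / (1 + r) * (2 * \<kappa> * dpsi ?N r)\<bar> \<le> (1 + 4 * \<kappa> * real ?N) * (1 + r\<^sup>2)"
    proof -
      have "(1 + 4 * \<kappa> * real ?N) * (1 + r\<^sup>2) = (1 + r\<^sup>2) + 1 * (2 * \<kappa> * (2 * real ?N * (1 + r\<^sup>2)))"
        by (simp add: algebra_simps)
      then show ?thesis
        using order_trans[OF abs_triangle_ineq add_mono[OF a1 a2]] by (simp only:)
    qed
    then have "e r * \<bar>1 / (1 + r)\<^sup>2 + r / (1 + r) * (2 * \<kappa> * dpsi ?N r)\<bar> \<le> E * ((1 + 4 * \<kappa> * real ?N) * (1 + r\<^sup>2))"
      using e_bounds[OF r] E1 by (intro mult_mono) auto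
    then show ?thesis using e_bounds[OF r] by (simp add: M'_def C_def abs_mult mult.assoc)
  qed
  note ibp = hyp_ibp[OF dim hp dM M'_cont meas M_le M'_le]
  let ?T = "twist (\<lambda>r. \<kappa> * dpsi ?N r) u G"
  have Tint: "integrable ball_measure (grad_sq ?T)"
  proof (rule twist_energy(3)[OF hp, where C = "\<kappa> * (2 * real ?N)"])
    show "\<bar>\<kappa> * dpsi ?N r\<bar> \<le> \<kappa> * (2 * real ?N) * r" if "0 < r" for r
      using mult_left_mono[OF dpsi_bound[OF that dim] \<kappa>] \<kappa>
      by (simp add: abs_mult mult.assoc)
  qed measurable
  have uint: "integrable ball_measure (\<lambda>x. conf (norm x) ^ ?N * (u x)\<^sup>2)"
    using hp by (simp add: hyp_pair_def)
  let ?I1 = "\<lambda>x. conf (norm x) ^ ?N * ((u x)\<^sup>2 *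
      (M' (rad (norm x)) + (real ?N - 1) * (M (rad (norm x)) * (cosh (rad (norm x)) / sinh (rad (norm x))))))"
  let ?I2 = "\<lambda>x. conf (norm x) ^ ?N * (u x * radial_part G x * M (rad (norm x)))"
  have "(\<integral>x. 1 / 4 * (conf (norm x) ^ ?N * (u x)\<^sup>2) - 4 * E * grad_sq ?T x \<partial>ball_measure)
      \<le> (\<integral>x. ?I1 x + 2 * ?I2 x \<partial>ball_measure)"
  proof (rule integral_mono_AE)
    show "AE x in ball_measure. 1 / 4 * (conf (norm x) ^ ?N * (u x)\<^sup>2) - 4 * E * grad_sq ?T x \<le> ?I1 x + 2 * ?I2 x"
      using AE_ball_measure_nonzero
    proof eventually_elim
      fix x :: 'a assume "x \<noteq> 0 \<and> norm x < 1"
      then have x: "x \<noteq> 0" "norm x < 1" by auto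
      define r q \<tau> c h where "r = rad (norm x)" and "q = r / (1 + r)" and "\<tau> = radial_part ?T x"
        and "c = conf (norm x) ^ ?N" and "h = cosh r / sinh r"
      have r: "0 < r" using x by (simp add: r_def rad_pos)
      have c: "0 \<le> c" using conf_pos[of "norm x"] x by (simp add: c_def)
      have q: "0 \<le> q" "q \<le> 1" using r by (simp_all add: q_def)
      have h: "1 \<le> r * h" "1 \<le> h" using one_le_r_coth[OF r] one_le_coth[OF r] by (simp_all add: h_def)
      have "r \<le> r * h" using mult_left_mono[OF h(2), of r] r by simp
      with h have "1 + r \<le> 2 * (r * h)" by linarith
      then have "1 / 2 \<le> q * h" using r by (simp add: q_def field_simps)
      moreover have "q * h \<le> (real ?N - 1) * (q * h)"
        using mult_right_mono[of 1 "real ?N - 1" "q * h"] dim q h by simp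
      moreover have "0 \<le> 1 / (1 + r)\<^sup>2" by simp
      ultimately have b: "1 / 2 \<le> 1 / (1 + r)\<^sup>2 + (real ?N - 1) * (q * h)" by linarith
      have \<tau>: "\<tau> = radial_part G x + u x * (\<kappa> * dpsi ?N r)"
        unfolding \<tau>_def r_def using x by (rule radial_part_twist)
      have "\<bar>\<tau>\<bar>\<^sup>2 \<le> (norm (?T x) / conf (norm x))\<^sup>2"
        unfolding \<tau>_def by (intro power_mono radial_part_le x) simp
      then have T: "c * \<tau>\<^sup>2 \<le> grad_sq ?T x"
        using c by (simp add: grad_sq_def c_def mult_left_mono)
      have "?I1 x + 2 * ?I2 x = c * (e r * ((u x)\<^sup>2 * (1 / (1 + r)\<^sup>2 + (real ?N - 1) * (q * h)) + 2 * (q * (u x * \<tau>))))"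
      proof -
        have "C * (U\<^sup>2 * (E * (J + Q * (2 * \<kappa> * D)) + m * (Q * E * H))) + 2 * (C * (U * g * (Q * E)))
          = C * (E * (U\<^sup>2 * (J + m * (Q * H)) + 2 * (Q * (U * (g + U * (\<kappa> * D))))))" for C U E J Q D m H g :: real
          by (simp add: algebra_simps power2_eq_square)
        then show ?thesis
          unfolding r_def[symmetric] c_def[symmetric] h_def[symmetric] M_def M'_def q_def[symmetric] \<tau> .
      qed
      moreover have "c * (1 / 4 * (u x)\<^sup>2 - 4 * E * \<tau>\<^sup>2)
          \<le> c * (e r * ((u x)\<^sup>2 * (1 / (1 + r)\<^sup>2 + (real ?N - 1) * (q * h)) + 2 * (q * (u x * \<tau>))))"
      proof (rule mult_left_mono[OF _ c])
        have "1 / 4 * (u x)\<^sup>2 - 4 * \<tau>\<^sup>2 \<le> (u x)\<^sup>2 * (1 / 2) + 2 * (q * (u x * \<tau>))"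
        proof -
          \<comment> \<open>Completing the square gives up half of the coefficient 1/2 of
            \<open>u\<^sup>2\<close> at the price of \<open>4 \<tau>\<^sup>2\<close>; the quotient
            of 4 and the remaining 1/4 is the 16 of the statement.\<close>
          have "0 \<le> (1 / 2 * u x + 2 * (q * \<tau>))\<^sup>2" by simp
          then have "0 \<le> 1 / 4 * (u x)\<^sup>2 + 2 * (q * (u x * \<tau>)) + 4 * (q\<^sup>2 * \<tau>\<^sup>2)"
            by (simp add: power2_sum power_mult_distrib power_divide mult_ac)
          moreover have "q\<^sup>2 * \<tau>\<^sup>2 \<le> 1 * \<tau>\<^sup>2"
            using q by (intro mult_right_mono power_le_one) auto
          ultimately show ?thesis by simp
        qed
        also have "\<dots> \<le> (u x)\<^sup>2 * (1 / (1 + r)\<^sup>2 + (real ?N - 1) * (q * h)) + 2 * (q * (u x * \<tau>))"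
          using mult_left_mono[OF b, of "(u x)\<^sup>2"] by simp
        finally have "e r * (1 / 4 * (u x)\<^sup>2 - 4 * \<tau>\<^sup>2) \<le>
            e r * ((u x)\<^sup>2 * (1 / (1 + r)\<^sup>2 + (real ?N - 1) * (q * h)) + 2 * (q * (u x * \<tau>)))"
          using e_bounds[OF r] by (intro mult_left_mono) auto
        moreover have "1 * (u x)\<^sup>2 \<le> e r * (u x)\<^sup>2" "e r * \<tau>\<^sup>2 \<le> E * \<tau>\<^sup>2"
          using e_bounds[OF r] by (intro mult_right_mono; simp)+
        ultimately show "1 / 4 * (u x)\<^sup>2 - 4 * E * \<tau>\<^sup>2
          \<le> e r * ((u x)\<^sup>2 * (1 / (1 + r)\<^sup>2 + (real ?N - 1) * (q * h)) + 2 * (q * (u x * \<tau>)))"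
          by (simp add: right_diff_distrib)
      qed
      moreover have "4 * E * (c * \<tau>\<^sup>2) \<le> 4 * E * grad_sq ?T x"
        using T E1 by (intro mult_left_mono) auto
      ultimately show "1 / 4 * (conf (norm x) ^ ?N * (u x)\<^sup>2) - 4 * E * grad_sq ?T x \<le> ?I1 x + 2 * ?I2 x"
        unfolding c_def[symmetric] by (simp add: right_diff_distrib mult_ac)
    qed
  qed (use ibp(1,2) uint Tint in simp_all)
  also have "\<dots> = 0" using ibp by simp
  finally have "1 / 4 * (\<integral>x. conf (norm x) ^ ?N * (u x)\<^sup>2 \<partial>ball_measure) - 4 * E * (\<integral>x. grad_sq ?T x \<partial>ball_measure) \<le> 0"
    using uint Tint by simp
  then show ?thesis by (simp add: E_def)
qed

section \<open>A Poincare inequality on balls\<close>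

text \<open>At the origin the condition \<open>F' 0 = 0\<close> removes the conical singularity of
  the norm, and since division by 0 returns 0, one formula for the gradient covers all
  points.\<close>

lemma radial_has_derivative:
  fixes x :: "'a::euclidean_space"
  assumes F: "(F has_real_derivative F' (norm x)) (at (norm x))" and F'0: "F' 0 = 0"
  shows "((\<lambda>x. F (norm x)) has_derivative (\<lambda>h. ((F' (norm x) / norm x) *\<^sub>R x) \<bullet> h)) (at x)"
proof (cases "x = 0")
  case True
  have "((\<lambda>h. (F h - F 0) / h) \<longlongrightarrow> 0) (at 0)"
    using F True F'0 by (simp add: DERIV_def)
  moreover have "filterlim norm (at 0) (at (0::'a))"
    unfolding filterlim_at by (auto simp: eventually_at_filter intro!: tendsto_norm_zero tendsto_ident_at)
  ultimately have "((\<lambda>y::'a. (F (norm y) - F 0) / norm y) \<longlongrightarrow> 0) (at 0)"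
    by (rule filterlim_compose)
  then have "((\<lambda>y::'a. norm ((F (norm y) - F 0) / norm y)) \<longlongrightarrow> 0) (at 0)"
    by (rule tendsto_norm_zero)
  then have "((\<lambda>x::'a. F (norm x)) has_derivative (\<lambda>h. 0)) (at 0)"
    by (simp add: has_derivative_iff_norm norm_divide)
  then show ?thesis using True by simp
next
  case False
  then have "(norm has_derivative (\<lambda>h. (x \<bullet> h) / norm x)) (at x)"
    by (intro has_derivative_eq_rhs[OF has_derivative_norm])
      (auto simp: sgn_div_norm inner_commute divide_inverse mult.commute)
  from has_derivative_compose[OF this F[unfolded has_field_derivative_def]]
  show ?thesis by (simp add: mult.commute)
qed

lemma radial_gradient_continuous:
  assumes F': "continuous_on {-1<..<1} F'" and F'0: "F' 0 = 0"
  shows "continuous_on (ball 0 1) (\<lambda>x::'a::euclidean_space. (F' (norm x) / norm x) *\<^sub>R x)"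
proof -
  have "isCont (\<lambda>x. (F' (norm x) / norm x) *\<^sub>R x) x" if "norm x < 1" for x :: 'a
  proof (cases "x = 0")
    case True
    have "isCont F' 0" using F' by (auto simp: continuous_on_eq_continuous_at)
    then have "(F' \<longlongrightarrow> 0) (at 0)" using F'0 by (simp add: isCont_def)
    moreover have "filterlim norm (at 0) (at (0::'a))"
      unfolding filterlim_at by (auto simp: eventually_at_filter intro!: tendsto_norm_zero tendsto_ident_at)
    ultimately have "((\<lambda>y::'a. F' (norm y)) \<longlongrightarrow> 0) (at 0)" by (rule filterlim_compose)
    then have "((\<lambda>y::'a. (F' (norm y) / norm y) *\<^sub>R y) \<longlongrightarrow> 0) (at 0)"
      by (rule Lim_null_comparison[rotated, OF tendsto_norm_zero])
        (auto intro!: always_eventually simp: F'0)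
    then show ?thesis using True by (simp add: isCont_def)
  next
    case False
    have "isCont F' (norm x)"
    proof -
      have "norm x \<in> {-1<..<1}" using that by (auto intro: less_le_trans[of _ 0])
      then show ?thesis using F' by (simp only: continuous_on_eq_continuous_at[OF open_greaterThanLessThan])
    qed
    then have "isCont (\<lambda>x. F' (norm x)) x" by (intro isCont_o2[of _ norm F']) auto
    then show ?thesis using False by (intro continuous_intros) auto
  qed
  then show ?thesis by (auto intro!: continuous_at_imp_continuous_on)
qed

text \<open>The fundamental theorem of calculus along the segment, then Cauchy-Schwarz in
  \<open>t\<close>. Convexity keeps the segment in the ball, so inserting the indicator costs
  nothing; with it the right-hand side can be integrated over the whole space and
  translated.\<close>

lemma squared_increment_le:
  fixes f :: "'a::euclidean_space \<Rightarrow> real" and V :: "'a \<Rightarrow> 'a"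
  assumes f: "\<And>x. norm x < s' \<Longrightarrow> (f has_derivative (\<lambda>h. V x \<bullet> h)) (at x)"
    and V: "continuous_on (ball 0 s') V" and s: "s \<le> s'"
    and x: "x \<in> ball 0 s" "x + h \<in> ball 0 s"
  shows "ennreal ((f (x + h) - f x)\<^sup>2)
    \<le> (\<integral>\<^sup>+t. ennreal ((norm h)\<^sup>2 * (indicator {0..1} t * (indicator (ball 0 s) (x + t *\<^sub>R h) * (norm (V (x + t *\<^sub>R h)))\<^sup>2))) \<partial>lborel)"
proof -
  define p where "p t = x + t *\<^sub>R h" for t
  have p_in: "p t \<in> ball 0 s" if "t \<in> {0..1}" for t
  proof -
    have "(1 - t) *\<^sub>R x + t *\<^sub>R (x + h) \<in> ball 0 s"
      using convex_ball[of "0::'a" s] x that unfolding convex_alt by auto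
    then show ?thesis by (simp add: p_def algebra_simps)
  qed
  have p_in': "norm (p t) < s'" if "t \<in> {0..1}" for t using p_in[OF that] s by simp
  define F' where "F' t = V (p t) \<bullet> h" for t
  have p_cont: "isCont p t" for t unfolding p_def by (intro continuous_intros)
  have F'_cont: "isCont F' t" if "t \<in> {0..1}" for t
  proof -
    have "isCont V (p t)"
      using V p_in'[OF that] by (auto simp: continuous_on_eq_continuous_at)
    then have "isCont (\<lambda>t. V (p t)) t" by (rule isCont_o2[OF p_cont])
    then show ?thesis unfolding F'_def by (intro continuous_intros)
  qed
  have dF: "((\<lambda>t. f (p t)) has_real_derivative F' t) (at t)" if "t \<in> {0..1}" for t
  proof -
    have "(p has_derivative (\<lambda>k. k *\<^sub>R h)) (at t)"
      unfolding p_def by (auto intro!: derivative_eq_intros)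
    from has_derivative_compose[OF this f[OF p_in'[OF that]]]
    show ?thesis by (simp add: has_field_derivative_def F'_def mult.commute[of _ "V _ \<bullet> h"])
  qed
  have ind: "(indicator {0..1} t :: real)\<^sup>2 = indicator {0..1} t" for t :: real
    by (simp add: indicator_def)
  have F'_on: "continuous_on {0..1} F'" using F'_cont by (auto intro: continuous_at_imp_continuous_on)
  have Fi: "(\<lambda>t. indicator {0..1} t * F' t) \<in> borel_measurable borel"
    using borel_measurable_continuous_on_indicator[OF _ F'_on] by simp
  have Fsq: "integrable lborel (\<lambda>t. indicator {0..1} t *\<^sub>R (F' t)\<^sup>2)"
    using borel_integrable_compact[of "{0..1}" "\<lambda>t. (F' t)\<^sup>2"] F'_on
    by (auto intro!: continuous_intros simp: indicator_scaleR_eq_if cong: if_cong)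
  have sq1: "sq_int lborel (\<lambda>t. indicator {0..1} t * F' t)"
    using Fi Fsq by (simp add: sq_int_def power_mult_distrib ind)
  have sq2: "sq_int lborel (indicator {0..1} :: real \<Rightarrow> real)"
    by (simp add: sq_int_def ind)
  have "(\<integral>t. (indicator {0..1} t * F' t) * indicator {0..1} t \<partial>lborel) = f (p 1) - f (p 0)"
  proof -
    have "(\<integral>t. indicator {0..1} t *\<^sub>R F' t \<partial>lborel) = f (p 1) - f (p 0)"
    proof (rule integral_FTC_atLeastAtMost)
      show "((\<lambda>t. f (p t)) has_vector_derivative F' t) (at t within {0..1})" if "0 \<le> t" "t \<le> 1" for t
        using dF[of t] that
        by (auto simp: has_real_derivative_iff_has_vector_derivative intro: has_vector_derivative_at_within)
    qed (use F'_on in auto)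
    moreover have "(indicator {0..1} t * F' t) * indicator {0..1} t = indicator {0..1} t *\<^sub>R F' t" for t
      by (simp add: indicator_def)
    ultimately show ?thesis by (simp only:)
  qed
  then have "\<bar>f (p 1) - f (p 0)\<bar> \<le> sqrt (\<integral>t. (indicator {0..1} t * F' t)\<^sup>2 \<partial>lborel) * sqrt (\<integral>t. (indicator {0..1} (t::real))\<^sup>2 \<partial>lborel)"
    using integral_Cauchy_Schwarz[OF sq1 sq2] by simp
  also have "(\<integral>t. (indicator {0..1} (t::real))\<^sup>2 \<partial>lborel) = (1::real)" by (simp add: ind)
  finally have "\<bar>f (x + h) - f x\<bar> \<le> sqrt (\<integral>t. (indicator {0..1} t * F' t)\<^sup>2 \<partial>lborel)" by (simp add: p_def)
  then have "\<bar>f (x + h) - f x\<bar>\<^sup>2 \<le> (sqrt (\<integral>t. (indicator {0..1} t * F' t)\<^sup>2 \<partial>lborel))\<^sup>2"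
    by (rule power_mono) simp
  then have "(f (x + h) - f x)\<^sup>2 \<le> (\<integral>t. (indicator {0..1} t * F' t)\<^sup>2 \<partial>lborel)" by simp
  then have "ennreal ((f (x + h) - f x)\<^sup>2) \<le> ennreal (\<integral>t. (indicator {0..1} t * F' t)\<^sup>2 \<partial>lborel)"
    by (rule ennreal_leI)
  also have "\<dots> = (\<integral>\<^sup>+t. ennreal ((indicator {0..1} t * F' t)\<^sup>2) \<partial>lborel)"
    using sq1 by (subst nn_integral_eq_integral) (auto simp: sq_int_def)
  also have "\<dots> \<le> (\<integral>\<^sup>+t. ennreal ((norm h)\<^sup>2 * (indicator {0..1} t * (indicator (ball 0 s) (x + t *\<^sub>R h) * (norm (V (x + t *\<^sub>R h)))\<^sup>2))) \<partial>lborel)"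
  proof (intro nn_integral_mono ennreal_leI)
    fix t :: real
    have "\<bar>F' t\<bar>\<^sup>2 \<le> (norm (V (p t)) * norm h)\<^sup>2"
      unfolding F'_def by (intro power_mono Cauchy_Schwarz_ineq2) simp
    then show "(indicator {0..1} t * F' t)\<^sup>2 \<le> (norm h)\<^sup>2 * (indicator {0..1} t * (indicator (ball 0 s) (x + t *\<^sub>R h) * (norm (V (x + t *\<^sub>R h)))\<^sup>2))"
      using p_in[of t] by (auto simp: indicator_def power_mult_distrib mult.commute p_def)
  qed
  finally show ?thesis .
qed

text \<open>Substituting \<open>y = x + h\<close> first, the translation by \<open>t h\<close> costs nothing for fixed \<open>h\<close> and \<open>t\<close>.\<close>

lemma double_integral_increment_le:
  fixes f :: "'a::euclidean_space \<Rightarrow> real" and V :: "'a \<Rightarrow> 'a"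
  assumes f: "\<And>x. norm x < s' \<Longrightarrow> (f has_derivative (\<lambda>h. V x \<bullet> h)) (at x)"
    and V: "continuous_on (ball 0 s') V" and s: "0 < s" "s \<le> s'"
  defines "i \<equiv> indicator (ball 0 s) :: 'a \<Rightarrow> real"
  shows "(\<integral>\<^sup>+x. \<integral>\<^sup>+y. ennreal (i x * (i y * (f y - f x)\<^sup>2)) \<partial>lborel \<partial>lborel)
    \<le> ennreal (4 * s\<^sup>2 * measure lborel (ball (0::'a) (2 * s))) * (\<integral>\<^sup>+x. ennreal (i x * (norm (V x))\<^sup>2) \<partial>lborel)"
proof -
  define \<phi> where "\<phi> x = i x * (norm (V x))\<^sup>2" for x
  have f_cont: "continuous_on (ball 0 s) f"
    using has_derivative_continuous[OF f] s by (auto intro!: continuous_at_imp_continuous_on)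
  have V_cont: "continuous_on (ball 0 s) V"
    using V by (rule continuous_on_subset) (use s in auto)
  have i_meas[measurable]: "i \<in> borel_measurable borel"
    unfolding i_def by (intro borel_measurable_indicator) simp
  define f0 where "f0 x = i x * f x" for x
  have f0_meas[measurable]: "f0 \<in> borel_measurable borel"
    using borel_measurable_continuous_on_indicator[OF _ f_cont] by (simp add: f0_def[abs_def] i_def)
  have \<phi>_meas[measurable]: "\<phi> \<in> borel_measurable borel"
  proof -
    have "continuous_on (ball 0 s) (\<lambda>x. (norm (V x))\<^sup>2)" by (intro continuous_intros V_cont)
    from borel_measurable_continuous_on_indicator[OF _ this] show ?thesis
      by (simp add: \<phi>_def[abs_def] i_def)
  qed
  have i_eq: "i x * (i y * (f y - f x)\<^sup>2) = i x * (i y * (f0 y - f0 x)\<^sup>2)" for x y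
    by (auto simp: f0_def i_def indicator_def)
  have "(\<integral>\<^sup>+x. \<integral>\<^sup>+y. ennreal (i x * (i y * (f y - f x)\<^sup>2)) \<partial>lborel \<partial>lborel)
      = (\<integral>\<^sup>+x. \<integral>\<^sup>+h. ennreal (i x * (i (x + h) * (f0 (x + h) - f0 x)\<^sup>2)) \<partial>lborel \<partial>lborel)"
  proof (rule nn_integral_cong)
    fix x
    show "(\<integral>\<^sup>+y. ennreal (i x * (i y * (f y - f x)\<^sup>2)) \<partial>lborel) = (\<integral>\<^sup>+h. ennreal (i x * (i (x + h) * (f0 (x + h) - f0 x)\<^sup>2)) \<partial>lborel)"
      unfolding i_eq
      by (subst lborel_nn_integral_translation[symmetric, of _ x]) (auto simp: add.commute)
  qed
  also have "\<dots> = (\<integral>\<^sup>+h. \<integral>\<^sup>+x. ennreal (i x * (i (x + h) * (f0 (x + h) - f0 x)\<^sup>2)) \<partial>lborel \<partial>lborel)"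
    by (rule lborel_pair.Fubini') measurable
  \<comment> \<open>Two points of the ball differ by less than \<open>2 * s\<close>, so only such
    \<open>h\<close> contribute, and for them
    \<open>(norm h)\<^sup>2 \<le> 4 * s\<^sup>2\<close>.\<close>
  also have "\<dots> \<le> (\<integral>\<^sup>+h. ennreal (4 * s\<^sup>2 * indicator (ball (0::'a) (2 * s)) h) * (\<integral>\<^sup>+x. ennreal (\<phi> x) \<partial>lborel) \<partial>lborel)"
  proof (rule nn_integral_mono)
    fix h :: 'a
    show "(\<integral>\<^sup>+x. ennreal (i x * (i (x + h) * (f0 (x + h) - f0 x)\<^sup>2)) \<partial>lborel)
      \<le> ennreal (4 * s\<^sup>2 * indicator (ball 0 (2 * s)) h) * (\<integral>\<^sup>+x. ennreal (\<phi> x) \<partial>lborel)"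
    proof (cases "norm h < 2 * s")
      case True
      have h2: "(norm h)\<^sup>2 \<le> 4 * s\<^sup>2" using power_mono[of "norm h" "2 * s" 2] True by (simp add: power_mult_distrib)
      have "(\<integral>\<^sup>+x. ennreal (i x * (i (x + h) * (f0 (x + h) - f0 x)\<^sup>2)) \<partial>lborel)
        \<le> (\<integral>\<^sup>+x. \<integral>\<^sup>+t. ennreal ((norm h)\<^sup>2 * (indicator {0..1} t * \<phi> (x + t *\<^sub>R h))) \<partial>lborel \<partial>lborel)"
      proof (rule nn_integral_mono)
        fix x :: 'a
        show "ennreal (i x * (i (x + h) * (f0 (x + h) - f0 x)\<^sup>2)) \<le> (\<integral>\<^sup>+t. ennreal ((norm h)\<^sup>2 * (indicator {0..1} t * \<phi> (x + t *\<^sub>R h))) \<partial>lborel)"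
        proof (cases "x \<in> ball 0 s \<and> x + h \<in> ball 0 s")
          case True
          then show ?thesis
            using squared_increment_le[OF f V s(2), of x h] by (simp add: \<phi>_def i_def f0_def)
        next
          case False
          then have z: "i x * (i (x + h) * (f0 (x + h) - f0 x)\<^sup>2) = 0" by (auto simp: i_def)
          show ?thesis unfolding z by simp
        qed
      qed
      also have "\<dots> = (\<integral>\<^sup>+t. \<integral>\<^sup>+x. ennreal ((norm h)\<^sup>2 * (indicator {0..1} t * \<phi> (x + t *\<^sub>R h))) \<partial>lborel \<partial>lborel)"
        by (rule lborel_pair.Fubini') measurable
      also have "\<dots> = (\<integral>\<^sup>+t. ennreal ((norm h)\<^sup>2) * (\<integral>\<^sup>+x. ennreal (\<phi> x) \<partial>lborel) * indicator {0..1} (t::real) \<partial>lborel)"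
      proof (rule nn_integral_cong)
        fix t :: real
        have "(\<integral>\<^sup>+x. ennreal ((norm h)\<^sup>2 * (indicator {0..1} t * \<phi> (x + t *\<^sub>R h))) \<partial>lborel)
          = (\<integral>\<^sup>+x. ennreal ((norm h)\<^sup>2) * indicator {0..1} t * ennreal (\<phi> (x + t *\<^sub>R h)) \<partial>lborel)"
          by (intro nn_integral_cong) (auto simp: indicator_def ennreal_mult \<phi>_def i_def)
        also have "\<dots> = ennreal ((norm h)\<^sup>2) * indicator {0..1} t * (\<integral>\<^sup>+x. ennreal (\<phi> (x + t *\<^sub>R h)) \<partial>lborel)"
          by (rule nn_integral_cmult) measurable
        also have "(\<integral>\<^sup>+x. ennreal (\<phi> (x + t *\<^sub>R h)) \<partial>lborel) = (\<integral>\<^sup>+x. ennreal (\<phi> x) \<partial>lborel)"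
          by (rule lborel_nn_integral_translation) measurable
        finally show "(\<integral>\<^sup>+x. ennreal ((norm h)\<^sup>2 * (indicator {0..1} t * \<phi> (x + t *\<^sub>R h))) \<partial>lborel)
          = ennreal ((norm h)\<^sup>2) * (\<integral>\<^sup>+x. ennreal (\<phi> x) \<partial>lborel) * indicator {0..1} t" by (simp add: mult_ac)
      qed
      also have "\<dots> = ennreal ((norm h)\<^sup>2) * (\<integral>\<^sup>+x. ennreal (\<phi> x) \<partial>lborel)"
        by (subst nn_integral_cmult_indicator) auto
      also have "\<dots> \<le> ennreal (4 * s\<^sup>2 * indicator (ball 0 (2 * s)) h) * (\<integral>\<^sup>+x. ennreal (\<phi> x) \<partial>lborel)"
        using True h2 by (intro mult_right_mono ennreal_leI) auto
      finally show ?thesis .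
    next
      case False
      have z: "i x * (i (x + h) * (f0 (x + h) - f0 x)\<^sup>2) = 0" for x
        using False norm_triangle_ineq2[of "x + h" x] norm_triangle_ineq4[of "x + h" x]
        by (auto simp: i_def indicator_def)
      show ?thesis unfolding z by simp
    qed
  qed
  also have "\<dots> = (\<integral>\<^sup>+h. ennreal (4 * s\<^sup>2 * indicator (ball (0::'a) (2 * s)) h) \<partial>lborel) * (\<integral>\<^sup>+x. ennreal (\<phi> x) \<partial>lborel)"
    by (rule nn_integral_multc)
      (intro measurable_compose[OF _ measurable_ennreal] borel_measurable_times borel_measurable_indicator; simp)
  also have "(\<integral>\<^sup>+h. ennreal (4 * s\<^sup>2 * indicator (ball (0::'a) (2 * s)) h) \<partial>lborel) = ennreal (4 * s\<^sup>2 * measure lborel (ball (0::'a) (2 * s)))"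
  proof -
    have "integrable lborel (\<lambda>h::'a. 4 * s\<^sup>2 * indicator (ball 0 (2 * s)) h)"
      using emeasure_bounded_finite[OF bounded_ball, of "0::'a" "2 * s"]
      by (intro integrable_mult_right integrable_real_indicator) auto
    then show ?thesis by (subst nn_integral_eq_integral) auto
  qed
  finally show ?thesis by (simp add: \<phi>_def)
qed

lemma bounded_on_smaller_ball:
  fixes g :: "'a::euclidean_space \<Rightarrow> real"
  assumes "continuous_on (ball 0 s') g" "s < s'"
  obtains B where "\<And>x. \<bar>indicator (ball 0 s) x * g x\<bar> \<le> B"
    "(\<lambda>x. indicator (ball 0 s) x * g x) \<in> borel_measurable borel"
proof -
  have "cball (0::'a) s \<subseteq> ball 0 s'" using assms(2) by auto
  then have "compact (g ` cball 0 s)"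
    by (intro compact_continuous_image continuous_on_subset[OF assms(1)]) auto
  then have "bounded (g ` cball 0 s)" by (rule compact_imp_bounded)
  then obtain B where B: "\<forall>x\<in>cball 0 s. \<bar>g x\<bar> \<le> B" by (auto simp: bounded_iff)
  have "\<bar>indicator (ball 0 s) x * g x\<bar> \<le> max B 0" for x
    using B[rule_format, of x] by (cases "x \<in> ball 0 s") auto
  moreover have "(\<lambda>x. indicator (ball 0 s) x * g x) \<in> borel_measurable borel"
  proof -
    have "continuous_on (ball 0 s) g"
      using assms(2) by (intro continuous_on_subset[OF assms(1)]) auto
    from borel_measurable_continuous_on_indicator[OF _ this] show ?thesis by simp
  qed
  ultimately show ?thesis using that by blast
qed

text \<open>The integral of \<open>(f y - f x)\<^sup>2\<close> over pairs of points of the ball is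
  \<open>2 * (A * P - S\<^sup>2)\<close>, with \<open>A\<close> the volume. This variance form does
  not mention the mean and is continuous under limits in the square norm.\<close>

lemma poincare_classical:
  fixes f :: "'a::euclidean_space \<Rightarrow> real" and V :: "'a \<Rightarrow> 'a"
  assumes f: "\<And>x. norm x < s' \<Longrightarrow> (f has_derivative (\<lambda>h. V x \<bullet> h)) (at x)"
    and V: "continuous_on (ball 0 s') V" and s: "0 < s" "s < s'" "s' \<le> 1"
  defines "i \<equiv> indicator (ball 0 s) :: 'a \<Rightarrow> real"
  shows "measure lborel (ball (0::'a) s) * (\<integral>x. (i x * f x)\<^sup>2 \<partial>ball_measure) - (\<integral>x. i x * f x \<partial>ball_measure)\<^sup>2
    \<le> 2 * s\<^sup>2 * measure lborel (ball (0::'a) (2 * s)) * (\<integral>x. i x * (norm (V x))\<^sup>2 \<partial>ball_measure)"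
proof -
  define A m where "A = measure lborel (ball (0::'a) s)" and "m = measure lborel (ball (0::'a) (2 * s))"
  have f_cont: "continuous_on (ball 0 s') f"
    using has_derivative_continuous[OF f] by (auto intro!: continuous_at_imp_continuous_on)
  have int: "integrable lborel (\<lambda>x. i x * g x)" "(\<integral>x. i x * g x \<partial>ball_measure) = (\<integral>x. i x * g x \<partial>lborel)"
    if g: "continuous_on (ball 0 s') g" for g :: "'a \<Rightarrow> real"
  proof -
    obtain B where B: "\<And>x. \<bar>indicator (ball 0 s) x * g x\<bar> \<le> B"
      "(\<lambda>x. indicator (ball 0 s) x * g x) \<in> borel_measurable borel"
      using bounded_on_smaller_ball[OF g s(2)] by blast
    show "integrable lborel (\<lambda>x. i x * g x)"
      unfolding i_def by (rule integrable_bounded_support[OF B(2,1), of s]) simp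
    show "(\<integral>x. i x * g x \<partial>ball_measure) = (\<integral>x. i x * g x \<partial>lborel)"
      unfolding i_def using s by (intro ball_measure_borel(2)[OF B(2)]) auto
  qed
  define P S Q where "P = (\<integral>x. i x * (f x)\<^sup>2 \<partial>lborel)" and "S = (\<integral>x. i x * f x \<partial>lborel)"
    and "Q = (\<integral>x. i x * (norm (V x))\<^sup>2 \<partial>lborel)"
  have c2: "continuous_on (ball 0 s') (\<lambda>x. (f x)\<^sup>2)" "continuous_on (ball 0 s') (\<lambda>x. (norm (V x))\<^sup>2)"
    "continuous_on (ball 0 s') (\<lambda>x::'a. 1::real)"
    by (intro continuous_intros f_cont V)+
  note I = int(1)[OF f_cont] int(1)[OF c2(1)] int(1)[OF c2(2)] int(1)[OF c2(3), simplified]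
  have i_int: "(\<integral>x. i x \<partial>lborel) = A" by (simp add: i_def A_def)
  have i0: "0 \<le> i x" for x by (simp add: i_def)
  have eq: "i y * (f y - a)\<^sup>2 = i y * (f y)\<^sup>2 - 2 * a * (i y * f y) + a\<^sup>2 * i y" for a y
    by (simp add: power2_diff algebra_simps)
  have inner_int: "integrable lborel (\<lambda>y. i y * (f y - a)\<^sup>2)" for a
    unfolding eq using I by simp
  have inner: "(\<integral>y. i y * (f y - a)\<^sup>2 \<partial>lborel) = P - 2 * a * S + a\<^sup>2 * A" for a
    unfolding eq P_def S_def i_int[symmetric] using I by simp
  have nn: "0 \<le> P - 2 * a * S + a\<^sup>2 * A" for a
    unfolding inner[symmetric] by (rule integral_nonneg_AE) (simp add: i0)
  have eq2: "i x * (P - 2 * f x * S + (f x)\<^sup>2 * A) = P * i x - 2 * S * (i x * f x) + A * (i x * (f x)\<^sup>2)" for x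
    by (simp add: algebra_simps)
  have "(\<integral>\<^sup>+x. \<integral>\<^sup>+y. ennreal (i x * (i y * (f y - f x)\<^sup>2)) \<partial>lborel \<partial>lborel)
    = (\<integral>\<^sup>+x. ennreal (i x * (P - 2 * f x * S + (f x)\<^sup>2 * A)) \<partial>lborel)"
  proof (rule nn_integral_cong)
    fix x
    have "(\<integral>\<^sup>+y. ennreal (i x * (i y * (f y - f x)\<^sup>2)) \<partial>lborel) = ennreal (\<integral>y. i x * (i y * (f y - f x)\<^sup>2) \<partial>lborel)"
      using inner_int[of "f x"] by (intro nn_integral_eq_integral) (auto simp: i0)
    also have "(\<integral>y. i x * (i y * (f y - f x)\<^sup>2) \<partial>lborel) = i x * (P - 2 * f x * S + (f x)\<^sup>2 * A)"
      by (simp only: integral_mult_right_zero inner)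
    finally show "(\<integral>\<^sup>+y. ennreal (i x * (i y * (f y - f x)\<^sup>2)) \<partial>lborel) = ennreal (i x * (P - 2 * f x * S + (f x)\<^sup>2 * A))" .
  qed
  also have "\<dots> = ennreal (\<integral>x. i x * (P - 2 * f x * S + (f x)\<^sup>2 * A) \<partial>lborel)"
  proof (rule nn_integral_eq_integral)
    show "integrable lborel (\<lambda>x. i x * (P - 2 * f x * S + (f x)\<^sup>2 * A))" unfolding eq2 using I by simp
    show "AE x in lborel. 0 \<le> i x * (P - 2 * f x * S + (f x)\<^sup>2 * A)" using nn i0 by simp
  qed
  also have "(\<integral>x. i x * (P - 2 * f x * S + (f x)\<^sup>2 * A) \<partial>lborel) = 2 * (A * P - S\<^sup>2)"
  proof -
    have "(\<integral>x. P * i x - 2 * S * (i x * f x) + A * (i x * (f x)\<^sup>2) \<partial>lborel) = P * A - 2 * S * S + A * P"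
      using I i_int by (simp add: P_def[symmetric] S_def[symmetric])
    then show ?thesis unfolding eq2 by (simp add: power2_eq_square algebra_simps)
  qed
  finally have "ennreal (2 * (A * P - S\<^sup>2)) \<le> ennreal (4 * s\<^sup>2 * m) * (\<integral>\<^sup>+x. ennreal (i x * (norm (V x))\<^sup>2) \<partial>lborel)"
    using double_integral_increment_le[OF f V s(1) less_imp_le[OF s(2)]] by (simp add: i_def m_def)
  also have "(\<integral>\<^sup>+x. ennreal (i x * (norm (V x))\<^sup>2) \<partial>lborel) = ennreal Q"
    unfolding Q_def using I by (intro nn_integral_eq_integral) (auto simp: i0)
  also have "ennreal (4 * s\<^sup>2 * m) * ennreal Q = ennreal (4 * s\<^sup>2 * m * Q)"
    by (rule ennreal_mult[symmetric]) (auto simp: m_def Q_def i0)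
  finally have "2 * (A * P - S\<^sup>2) \<le> 4 * s\<^sup>2 * m * Q"
    by (subst (asm) ennreal_le_iff) (auto simp: m_def Q_def i0)
  moreover have "(\<integral>x. (i x * f x)\<^sup>2 \<partial>ball_measure) = P"
  proof -
    have "(i x * f x)\<^sup>2 = i x * (f x)\<^sup>2" for x by (simp add: i_def indicator_def)
    then show ?thesis using int(2)[OF c2(1)] by (simp add: P_def)
  qed
  ultimately show ?thesis
    using int(2)[OF c2(2)] int(2)[OF f_cont] by (simp add: A_def[symmetric] m_def[symmetric] S_def Q_def)
qed

lemma sum_components_square: "(norm (X::'a::euclidean_space))\<^sup>2 = (\<Sum>b\<in>Basis. (X \<bullet> b)\<^sup>2)"
  unfolding power2_norm_eq_inner by (subst euclidean_inner) (simp add: power2_eq_square)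

text \<open>The inequality for approximants is passed to the limit in variance form, and only then
  is the mean \<open>c\<close> introduced. The continuously differentiable radial factor is
  multiplied onto the approximants, and \<open>W\<close> is what the product rule gives for the
  product \<open>v\<close>.\<close>

lemma poincare_weak:
  fixes u :: "'a::euclidean_space \<Rightarrow> real" and G :: "'a \<Rightarrow> 'a"
  assumes app: "C1_approximable u G"
    and F: "\<And>t. \<bar>t\<bar> < 1 \<Longrightarrow> (F has_real_derivative F' t) (at t)" and F'0: "F' 0 = 0"
    and F'_cont: "continuous_on {-1<..<1} F'" and s: "0 < s" "s < 1"
  defines "i \<equiv> indicator (ball 0 s) :: 'a \<Rightarrow> real"
    and "v \<equiv> \<lambda>x. F (norm x) * u x"
    and "W \<equiv> \<lambda>x. F (norm x) *\<^sub>R G x + u x *\<^sub>R ((F' (norm x) / norm x) *\<^sub>R x)"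
  obtains c where "integrable ball_measure (\<lambda>x. i x * (v x - c)\<^sup>2)"
    "integrable ball_measure (\<lambda>x. i x * (norm (W x))\<^sup>2)"
    "(\<integral>x. i x * (v x - c)\<^sup>2 \<partial>ball_measure) \<le> 2 ^ (DIM('a) + 1) * s\<^sup>2 * (\<integral>x. i x * (norm (W x))\<^sup>2 \<partial>ball_measure)"
proof -
  define s' where "s' = (s + 1) / 2"
  have s': "s < s'" "s' < 1" using s by (auto simp: s'_def)
  obtain U V where UV: "\<And>n x. norm x < s' \<Longrightarrow> (U n has_derivative (\<lambda>h. V n x \<bullet> h)) (at x)"
     "\<And>n. continuous_on (ball 0 s') (V n)" "L2_lim ball_measure U u"
     "\<And>b. b \<in> Basis \<Longrightarrow> L2_lim ball_measure (\<lambda>n x. V n x \<bullet> b) (\<lambda>x. G x \<bullet> b)"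
    using app s'(2) unfolding C1_approximable_def by blast
  define g where "g x = (F' (norm x) / norm x) *\<^sub>R x" for x :: 'a
  have dF: "((\<lambda>x. F (norm x)) has_derivative (\<lambda>h. g x \<bullet> h)) (at x)" if "norm x < 1" for x :: 'a
    unfolding g_def using that by (intro radial_has_derivative F F'0) simp
  have F_cont: "continuous_on (ball 0 1) (\<lambda>x::'a. F (norm x))"
    using has_derivative_continuous[OF dF] by (auto intro!: continuous_at_imp_continuous_on)
  have g_cont: "continuous_on (ball 0 1) g"
    unfolding g_def by (rule radial_gradient_continuous[OF F'_cont F'0])
  obtain BF where BF: "\<And>x::'a. \<bar>i x * F (norm x)\<bar> \<le> BF" "(\<lambda>x. i x * F (norm x)) \<in> borel_measurable borel"
    unfolding i_def using bounded_on_smaller_ball[OF F_cont s(2)] by blast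
  have "\<exists>B. \<forall>x. \<bar>i x * (g x \<bullet> b)\<bar> \<le> B" "(\<lambda>x. i x * (g x \<bullet> b)) \<in> borel_measurable borel" for b
  proof -
    have "continuous_on (ball 0 1) (\<lambda>x. g x \<bullet> b)" by (intro continuous_intros g_cont)
    then show "\<exists>B. \<forall>x. \<bar>i x * (g x \<bullet> b)\<bar> \<le> B" "(\<lambda>x. i x * (g x \<bullet> b)) \<in> borel_measurable borel"
      unfolding i_def using bounded_on_smaller_ball[OF _ s(2)] by blast+
  qed
  note gm = this(2)
  obtain Bg where Bg: "\<And>b x. \<bar>i x * (g x \<bullet> b)\<bar> \<le> Bg b"
    using choice[of "\<lambda>b B. \<forall>x. \<bar>i x * (g x \<bullet> b)\<bar> \<le> B"] \<open>\<And>b. \<exists>B. \<forall>x. \<bar>i x * (g x \<bullet> b)\<bar> \<le> B\<close> by blast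
  define f where "f n x = F (norm x) * U n x" for n x
  define Vf where "Vf n x = F (norm x) *\<^sub>R V n x + U n x *\<^sub>R g x" for n x
  have df: "(f n has_derivative (\<lambda>h. Vf n x \<bullet> h)) (at x)" if "norm x < s'" for n x
    using has_derivative_mult[OF dF UV(1)[OF that, of n]] that s'
    by (simp add: f_def[abs_def] Vf_def inner_add_left add.commute mult.commute)
  have U_cont: "continuous_on (ball 0 s') (U n)" for n
    using has_derivative_continuous[OF UV(1)] by (auto intro!: continuous_at_imp_continuous_on)
  have Vf_cont: "continuous_on (ball 0 s') (Vf n)" for n
    unfolding Vf_def
    by (intro continuous_intros UV(2) U_cont continuous_on_subset[OF F_cont] continuous_on_subset[OF g_cont])
      (use s' in auto)
  have Lf: "L2_lim ball_measure (\<lambda>n x. i x * f n x) (\<lambda>x. i x * v x)"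
    using L2_lim_bounded_mult[OF UV(3) ball_measure_borel_measurable[OF BF(2)] BF(1)]
    by (simp add: f_def v_def mult.assoc)
  have LV: "L2_lim ball_measure (\<lambda>n x. i x * (Vf n x \<bullet> b)) (\<lambda>x. i x * (W x \<bullet> b))" if b: "b \<in> Basis" for b
    using L2_lim_add[OF L2_lim_bounded_mult[OF UV(4)[OF b] ball_measure_borel_measurable[OF BF(2)] BF(1)]
        L2_lim_bounded_mult[OF UV(3) ball_measure_borel_measurable[OF gm[of b]] Bg]]
    by (simp add: Vf_def W_def g_def inner_add_left distrib_left mult_ac)
  have one: "sq_int ball_measure (\<lambda>x::'a. 1)"
    using finite_measure.integrable_const[OF finite_ball_measure, of "1::real"] by (simp add: sq_int_def)
  define A where "A = measure lborel (ball (0::'a) s)"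
  \<comment> \<open>Doubling the radius multiplies the volume by \<open>2 ^ N\<close>; together with
    the factor 2 of \<open>poincare_classical\<close> this is \<open>2 ^ (N + 1)\<close>.\<close>
  have m: "measure lborel (ball (0::'a) (2 * s)) = 2 ^ DIM('a) * A"
    using s content_ball[of "2 * s" "0::'a"] content_ball[of s "0::'a"] by (simp add: A_def power_mult_distrib)
  have A: "0 < A"
    using s content_ball[of s "0::'a"] by (simp add: A_def)
  have i2: "i x * i x = i x" "(i x)\<^sup>2 = i x" for x by (simp_all add: i_def indicator_def)
  have norm_sum: "i x * (norm X)\<^sup>2 = (\<Sum>b\<in>Basis. (i x * (X \<bullet> b)) * (i x * (X \<bullet> b)))" for x X :: 'a
    unfolding sum_components_square sum_distrib_left
    by (intro sum.cong refl) (metis i2(2) power2_eq_square power_mult_distrib)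
  have int_sum: "(\<integral>x. i x * (norm (X x))\<^sup>2 \<partial>ball_measure) = (\<Sum>b\<in>Basis. \<integral>x. (i x * (X x \<bullet> b)) * (i x * (X x \<bullet> b)) \<partial>ball_measure)"
    if "\<And>b. b \<in> Basis \<Longrightarrow> sq_int ball_measure (\<lambda>x. i x * (X x \<bullet> b))" for X :: "'a \<Rightarrow> 'a"
    unfolding norm_sum using sq_int_mult[OF that that] by (intro Bochner_Integration.integral_sum) auto
  have int_X: "integrable ball_measure (\<lambda>x. i x * (norm (X x))\<^sup>2)"
    if "\<And>b. b \<in> Basis \<Longrightarrow> sq_int ball_measure (\<lambda>x. i x * (X x \<bullet> b))" for X :: "'a \<Rightarrow> 'a"
    unfolding norm_sum using sq_int_mult[OF that that] by (intro Bochner_Integration.integrable_sum) auto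
  have siV: "sq_int ball_measure (\<lambda>x. i x * (Vf n x \<bullet> b))" "sq_int ball_measure (\<lambda>x. i x * (W x \<bullet> b))" if "b \<in> Basis" for n b
    using LV[OF that] by (auto simp: L2_lim_def)
  have step: "A * (\<integral>x. (i x * f n x) * (i x * f n x) \<partial>ball_measure) - (\<integral>x. (i x * f n x) * 1 \<partial>ball_measure)\<^sup>2
    \<le> 2 * s\<^sup>2 * (2 ^ DIM('a) * A) * (\<Sum>b\<in>Basis. \<integral>x. (i x * (Vf n x \<bullet> b)) * (i x * (Vf n x \<bullet> b)) \<partial>ball_measure)" for n
  proof -
    have e: "(\<integral>x. i x * (norm (Vf n x))\<^sup>2 \<partial>ball_measure) = (\<Sum>b\<in>Basis. \<integral>x. (i x * (Vf n x \<bullet> b)) * (i x * (Vf n x \<bullet> b)) \<partial>ball_measure)"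
      by (rule int_sum, rule siV(1))
    have "A * (\<integral>x. (i x * f n x)\<^sup>2 \<partial>ball_measure) - (\<integral>x. i x * f n x \<partial>ball_measure)\<^sup>2
      \<le> 2 * s\<^sup>2 * (2 ^ DIM('a) * A) * (\<integral>x. i x * (norm (Vf n x))\<^sup>2 \<partial>ball_measure)"
      using poincare_classical[OF df Vf_cont s(1) s'(1) less_imp_le[OF s'(2)], of n]
      unfolding m A_def[symmetric] i_def[symmetric] .
    then show ?thesis unfolding e by (simp only: power2_eq_square mult_1_right)
  qed
  have lim1: "(\<lambda>n. A * (\<integral>x. (i x * f n x) * (i x * f n x) \<partial>ball_measure) - (\<integral>x. (i x * f n x) * 1 \<partial>ball_measure)\<^sup>2)
    \<longlonglongrightarrow> A * (\<integral>x. (i x * v x) * (i x * v x) \<partial>ball_measure) - (\<integral>x. (i x * v x) * 1 \<partial>ball_measure)\<^sup>2"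
    by (intro tendsto_intros L2_lim_integral_mult Lf L2_lim_const one)
  have lim2: "(\<lambda>n. 2 * s\<^sup>2 * (2 ^ DIM('a) * A) * (\<Sum>b\<in>Basis. \<integral>x. (i x * (Vf n x \<bullet> b)) * (i x * (Vf n x \<bullet> b)) \<partial>ball_measure))
    \<longlonglongrightarrow> 2 * s\<^sup>2 * (2 ^ DIM('a) * A) * (\<Sum>b\<in>Basis. \<integral>x. (i x * (W x \<bullet> b)) * (i x * (W x \<bullet> b)) \<partial>ball_measure)"
    by (intro tendsto_intros L2_lim_integral_mult LV)
  have "A * (\<integral>x. (i x * v x) * (i x * v x) \<partial>ball_measure) - (\<integral>x. (i x * v x) * 1 \<partial>ball_measure)\<^sup>2
    \<le> 2 * s\<^sup>2 * (2 ^ DIM('a) * A) * (\<Sum>b\<in>Basis. \<integral>x. (i x * (W x \<bullet> b)) * (i x * (W x \<bullet> b)) \<partial>ball_measure)"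
    by (rule LIMSEQ_le[OF lim1 lim2]) (use step in blast)
  moreover have "(\<integral>x. i x * (norm (W x))\<^sup>2 \<partial>ball_measure) = (\<Sum>b\<in>Basis. \<integral>x. (i x * (W x \<bullet> b)) * (i x * (W x \<bullet> b)) \<partial>ball_measure)"
    by (rule int_sum, rule siV(2))
  ultimately have main: "A * (\<integral>x. (i x * v x)\<^sup>2 \<partial>ball_measure) - (\<integral>x. i x * v x \<partial>ball_measure)\<^sup>2
    \<le> 2 * s\<^sup>2 * (2 ^ DIM('a) * A) * (\<integral>x. i x * (norm (W x))\<^sup>2 \<partial>ball_measure)"
    by (simp only: power2_eq_square mult_1_right)
  define P S where "P = (\<integral>x. (i x * v x)\<^sup>2 \<partial>ball_measure)" and "S = (\<integral>x. i x * v x \<partial>ball_measure)"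
  define c where "c = S / A"
  have siv: "sq_int ball_measure (\<lambda>x. i x * v x)" using Lf by (simp add: L2_lim_def)
  have i_borel: "i \<in> borel_measurable borel" unfolding i_def by (intro borel_measurable_indicator) simp
  have ib: "integrable ball_measure i" "(\<integral>x. i x \<partial>ball_measure) = A"
  proof -
    have "integrable lborel i"
      using i_borel by (intro integrable_bounded_support[where B = 1 and R = s]) (auto simp: i_def indicator_def)
    moreover have "i x = 0" if "1 \<le> norm x" for x using that s by (simp add: i_def)
    ultimately show "integrable ball_measure i" "(\<integral>x. i x \<partial>ball_measure) = A"
      using ball_measure_borel[OF i_borel] by (simp_all add: A_def i_def)
  qed
  have eq: "i x * (v x - c)\<^sup>2 = (i x * v x)\<^sup>2 - 2 * c * (i x * v x) + c\<^sup>2 * i x" for x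
    by (simp add: power2_diff power_mult_distrib i2 algebra_simps)
  have iv: "integrable ball_measure (\<lambda>x. i x * v x)" "integrable ball_measure (\<lambda>x. (i x * v x)\<^sup>2)"
    using siv sq_int_integrable[OF siv finite_ball_measure] by (auto simp: sq_int_def)
  show ?thesis
  proof (rule that[of c])
    show "integrable ball_measure (\<lambda>x. i x * (v x - c)\<^sup>2)"
      unfolding eq using iv ib by simp
    show "integrable ball_measure (\<lambda>x. i x * (norm (W x))\<^sup>2)" by (rule int_X[OF siV(2)])
    have "(\<integral>x. i x * (v x - c)\<^sup>2 \<partial>ball_measure) = P - 2 * c * S + c\<^sup>2 * A"
      unfolding eq using iv ib by (simp add: P_def S_def)
    also have "A * \<dots> = A * P - S\<^sup>2"
      using A by (simp add: c_def field_simps power2_eq_square)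
    also have "\<dots> \<le> A * (2 ^ (DIM('a) + 1) * s\<^sup>2 * (\<integral>x. i x * (norm (W x))\<^sup>2 \<partial>ball_measure))"
      using main by (simp add: P_def S_def mult_ac)
    finally show "(\<integral>x. i x * (v x - c)\<^sup>2 \<partial>ball_measure) \<le> 2 ^ (DIM('a) + 1) * s\<^sup>2 * (\<integral>x. i x * (norm (W x))\<^sup>2 \<partial>ball_measure)"
      using A by simp
  qed
qed

section \<open>Gaussians and the spectral gap\<close>

lemma unrad_le_iff: "unrad a \<le> unrad b \<longleftrightarrow> a \<le> b"
proof -
  have p: "0 < exp a + 1" "0 < exp b + (1::real)" by (simp_all add: add_pos_pos)
  have "unrad a \<le> unrad b \<longleftrightarrow> (exp a - 1) * (exp b + 1) \<le> (exp b - 1) * (exp a + 1)"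
    unfolding unrad_def using p by (simp add: divide_le_eq pos_le_divide_eq mult.commute mult.left_commute field_simps)
  also have "\<dots> \<longleftrightarrow> exp a \<le> exp b" by (simp add: algebra_simps)
  finally show ?thesis by simp
qed

lemma le_rad_iff:
  assumes "0 \<le> t" "t < 1"
  shows "r \<le> rad t \<longleftrightarrow> unrad r \<le> t"
proof -
  have "unrad (rad t) = t"
    using assms by (simp add: unrad_def exp_rad field_simps)
  then show ?thesis using unrad_le_iff[of r "rad t"] by simp
qed

text \<open>Clearing denominators reduces this to \<open>1 - r \<le> exp (- r)\<close>. It bounds
  the Euclidean radius of the Poincare ball by the hyperbolic one, and hence the Poincare constant
  by a multiple of \<open>\<lambda>\<^sup>2\<close>.\<close>

lemma unrad_le_self: "0 \<le> r \<Longrightarrow> unrad r \<le> r"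
proof -
  assume r: "0 \<le> r"
  have "1 - r \<le> exp (- r)" using exp_ge_add_one_self[of "- r"] by simp
  then have "(1 - r) * exp r \<le> 1" by (simp add: exp_minus field_simps)
  then have "exp r - 1 \<le> r * exp r" by (simp add: algebra_simps)
  also have "\<dots> \<le> r * (exp r + 1)" using r by (simp add: algebra_simps)
  finally show ?thesis by (simp add: unrad_def pos_divide_le_eq add_pos_pos)
qed

text \<open>The density is at most a multiple of \<open>exp (n r)\<close> and
  \<open>1 + r\<^sup>2 \<le> exp (2 r)\<close>, so the exponent is at most
  \<open>(n + 2) r - r\<^sup>2 / l\<close>, a parabola with maximum
  \<open>(n + 2)\<^sup>2 l / 4\<close>.\<close>

lemma gauss_decay:
  assumes "0 \<le> t" "t < 1" "0 < l"
  shows "conf t ^ n * ((1 + (rad t)\<^sup>2) * exp (- ((rad t)\<^sup>2 / l))) \<le> 2 ^ n * exp ((real n + 2)\<^sup>2 * l / 4)"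
proof -
  define r where "r = rad t"
  have r: "0 \<le> r" unfolding r_def using assms by (intro rad_nonneg)
  have "conf t ^ n \<le> (2 * exp r) ^ n"
    unfolding r_def using assms conf_pos[of t] by (intro power_mono conf_le_exp_rad) auto
  also have "\<dots> = 2 ^ n * exp (real n * r)" by (simp add: power_mult_distrib exp_of_nat_mult)
  finally have c: "conf t ^ n \<le> 2 ^ n * exp (real n * r)" .
  have "1 + r\<^sup>2 \<le> (1 + r)\<^sup>2" using r by (simp add: power2_sum)
  also have "\<dots> \<le> (exp r)\<^sup>2" using r exp_ge_add_one_self[of r] by (intro power_mono) auto
  also have "\<dots> = exp (2 * r)" by (simp add: power2_eq_square exp_add[symmetric])
  finally have "conf t ^ n * ((1 + r\<^sup>2) * exp (- (r\<^sup>2 / l)))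
      \<le> (2 ^ n * exp (real n * r)) * (exp (2 * r) * exp (- (r\<^sup>2 / l)))"
    using conf_pos[of t] assms by (intro mult_mono c mult_right_mono) auto
  also have "\<dots> = 2 ^ n * exp (real n * r + 2 * r - r\<^sup>2 / l)"
    by (simp add: exp_add exp_diff exp_minus divide_inverse mult_ac)
  also have "\<dots> \<le> 2 ^ n * exp ((real n + 2)\<^sup>2 * l / 4)"
  proof -
    have "0 \<le> (r - (real n + 2) * l / 2)\<^sup>2 / l" using assms(3) by simp
    also have "(r - (real n + 2) * l / 2)\<^sup>2 / l = r\<^sup>2 / l - (real n + 2) * r + (real n + 2)\<^sup>2 * l / 4"
      using assms(3) by (simp add: power2_eq_square field_simps)
    finally show ?thesis by (simp add: algebra_simps)
  qed
  finally show ?thesis by (simp add: r_def)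
qed

text \<open>\<open>\<sigma> = - 1 / (2 * \<lambda>\<^sup>2)\<close> gives the extremals, the opposite sign their inverses.\<close>

definition rgauss :: "real \<Rightarrow> real \<Rightarrow> real" where
  "rgauss \<sigma> t = exp (\<sigma> * (rad t)\<^sup>2)"

definition rgauss' :: "real \<Rightarrow> real \<Rightarrow> real" where
  "rgauss' \<sigma> t = rgauss \<sigma> t * (2 * \<sigma> * rad t * conf t)"

lemma rgauss_has_derivative: "\<bar>t\<bar> < 1 \<Longrightarrow> (rgauss \<sigma> has_real_derivative rgauss' \<sigma> t) (at t)"
  unfolding rgauss_def[abs_def] rgauss'_def
  by (auto intro!: derivative_eq_intros rad_has_derivative)

lemma rgauss'_0: "rgauss' \<sigma> 0 = 0"
  by (simp add: rgauss'_def rad_def)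

lemma rgauss'_continuous: "continuous_on {-1<..<1} (rgauss' \<sigma>)"
proof -
  have "continuous_on {-1<..<1} (rgauss \<sigma>)" "continuous_on {-1<..<1} rad" "continuous_on {-1<..<1} conf"
    by (auto intro!: continuous_at_imp_continuous_on DERIV_isCont[OF rgauss_has_derivative]
        DERIV_isCont[OF rad_has_derivative] DERIV_isCont[OF conf_has_derivative])
  then show ?thesis unfolding rgauss'_def[abs_def] by (intro continuous_intros)
qed

lemma measurable_rgauss[measurable]:
  "rgauss \<sigma> \<in> borel_measurable borel" "rgauss' \<sigma> \<in> borel_measurable borel"
  unfolding rgauss_def[abs_def] rgauss'_def[abs_def] by measurable

definition rgauss_grad :: "real \<Rightarrow> 'a::euclidean_space \<Rightarrow> 'a" where
  "rgauss_grad \<sigma> x = (rgauss' \<sigma> (norm x) / norm x) *\<^sub>R x"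

lemma bounded_sq_int:
  fixes h :: "'a::euclidean_space \<Rightarrow> real"
  assumes h: "h \<in> borel_measurable ball_measure" and le: "\<And>x. norm x < 1 \<Longrightarrow> (h x)\<^sup>2 \<le> B"
  shows "sq_int ball_measure h"
proof -
  have "integrable (ball_measure :: 'a measure) (\<lambda>x. B)"
    using finite_measure.integrable_const[OF finite_ball_measure] .
  then have "integrable ball_measure (\<lambda>x. (h x)\<^sup>2)"
    by (rule integrable_ball_measure_bound) (use h le in \<open>auto intro: borel_measurable_power\<close>)
  with h show ?thesis by (simp add: sq_int_def)
qed

text \<open>The gradient of \<open>exp (- r\<^sup>2 / (2 l))\<close> is \<open>- r / l\<close> times
  this function times \<open>grad r\<close>, so the twist annihilates it, and subtracting a multiple
  does not change the completed square.\<close>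

lemma twist_gauss_diff:
  assumes "l \<noteq> 0"
  shows "twist (\<lambda>r. r / l) (\<lambda>x. u x - c * rgauss (- (1 / (2 * l))) (norm x))
      (\<lambda>x. G x - c *\<^sub>R rgauss_grad (- (1 / (2 * l))) x) x = twist (\<lambda>r. r / l) u G x"
proof -
  have coef: "(p - c * g) * (r / l) * k / n - c * (g * (2 * (- (1 / (2 * l))) * r * k) / n) = p * (r / l) * k / n"
    for p g r k n :: real
    using assms by (cases "n = 0") (simp_all add: field_simps)
  have "X - c *\<^sub>R (a *\<^sub>R x) + b *\<^sub>R x = X + (b - c * a) *\<^sub>R x" for X and a b :: real
    by (simp add: scaleR_diff_left)
  then show ?thesis
    unfolding twist_def rgauss_grad_def rgauss'_def by (simp only: coef)
qed

text \<open>The Gaussian is continuously differentiable on the ball and is subtracted from the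
  approximants directly. By \<open>gauss_decay\<close> each of its three weighted densities is
  bounded, and the ball has finite Euclidean measure.\<close>

lemma hyp_pair_gauss_diff:
  fixes u :: "'a::euclidean_space \<Rightarrow> real"
  assumes dim: "2 \<le> DIM('a)" and hp: "hyp_pair u G" and l: "0 < l"
  shows "hyp_pair (\<lambda>x. u x - c * rgauss (- (1 / (2 * l))) (norm x))
      (\<lambda>x. G x - c *\<^sub>R rgauss_grad (- (1 / (2 * l))) x)"
proof -
  define \<sigma> where "\<sigma> = - (1 / (2 * l))"
  let ?N = "DIM('a)"
  define B where "B = 2 ^ ?N * exp ((real ?N + 2)\<^sup>2 * l / 4)"
  have app: "C1_approximable u G" using hp by (simp add: hyp_pair_def)
  have um: "u \<in> borel_measurable ball_measure"
    using C1_approximable_sq_int(1)[OF app] by (simp add: sq_int_def)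
  have Gm: "(\<lambda>x. G x \<bullet> b) \<in> borel_measurable ball_measure" if "b \<in> Basis" for b
    using C1_approximable_sq_int(2)[OF app that] by (simp add: sq_int_def)
  have gm: "(\<lambda>x::'a. rgauss \<sigma> (norm x)) \<in> borel_measurable ball_measure"
    by (rule radial_measurable) measurable
  have hm: "(\<lambda>x::'a. rgauss_grad \<sigma> x \<bullet> b) \<in> borel_measurable ball_measure" for b
    unfolding rgauss_grad_def inner_scaleR_left
    by (intro borel_measurable_times radial_measurable[of "\<lambda>t. rgauss' \<sigma> t / t"] ball_measure_borel_measurable) measurable
  have c1: "1 \<le> conf (norm x) ^ n" if "norm x < 1" for x :: 'a and n
    using conf_ge_2[of "norm x"] that by (intro one_le_power) auto
  have gsq: "(rgauss \<sigma> t)\<^sup>2 = exp (- ((rad t)\<^sup>2 / l))" for t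
    using l by (simp add: rgauss_def \<sigma>_def power2_eq_square exp_add[symmetric] field_simps)
  have decay: "conf (norm x) ^ ?N * ((1 + (rad (norm x))\<^sup>2) * (rgauss \<sigma> (norm x))\<^sup>2) \<le> B"
    if "norm x < 1" for x :: 'a
    unfolding gsq B_def using that l by (intro gauss_decay) auto
  have cN: "0 \<le> conf (norm x) ^ n" if "norm x < 1" for x :: 'a and n
    using c1[OF that, of n] by simp
  have D1: "conf (norm x) ^ ?N * (rgauss \<sigma> (norm x))\<^sup>2 \<le> B" if x: "norm x < 1" for x :: 'a
  proof -
    have "1 * (rgauss \<sigma> (norm x))\<^sup>2 \<le> (1 + (rad (norm x))\<^sup>2) * (rgauss \<sigma> (norm x))\<^sup>2"
      by (intro mult_right_mono) auto
    from order_trans[OF mult_left_mono[OF this cN[OF x, of ?N]] decay[OF x]] show ?thesis by simp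
  qed
  have D2: "conf (norm x) ^ ?N * ((rad (norm x))\<^sup>2 * (rgauss \<sigma> (norm x))\<^sup>2) \<le> B" if x: "norm x < 1" for x :: 'a
  proof -
    have "(rad (norm x))\<^sup>2 * (rgauss \<sigma> (norm x))\<^sup>2 \<le> (1 + (rad (norm x))\<^sup>2) * (rgauss \<sigma> (norm x))\<^sup>2"
      by (intro mult_right_mono) auto
    from mult_left_mono[OF this cN[OF x]] decay[OF x] show ?thesis by (rule order_trans)
  qed
  have grad_eq: "norm (rgauss_grad \<sigma> x) / conf (norm x) = \<bar>rgauss \<sigma> (norm x) * (rad (norm x) / l)\<bar>"
    if x: "norm x < 1" for x :: 'a
  proof (cases "x = 0")
    case True
    then show ?thesis by (simp add: rgauss_grad_def rad_def)
  next
    case False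
    have c: "0 < conf (norm x)" using x by (intro conf_pos) simp
    have "norm (rgauss_grad \<sigma> x) = \<bar>rgauss' \<sigma> (norm x)\<bar>" using False by (simp add: rgauss_grad_def)
    also have "\<dots> = \<bar>rgauss \<sigma> (norm x) * (rad (norm x) / l)\<bar> * conf (norm x)"
      using c l by (simp add: rgauss'_def \<sigma>_def abs_mult)
    finally show ?thesis using c by simp
  qed
  have D3: "conf (norm x) ^ ?N * (norm (rgauss_grad \<sigma> x) / conf (norm x))\<^sup>2 \<le> B / l\<^sup>2" if x: "norm x < 1" for x :: 'a
  proof -
    have "conf (norm x) ^ ?N * (norm (rgauss_grad \<sigma> x) / conf (norm x))\<^sup>2
      = (conf (norm x) ^ ?N * ((rad (norm x))\<^sup>2 * (rgauss \<sigma> (norm x))\<^sup>2)) / l\<^sup>2"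
      unfolding grad_eq[OF x] by (simp add: power_mult_distrib power_divide)
    also have "\<dots> \<le> B / l\<^sup>2" by (intro divide_right_mono D2 x) simp
    finally show ?thesis .
  qed
  have sg: "sq_int ball_measure (\<lambda>x::'a. rgauss \<sigma> (norm x))"
  proof (rule bounded_sq_int[OF gm])
    fix x :: 'a assume x: "norm x < 1"
    show "(rgauss \<sigma> (norm x))\<^sup>2 \<le> B"
      using mult_right_mono[OF c1[OF x, of ?N], of "(rgauss \<sigma> (norm x))\<^sup>2"] D1[OF x] by simp
  qed
  have sh: "sq_int ball_measure (\<lambda>x. rgauss_grad \<sigma> x \<bullet> b)" if b: "b \<in> Basis" for b :: 'a
  proof (rule bounded_sq_int[OF hm])
    fix x :: 'a assume x: "norm x < 1"
    have c: "0 < conf (norm x)" using x by (intro conf_pos) simp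
    obtain m where N: "?N = m + 2" using dim by (metis add.commute le_Suc_ex)
    have "\<bar>rgauss_grad \<sigma> x \<bullet> b\<bar>\<^sup>2 \<le> (norm (rgauss_grad \<sigma> x))\<^sup>2"
      by (intro power_mono Basis_le_norm b) simp
    also have "\<dots> \<le> conf (norm x) ^ m * (norm (rgauss_grad \<sigma> x))\<^sup>2"
      using mult_right_mono[OF c1[OF x, of m], of "(norm (rgauss_grad \<sigma> x))\<^sup>2"] by simp
    also have "\<dots> = conf (norm x) ^ ?N * (norm (rgauss_grad \<sigma> x) / conf (norm x))\<^sup>2"
      using c by (simp add: N power_divide power2_eq_square)
    also have "\<dots> \<le> B / l\<^sup>2" by (rule D3[OF x])
    finally show "(rgauss_grad \<sigma> x \<bullet> b)\<^sup>2 \<le> B / l\<^sup>2" by simp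
  qed
  have dg: "((\<lambda>x::'a. rgauss \<sigma> (norm x)) has_derivative (\<lambda>h. rgauss_grad \<sigma> x \<bullet> h)) (at x)" if "norm x < 1" for x
    unfolding rgauss_grad_def using that
    by (intro radial_has_derivative rgauss_has_derivative rgauss'_0) simp
  have g_cont: "continuous_on (ball 0 1) (rgauss_grad \<sigma> :: 'a \<Rightarrow> 'a)"
    unfolding rgauss_grad_def[abs_def] by (rule radial_gradient_continuous[OF rgauss'_continuous rgauss'_0])
  have A: "C1_approximable (\<lambda>x. u x - c * rgauss \<sigma> (norm x)) (\<lambda>x. G x - c *\<^sub>R rgauss_grad \<sigma> x)"
    unfolding C1_approximable_def
  proof (intro allI impI)
    fix s :: real assume s: "s < 1"
    then obtain U V where UV: "\<And>n x. norm x < s \<Longrightarrow> (U n has_derivative (\<lambda>h. V n x \<bullet> h)) (at x)"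
      "\<And>n. continuous_on (ball 0 s) (V n)" "L2_lim ball_measure U u"
      "\<And>b. b \<in> Basis \<Longrightarrow> L2_lim ball_measure (\<lambda>n x. V n x \<bullet> b) (\<lambda>x. G x \<bullet> b)"
      using app unfolding C1_approximable_def by blast
    let ?U = "\<lambda>n x. U n x - c * rgauss \<sigma> (norm x)"
    let ?V = "\<lambda>n x. V n x - c *\<^sub>R rgauss_grad \<sigma> x"
    have "(?U n has_derivative (\<lambda>h. ?V n x \<bullet> h)) (at x)" if "norm x < s" for n x
      using has_derivative_diff[OF UV(1)[OF that, of n] has_derivative_mult_right[OF dg, of x c]] that s
      by (simp add: inner_diff_left)
    moreover have "continuous_on (ball 0 s) (?V n)" for n
      by (intro continuous_intros UV(2) continuous_on_subset[OF g_cont]) (use s in auto)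
    moreover have "L2_lim ball_measure ?U (\<lambda>x. u x - c * rgauss \<sigma> (norm x))"
      using L2_lim_add[OF UV(3) L2_lim_const[OF sq_int_cmult[OF sg, of "- c"]]] by simp
    moreover have "L2_lim ball_measure (\<lambda>n x. ?V n x \<bullet> b) (\<lambda>x. (G x - c *\<^sub>R rgauss_grad \<sigma> x) \<bullet> b)" if b: "b \<in> Basis" for b
      using L2_lim_add[OF UV(4)[OF b] L2_lim_const[OF sq_int_cmult[OF sh[OF b], of "- c"]]]
      by (simp add: inner_diff_left)
    ultimately show "\<exists>U V. (\<forall>n x. norm x < s \<longrightarrow> (U n has_derivative (\<bullet>) (V n x)) (at x)) \<and>
      (\<forall>n. continuous_on (ball 0 s) (V n)) \<and> L2_lim ball_measure U (\<lambda>x. u x - c * rgauss \<sigma> (norm x)) \<and>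
      (\<forall>b\<in>Basis. L2_lim ball_measure (\<lambda>n x. V n x \<bullet> b) (\<lambda>x. (G x - c *\<^sub>R rgauss_grad \<sigma> x) \<bullet> b))"
      by (intro exI[of _ ?U] exI[of _ ?V]) blast
  qed
  have sq2: "(a - b)\<^sup>2 \<le> 2 * a\<^sup>2 + 2 * b\<^sup>2" for a b :: real
    using zero_le_power2[of "a + b"] by (simp add: power2_diff power2_sum)
  have const: "integrable (ball_measure :: 'a measure) (\<lambda>x. k)" for k :: real
    using finite_measure.integrable_const[OF finite_ball_measure] .
  have rm: "(\<lambda>x::'a. conf (norm x) ^ ?N) \<in> borel_measurable ball_measure"
    "(\<lambda>x::'a. (rad (norm x))\<^sup>2) \<in> borel_measurable ball_measure"
    "(\<lambda>x::'a. conf (norm x)) \<in> borel_measurable ball_measure"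
    by (intro radial_measurable[of "\<lambda>t. conf t ^ ?N"] radial_measurable[of "\<lambda>t. (rad t)\<^sup>2"] radial_measurable[of conf]; measurable)+
  have wm: "(\<lambda>x. (u x - c * rgauss \<sigma> (norm x))\<^sup>2) \<in> borel_measurable ball_measure"
    by (intro borel_measurable_power borel_measurable_diff borel_measurable_times um gm) simp
  have "integrable ball_measure (\<lambda>x. conf (norm x) ^ ?N * (u x - c * rgauss \<sigma> (norm x))\<^sup>2)"
  proof (rule integrable_ball_measure_bound)
    show "integrable ball_measure (\<lambda>x. 2 * (conf (norm x) ^ ?N * (u x)\<^sup>2) + 2 * c\<^sup>2 * B)"
      using hp const by (simp add: hyp_pair_def)
    fix x :: 'a assume x: "norm x < 1"
    have "conf (norm x) ^ ?N * (u x - c * rgauss \<sigma> (norm x))\<^sup>2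
      \<le> conf (norm x) ^ ?N * (2 * (u x)\<^sup>2 + 2 * (c * rgauss \<sigma> (norm x))\<^sup>2)"
      by (intro mult_left_mono sq2 cN x)
    also have "\<dots> = 2 * (conf (norm x) ^ ?N * (u x)\<^sup>2) + 2 * c\<^sup>2 * (conf (norm x) ^ ?N * (rgauss \<sigma> (norm x))\<^sup>2)"
      by (simp add: power_mult_distrib algebra_simps)
    also have "\<dots> \<le> 2 * (conf (norm x) ^ ?N * (u x)\<^sup>2) + 2 * c\<^sup>2 * B"
      by (intro add_left_mono mult_left_mono D1 x) simp
    finally show "\<bar>conf (norm x) ^ ?N * (u x - c * rgauss \<sigma> (norm x))\<^sup>2\<bar> \<le> 2 * (conf (norm x) ^ ?N * (u x)\<^sup>2) + 2 * c\<^sup>2 * B"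
      using cN[OF x] by simp
  qed (intro borel_measurable_times rm wm)
  moreover have "integrable ball_measure (\<lambda>x. conf (norm x) ^ ?N * ((rad (norm x))\<^sup>2 * (u x - c * rgauss \<sigma> (norm x))\<^sup>2))"
  proof (rule integrable_ball_measure_bound)
    show "integrable ball_measure (\<lambda>x. 2 * (conf (norm x) ^ ?N * ((rad (norm x))\<^sup>2 * (u x)\<^sup>2)) + 2 * c\<^sup>2 * B)"
      using hp const by (simp add: hyp_pair_def)
    fix x :: 'a assume x: "norm x < 1"
    have "conf (norm x) ^ ?N * ((rad (norm x))\<^sup>2 * (u x - c * rgauss \<sigma> (norm x))\<^sup>2)
      \<le> conf (norm x) ^ ?N * ((rad (norm x))\<^sup>2 * (2 * (u x)\<^sup>2 + 2 * (c * rgauss \<sigma> (norm x))\<^sup>2))"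
      by (intro mult_left_mono sq2 cN x) simp
    also have "\<dots> = 2 * (conf (norm x) ^ ?N * ((rad (norm x))\<^sup>2 * (u x)\<^sup>2))
        + 2 * c\<^sup>2 * (conf (norm x) ^ ?N * ((rad (norm x))\<^sup>2 * (rgauss \<sigma> (norm x))\<^sup>2))"
      by (simp add: power_mult_distrib algebra_simps)
    also have "\<dots> \<le> 2 * (conf (norm x) ^ ?N * ((rad (norm x))\<^sup>2 * (u x)\<^sup>2)) + 2 * c\<^sup>2 * B"
      by (intro add_left_mono mult_left_mono D2 x) simp
    finally show "\<bar>conf (norm x) ^ ?N * ((rad (norm x))\<^sup>2 * (u x - c * rgauss \<sigma> (norm x))\<^sup>2)\<bar>
        \<le> 2 * (conf (norm x) ^ ?N * ((rad (norm x))\<^sup>2 * (u x)\<^sup>2)) + 2 * c\<^sup>2 * B"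
      using cN[OF x] by simp
  qed (intro borel_measurable_times rm wm)
  moreover have "integrable ball_measure (\<lambda>x. conf (norm x) ^ ?N * (norm (G x - c *\<^sub>R rgauss_grad \<sigma> x) / conf (norm x))\<^sup>2)"
  proof (rule integrable_ball_measure_bound)
    show "integrable ball_measure (\<lambda>x. 2 * (conf (norm x) ^ ?N * (norm (G x) / conf (norm x))\<^sup>2) + 2 * c\<^sup>2 * (B / l\<^sup>2))"
      using hp const by (simp add: hyp_pair_def)
    have "(\<lambda>x. (G x - c *\<^sub>R rgauss_grad \<sigma> x) \<bullet> b) \<in> borel_measurable ball_measure" if "b \<in> Basis" for b
      unfolding inner_diff_left inner_scaleR_left
      by (intro borel_measurable_diff borel_measurable_times Gm hm that) simp
    from norm_measurable_ball[OF this]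
    show "(\<lambda>x. conf (norm x) ^ ?N * (norm (G x - c *\<^sub>R rgauss_grad \<sigma> x) / conf (norm x))\<^sup>2) \<in> borel_measurable ball_measure"
      by (intro borel_measurable_times borel_measurable_power borel_measurable_divide rm)
    fix x :: 'a assume x: "norm x < 1"
    let ?k = "conf (norm x)"
    have k: "0 < ?k" using x by (intro conf_pos) simp
    have "norm (G x - c *\<^sub>R rgauss_grad \<sigma> x) / ?k \<le> norm (G x) / ?k + \<bar>c\<bar> * (norm (rgauss_grad \<sigma> x) / ?k)"
      using norm_triangle_ineq4[of "G x" "c *\<^sub>R rgauss_grad \<sigma> x"] k
      by (simp add: add_divide_distrib[symmetric] divide_right_mono)
    then have "(norm (G x - c *\<^sub>R rgauss_grad \<sigma> x) / ?k)\<^sup>2 \<le> (norm (G x) / ?k + \<bar>c\<bar> * (norm (rgauss_grad \<sigma> x) / ?k))\<^sup>2"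
      using k by (intro power_mono) auto
    also have "\<dots> \<le> 2 * (norm (G x) / ?k)\<^sup>2 + 2 * (\<bar>c\<bar> * (norm (rgauss_grad \<sigma> x) / ?k))\<^sup>2"
      using sq2[of "norm (G x) / ?k" "- (\<bar>c\<bar> * (norm (rgauss_grad \<sigma> x) / ?k))"] by simp
    finally have "?k ^ ?N * (norm (G x - c *\<^sub>R rgauss_grad \<sigma> x) / ?k)\<^sup>2
        \<le> ?k ^ ?N * (2 * (norm (G x) / ?k)\<^sup>2 + 2 * (\<bar>c\<bar> * (norm (rgauss_grad \<sigma> x) / ?k))\<^sup>2)"
      by (rule mult_left_mono[OF _ cN[OF x]])
    also have "\<dots> = 2 * (?k ^ ?N * (norm (G x) / ?k)\<^sup>2) + 2 * c\<^sup>2 * (?k ^ ?N * (norm (rgauss_grad \<sigma> x) / ?k)\<^sup>2)"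
      unfolding power_mult_distrib power2_abs by (simp only: distrib_left mult_ac)
    also have "\<dots> \<le> 2 * (?k ^ ?N * (norm (G x) / ?k)\<^sup>2) + 2 * c\<^sup>2 * (B / l\<^sup>2)"
      by (intro add_left_mono mult_left_mono D3 x) simp
    finally show "\<bar>?k ^ ?N * (norm (G x - c *\<^sub>R rgauss_grad \<sigma> x) / ?k)\<^sup>2\<bar>
      \<le> 2 * (?k ^ ?N * (norm (G x) / ?k)\<^sup>2) + 2 * c\<^sup>2 * (B / l\<^sup>2)"
      using cN[OF x] by simp
  qed
  ultimately show ?thesis using A by (simp add: hyp_pair_def \<sigma>_def)
qed

text \<open>Substitute \<open>radial_part H = \<tau> - w r / l\<close> in the identity for
  \<open>M = r\<close>. This yields \<open>- 2 w\<^sup>2 r\<^sup>2 / l\<close>, of which half pays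
  for the cross term with \<tau> and a quarter for the growth of the Laplacian, leaving the
  coefficient \<open>3 N / 2 - r\<^sup>2 / (2 l)\<close>. From \<open>r\<^sup>2 = 6 N l\<close> on
  it is at most \<open>- 3 N / 2\<close>; inside, the indicator term makes up the
  difference.\<close>

lemma lyapunov:
  fixes w :: "'a::euclidean_space \<Rightarrow> real"
  assumes dim: "2 \<le> DIM('a)" and hp: "hyp_pair w H" and l: "0 < l" "real DIM('a) * l \<le> 1"
  defines "s \<equiv> unrad (sqrt (6 * real DIM('a) * l))"
  defines "i \<equiv> indicator (ball 0 s) :: 'a \<Rightarrow> real"
  shows "integrable ball_measure (\<lambda>x. i x * (conf (norm x) ^ DIM('a) * (w x)\<^sup>2))"
    "3 / 2 * real DIM('a) * (\<integral>x. conf (norm x) ^ DIM('a) * (w x)\<^sup>2 \<partial>ball_measure)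
      \<le> 3 * real DIM('a) * (\<integral>x. i x * (conf (norm x) ^ DIM('a) * (w x)\<^sup>2) \<partial>ball_measure)
        + l * (\<integral>x. grad_sq (twist (\<lambda>r. r / l) w H) x \<partial>ball_measure)"
proof -
  let ?N = "DIM('a)"
  let ?T = "twist (\<lambda>r. r / l) w H"
  have wint: "integrable ball_measure (\<lambda>x. conf (norm x) ^ ?N * (w x)\<^sup>2)"
    using hp by (simp add: hyp_pair_def)
  have im: "i \<in> borel_measurable ball_measure"
    unfolding i_def by (intro ball_measure_borel_measurable borel_measurable_indicator) simp
  show iint: "integrable ball_measure (\<lambda>x. i x * (conf (norm x) ^ ?N * (w x)\<^sup>2))"
  proof (rule integrable_ball_measure_bound[OF wint])
    show "(\<lambda>x. i x * (conf (norm x) ^ ?N * (w x)\<^sup>2)) \<in> borel_measurable ball_measure"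
      by (intro borel_measurable_times[OF im] borel_measurable_integrable[OF wint])
    fix x :: 'a assume "norm x < 1"
    then show "\<bar>i x * (conf (norm x) ^ ?N * (w x)\<^sup>2)\<bar> \<le> conf (norm x) ^ ?N * (w x)\<^sup>2"
      using conf_pos[of "norm x"] by (auto simp: i_def indicator_def)
  qed
  note ibp = hyp_ibp_identity[OF dim hp]
  have id_int: "integrable ball_measure (\<lambda>x. conf (norm x) ^ ?N * (w x * radial_part H x * rad (norm x)))"
    by (rule twist_energy(1)[OF hp, where w = "\<lambda>r. r" and C = 1]) auto
  have Tint: "integrable ball_measure (grad_sq ?T)"
    by (rule twist_energy(3)[OF hp, where C = "1 / l"]) (use l in auto)
  let ?I1 = "\<lambda>x. conf (norm x) ^ ?N * ((w x)\<^sup>2 *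
      (1 + (real ?N - 1) * (rad (norm x) * (cosh (rad (norm x)) / sinh (rad (norm x))))))"
  let ?I2 = "\<lambda>x. conf (norm x) ^ ?N * (w x * radial_part H x * rad (norm x))"
  let ?R = "\<lambda>x. 3 * real ?N * (i x * (conf (norm x) ^ ?N * (w x)\<^sup>2))
      - 3 / 2 * real ?N * (conf (norm x) ^ ?N * (w x)\<^sup>2) + l * grad_sq ?T x"
  have "0 = (\<integral>x. ?I1 x + 2 * ?I2 x \<partial>ball_measure)"
    using ibp id_int by simp
  also have "\<dots> \<le> (\<integral>x. ?R x \<partial>ball_measure)"
  proof (rule integral_mono_AE)
    show "AE x in ball_measure. ?I1 x + 2 * ?I2 x \<le> ?R x"
      using AE_ball_measure_nonzero
    proof eventually_elim
      fix x :: 'a assume "x \<noteq> 0 \<and> norm x < 1"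
      then have x: "x \<noteq> 0" "norm x < 1" by auto
      define r c h \<tau> y where "r = rad (norm x)" and "c = conf (norm x) ^ ?N" and "h = r * (cosh r / sinh r)"
        and "\<tau> = radial_part ?T x" and "y = w x"
      have r: "0 < r" using x by (simp add: r_def rad_pos)
      have c: "0 \<le> c" using conf_pos[of "norm x"] x by (simp add: c_def)
      have \<tau>: "radial_part H x = \<tau> - y * (r / l)"
        unfolding \<tau>_def r_def y_def by (subst radial_part_twist[OF x]) simp
      have T: "c * \<tau>\<^sup>2 \<le> grad_sq ?T x"
      proof -
        have "\<bar>\<tau>\<bar>\<^sup>2 \<le> (norm (?T x) / conf (norm x))\<^sup>2"
          unfolding \<tau>_def by (intro power_mono radial_part_le x) simp
        then show ?thesis using c by (simp add: grad_sq_def c_def mult_left_mono)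
      qed
      \<comment> \<open>From \<open>r coth r \<le> 1 + r \<le> 3/2 + r\<^sup>2/2\<close>; the
        quadratic part acquires the factor \<open>N - 1\<close>, which \<open>N l \<le> 1\<close>
        turns into at most \<open>1 / l\<close>.\<close>
      have h: "1 + (real ?N - 1) * h \<le> 3 / 2 * real ?N + r\<^sup>2 / (2 * l)"
      proof -
        have "0 \<le> (r - 1)\<^sup>2" by simp
        then have "1 + r \<le> 3 / 2 + r\<^sup>2 / 2" unfolding power2_diff by simp
        then have "h \<le> 3 / 2 + r\<^sup>2 / 2" using r_coth_le[OF r] unfolding h_def by linarith
        then have "(real ?N - 1) * h \<le> (real ?N - 1) * (3 / 2 + r\<^sup>2 / 2)"
          using dim by (intro mult_left_mono) auto
        moreover have "(real ?N - 1) * r\<^sup>2 \<le> r\<^sup>2 / l"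
        proof -
          have "(real ?N - 1) * l \<le> 1" using l by (simp add: algebra_simps)
          then have "(real ?N - 1) * l * r\<^sup>2 \<le> 1 * r\<^sup>2" by (rule mult_right_mono) simp
          then show ?thesis using l by (simp add: pos_le_divide_eq mult_ac)
        qed
        moreover have "(real ?N - 1) * (3 / 2 + r\<^sup>2 / 2) = 3 / 2 * real ?N - 3 / 2 + (real ?N - 1) * r\<^sup>2 / 2"
          by (simp add: field_simps)
        moreover have "r\<^sup>2 / (2 * l) = r\<^sup>2 / l / 2" by simp
        ultimately show ?thesis by linarith
      qed
      have cross: "2 * (y * \<tau> * r) \<le> y\<^sup>2 * (r\<^sup>2 / l) + l * \<tau>\<^sup>2"
      proof -
        have "0 \<le> (y * r - l * \<tau>)\<^sup>2 / l" using l by simp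
        also have "(y * r - l * \<tau>)\<^sup>2 / l = y\<^sup>2 * (r\<^sup>2 / l) + l * \<tau>\<^sup>2 - 2 * (y * \<tau> * r)"
          using l by (simp add: power2_eq_square field_simps)
        finally show ?thesis by simp
      qed
      have "y\<^sup>2 * (1 + (real ?N - 1) * h) + 2 * (y * (\<tau> - y * (r / l)) * r)
        = y\<^sup>2 * (1 + (real ?N - 1) * h) + 2 * (y * \<tau> * r) - 2 * (y\<^sup>2 * (r\<^sup>2 / l))"
        by (simp add: power2_eq_square algebra_simps)
      also have "\<dots> \<le> y\<^sup>2 * (3 / 2 * real ?N + r\<^sup>2 / (2 * l)) - y\<^sup>2 * (r\<^sup>2 / l) + l * \<tau>\<^sup>2"
        using mult_left_mono[OF h, of "y\<^sup>2"] cross by simp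
      also have "\<dots> = y\<^sup>2 * (3 / 2 * real ?N - r\<^sup>2 / (2 * l)) + l * \<tau>\<^sup>2"
        by (simp add: algebra_simps)
      also have "\<dots> \<le> y\<^sup>2 * (3 * real ?N * i x - 3 / 2 * real ?N) + l * \<tau>\<^sup>2"
      proof (intro add_right_mono mult_left_mono)
        show "3 / 2 * real ?N - r\<^sup>2 / (2 * l) \<le> 3 * real ?N * i x - 3 / 2 * real ?N"
        proof (cases "norm x < s")
          case True
          have "0 \<le> r\<^sup>2 / (2 * l)" using l by simp
          then show ?thesis using True by (simp add: i_def)
        next
          case False
          then have "sqrt (6 * real ?N * l) \<le> r"
            unfolding r_def s_def using x by (subst le_rad_iff) auto
          then have "(sqrt (6 * real ?N * l))\<^sup>2 \<le> r\<^sup>2" using l by (intro power_mono) auto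
          then have "6 * real ?N * l \<le> r\<^sup>2" using l by simp
          then have "3 * real ?N \<le> r\<^sup>2 / (2 * l)" using l by (simp add: pos_le_divide_eq)
          then show ?thesis using False by (simp add: i_def)
        qed
      qed simp
      finally have "c * (y\<^sup>2 * (1 + (real ?N - 1) * h) + 2 * (y * (\<tau> - y * (r / l)) * r))
        \<le> c * (y\<^sup>2 * (3 * real ?N * i x - 3 / 2 * real ?N) + l * \<tau>\<^sup>2)"
        by (rule mult_left_mono[OF _ c])
      moreover have "?I1 x + 2 * ?I2 x = c * (y\<^sup>2 * (1 + (real ?N - 1) * h) + 2 * (y * (\<tau> - y * (r / l)) * r))"
        unfolding r_def[symmetric] c_def[symmetric] h_def[symmetric] \<tau> y_def[symmetric]
        by (simp add: distrib_left mult.left_commute)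
      moreover have "c * (y\<^sup>2 * (3 * real ?N * i x - 3 / 2 * real ?N) + l * \<tau>\<^sup>2)
        = 3 * real ?N * (i x * (c * y\<^sup>2)) - 3 / 2 * real ?N * (c * y\<^sup>2) + l * (c * \<tau>\<^sup>2)"
        by (simp add: algebra_simps)
      moreover have "l * (c * \<tau>\<^sup>2) \<le> l * grad_sq ?T x" using T l by simp
      ultimately show "?I1 x + 2 * ?I2 x \<le> ?R x"
        unfolding c_def y_def by linarith
    qed
  qed (use ibp(1) id_int iint wint Tint in simp_all)
  also have "\<dots> = 3 * real ?N * (\<integral>x. i x * (conf (norm x) ^ ?N * (w x)\<^sup>2) \<partial>ball_measure)
      - 3 / 2 * real ?N * (\<integral>x. conf (norm x) ^ ?N * (w x)\<^sup>2 \<partial>ball_measure) + l * (\<integral>x. grad_sq ?T x \<partial>ball_measure)"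
    using iint wint Tint by simp
  finally show "3 / 2 * real ?N * (\<integral>x. conf (norm x) ^ ?N * (w x)\<^sup>2 \<partial>ball_measure)
      \<le> 3 * real ?N * (\<integral>x. i x * (conf (norm x) ^ ?N * (w x)\<^sup>2) \<partial>ball_measure)
        + l * (\<integral>x. grad_sq ?T x \<partial>ball_measure)" by linarith
qed

text \<open>On the small ball, \<open>6 ^ N\<close> bounds the density and
  \<open>exp (6 * N)\<close> the squared inverse Gaussian; \<open>2 ^ (N + 1)\<close> comes from the
  Poincare inequality and \<open>6 * N\<close> from the squared radius. The outer 2 and 1 come from
  \<open>lyapunov\<close> after division by \<open>3 N / 2\<close>.\<close>

definition gauss_const :: "nat \<Rightarrow> real" where
  "gauss_const N = 2 * (6 ^ N * (2 ^ (N + 1) * (6 * real N) * exp (6 * real N))) + 1"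

lemma gauss_const_pos: "0 < gauss_const N"
  by (simp add: gauss_const_def add_nonneg_pos)

text \<open>The coefficient is the one that \<open>poincare_weak\<close> provides for
  \<open>u exp (r\<^sup>2 / (2 l))\<close>, whose gradient is \<open>exp (r\<^sup>2 / (2 l))\<close>
  times the twisted gradient. Applied to the difference from the corresponding Gaussian,
  \<open>lyapunov\<close> extends the estimate from the small ball to the whole space.\<close>

lemma gauss_distance:
  fixes u :: "'a::euclidean_space \<Rightarrow> real"
  assumes dim: "2 \<le> DIM('a)" and hp: "hyp_pair u G" and l: "0 < l" "6 * real DIM('a) * l \<le> 1"
  obtains c where "integrable ball_measure (\<lambda>x. conf (norm x) ^ DIM('a) * (u x - c * rgauss (- (1 / (2 * l))) (norm x))\<^sup>2)"
    "(\<integral>x. conf (norm x) ^ DIM('a) * (u x - c * rgauss (- (1 / (2 * l))) (norm x))\<^sup>2 \<partial>ball_measure)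
      \<le> gauss_const DIM('a) * l * (\<integral>x. grad_sq (twist (\<lambda>r. r / l) u G) x \<partial>ball_measure)"
proof -
  let ?N = "DIM('a)"
  define \<sigma> where "\<sigma> = 1 / (2 * l)"
  define T where "T = twist (\<lambda>r. r / l) u G"
  define r0 s where "r0 = sqrt (6 * real ?N * l)" and "s = unrad r0"
  have N0: "0 < real ?N" using dim by simp
  have r0: "0 < r0" "r0 \<le> 1" "r0\<^sup>2 = 6 * real ?N * l" using l N0 by (auto simp: r0_def)
  have s: "0 < s" "s < 1" "s \<le> r0"
    using r0 by (simp_all add: s_def unrad_bounds unrad_le_self)
  define i where "i = (indicator (ball 0 s) :: 'a \<Rightarrow> real)"
  have app: "C1_approximable u G" using hp by (simp add: hyp_pair_def)
  have W: "rgauss \<sigma> (norm x) *\<^sub>R G x + u x *\<^sub>R ((rgauss' \<sigma> (norm x) / norm x) *\<^sub>R x)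
      = rgauss \<sigma> (norm x) *\<^sub>R T x" for x
  proof -
    have "u x * (rgauss' \<sigma> (norm x) / norm x) = rgauss \<sigma> (norm x) * (u x * (rad (norm x) / l) * conf (norm x) / norm x)"
      using l by (simp add: rgauss'_def \<sigma>_def)
    then show ?thesis by (simp add: T_def twist_def scaleR_add_right)
  qed
  let ?W = "\<lambda>x. rgauss \<sigma> (norm x) *\<^sub>R G x + u x *\<^sub>R ((rgauss' \<sigma> (norm x) / norm x) *\<^sub>R x)"
  obtain c where c: "integrable ball_measure (\<lambda>x. i x * (rgauss \<sigma> (norm x) * u x - c)\<^sup>2)"
    "integrable ball_measure (\<lambda>x. i x * (norm (?W x))\<^sup>2)"
    "(\<integral>x. i x * (rgauss \<sigma> (norm x) * u x - c)\<^sup>2 \<partial>ball_measure)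
      \<le> 2 ^ (?N + 1) * s\<^sup>2 * (\<integral>x. i x * (norm (?W x))\<^sup>2 \<partial>ball_measure)"
    unfolding i_def
    by (rule poincare_weak[OF app rgauss_has_derivative[of _ \<sigma>] rgauss'_0 rgauss'_continuous s(1,2)])
  note c = c[unfolded W]
  define w where "w x = u x - c * rgauss (- \<sigma>) (norm x)" for x
  define H where "H x = G x - c *\<^sub>R rgauss_grad (- \<sigma>) x" for x
  have hpw: "hyp_pair w H"
    using hyp_pair_gauss_diff[OF dim hp l(1), of c] by (simp add: w_def[abs_def] H_def[abs_def] \<sigma>_def)
  have Tw: "twist (\<lambda>r. r / l) w H = T"
    using twist_gauss_diff[of l u c G] l
    by (simp add: T_def w_def[abs_def] H_def[abs_def] \<sigma>_def fun_eq_iff)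
  have "real ?N * l \<le> 1" using l mult_nonneg_nonneg[of "real ?N" l] by simp
  note ly = lyapunov[OF dim hpw l(1) this, folded r0_def, folded s_def, folded i_def, unfolded Tw]
  have Tint: "integrable ball_measure (grad_sq T)"
    unfolding T_def by (rule twist_energy(3)[OF hp, where C = "1 / l"]) (use l in auto)
  have inside: "rad (norm x) \<le> r0" if "norm x < s" for x :: 'a
    using that s by (subst rad_le_iff) (auto simp: s_def)
  have e1: "exp (1::real) \<le> 3" using exp_le by simp
  have b1: "i x * (conf (norm x) ^ ?N * (w x)\<^sup>2) \<le> 6 ^ ?N * (i x * (rgauss \<sigma> (norm x) * u x - c)\<^sup>2)"
    if x: "norm x < 1" for x
  proof (cases "norm x < s")
    case True
    define g where "g = rgauss (- \<sigma>) (norm x)"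
    have g: "0 \<le> g" "g \<le> 1" "g * rgauss \<sigma> (norm x) = 1"
    proof -
      have "0 \<le> \<sigma> * (rad (norm x))\<^sup>2" using l by (simp add: \<sigma>_def)
      then show "0 \<le> g" "g \<le> 1"
        by (simp_all add: g_def rgauss_def)
      show "g * rgauss \<sigma> (norm x) = 1"
        by (simp add: g_def rgauss_def exp_minus)
    qed
    have cf: "0 < conf (norm x)" using x by (intro conf_pos) simp
    \<comment> \<open>The hyperbolic radius is at most 1 here, so the conformal factor is at most
      \<open>2 * exp 1\<close>, hence at most 6.\<close>
    have "conf (norm x) \<le> 2 * exp (rad (norm x))" using x by (intro conf_le_exp_rad) auto
    also have "\<dots> \<le> 2 * exp 1" using inside[OF True] r0 by simp
    finally have "conf (norm x) \<le> 6" using e1 by linarith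
    then have cN: "conf (norm x) ^ ?N \<le> 6 ^ ?N" using cf by (intro power_mono) auto
    have "w x = g * (rgauss \<sigma> (norm x) * u x - c)"
    proof -
      have "g * (rgauss \<sigma> (norm x) * u x - c) = (g * rgauss \<sigma> (norm x)) * u x - c * g"
        by (simp add: right_diff_distrib)
      then show ?thesis unfolding g(3) by (simp add: w_def g_def)
    qed
    then have "(w x)\<^sup>2 = g\<^sup>2 * (rgauss \<sigma> (norm x) * u x - c)\<^sup>2" by (simp add: power_mult_distrib)
    also have "\<dots> \<le> 1 * (rgauss \<sigma> (norm x) * u x - c)\<^sup>2"
      using g by (intro mult_right_mono power_le_one) auto
    finally have "conf (norm x) ^ ?N * (w x)\<^sup>2 \<le> 6 ^ ?N * (rgauss \<sigma> (norm x) * u x - c)\<^sup>2"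
      using cN by (intro mult_mono) auto
    then show ?thesis using True by (simp add: i_def)
  next
    case False
    then show ?thesis by (simp add: i_def)
  qed
  have b2: "i x * (norm (rgauss \<sigma> (norm x) *\<^sub>R T x))\<^sup>2 \<le> exp (6 * real ?N) * grad_sq T x"
    if x: "norm x < 1" for x
  proof (cases "norm x < s")
    case True
    have cf: "0 < conf (norm x)" "1 \<le> conf (norm x)" using x conf_ge_2[of "norm x"] by (auto intro: conf_pos)
    obtain m where N: "?N = m + 2" using dim by (metis add.commute le_Suc_ex)
    have "(norm (T x))\<^sup>2 \<le> conf (norm x) ^ m * (norm (T x))\<^sup>2"
      using mult_right_mono[OF one_le_power[OF cf(2), of m], of "(norm (T x))\<^sup>2"] by simp
    also have "\<dots> = grad_sq T x"
      using cf by (simp add: grad_sq_def N power_divide power2_eq_square)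
    finally have 1: "(norm (T x))\<^sup>2 \<le> grad_sq T x" .
    have "(rad (norm x))\<^sup>2 \<le> r0\<^sup>2"
      using inside[OF True] x by (intro power_mono rad_nonneg) auto
    then have "(rad (norm x))\<^sup>2 / l \<le> 6 * real ?N" using l r0 by (simp add: pos_divide_le_eq)
    moreover have "(rgauss \<sigma> (norm x))\<^sup>2 = exp ((rad (norm x))\<^sup>2 / l)"
      using l by (simp add: rgauss_def \<sigma>_def power2_eq_square exp_add[symmetric] field_simps)
    ultimately have 2: "(rgauss \<sigma> (norm x))\<^sup>2 \<le> exp (6 * real ?N)" by simp
    have "(norm (rgauss \<sigma> (norm x) *\<^sub>R T x))\<^sup>2 = (rgauss \<sigma> (norm x))\<^sup>2 * (norm (T x))\<^sup>2"
      by (simp add: power_mult_distrib)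
    also have "\<dots> \<le> exp (6 * real ?N) * grad_sq T x" using 1 2 by (intro mult_mono) auto
    finally show ?thesis using True by (simp add: i_def)
  next
    case False
    have "0 \<le> conf (norm x)" using x by (intro less_imp_le[OF conf_pos]) simp
    then show ?thesis using False by (simp add: i_def grad_sq_def)
  qed
  define E where "E = (\<integral>x. grad_sq T x \<partial>ball_measure)"
  have ae: "AE x in (ball_measure :: 'a measure). norm x < 1"
    using AE_ball_measure_nonzero by eventually_elim simp
  have E0: "0 \<le> E"
  proof -
    have "AE x in ball_measure. 0 \<le> grad_sq T x"
      using ae by eventually_elim (simp add: grad_sq_def less_imp_le[OF conf_pos])
    then show ?thesis unfolding E_def by (rule integral_nonneg_AE)
  qed
  have "(\<integral>x. i x * (conf (norm x) ^ ?N * (w x)\<^sup>2) \<partial>ball_measure)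
      \<le> (\<integral>x. 6 ^ ?N * (i x * (rgauss \<sigma> (norm x) * u x - c)\<^sup>2) \<partial>ball_measure)"
  proof (rule integral_mono_AE)
    show "AE x in ball_measure. i x * (conf (norm x) ^ ?N * (w x)\<^sup>2) \<le> 6 ^ ?N * (i x * (rgauss \<sigma> (norm x) * u x - c)\<^sup>2)"
      using ae by eventually_elim (rule b1)
  qed (use ly(1) c(1) in simp_all)
  also have "\<dots> = 6 ^ ?N * (\<integral>x. i x * (rgauss \<sigma> (norm x) * u x - c)\<^sup>2 \<partial>ball_measure)" by simp
  also have "\<dots> \<le> 6 ^ ?N * (2 ^ (?N + 1) * s\<^sup>2 * (\<integral>x. i x * (norm (rgauss \<sigma> (norm x) *\<^sub>R T x))\<^sup>2 \<partial>ball_measure))"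
    by (intro mult_left_mono c(3)) simp
  also have "\<dots> \<le> 6 ^ ?N * (2 ^ (?N + 1) * (6 * real ?N * l) * (exp (6 * real ?N) * E))"
  proof (intro mult_left_mono mult_mono)
    show "s\<^sup>2 \<le> 6 * real ?N * l" unfolding r0(3)[symmetric] using s by (intro power_mono) auto
    have "(\<integral>x. i x * (norm (rgauss \<sigma> (norm x) *\<^sub>R T x))\<^sup>2 \<partial>ball_measure) \<le> (\<integral>x. exp (6 * real ?N) * grad_sq T x \<partial>ball_measure)"
    proof (rule integral_mono_AE)
      show "AE x in ball_measure. i x * (norm (rgauss \<sigma> (norm x) *\<^sub>R T x))\<^sup>2 \<le> exp (6 * real ?N) * grad_sq T x"
        using ae by eventually_elim (rule b2)
      show "integrable ball_measure (\<lambda>x. exp (6 * real ?N) * grad_sq T x)" using Tint by simp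
    qed (rule c(2))
    then show "(\<integral>x. i x * (norm (rgauss \<sigma> (norm x) *\<^sub>R T x))\<^sup>2 \<partial>ball_measure) \<le> exp (6 * real ?N) * E"
      by (simp add: E_def)
    show "0 \<le> (\<integral>x. i x * (norm (rgauss \<sigma> (norm x) *\<^sub>R T x))\<^sup>2 \<partial>ball_measure)"
      by (rule integral_nonneg_AE) (simp add: i_def)
  qed (use l in auto)
  finally have in_ball: "(\<integral>x. i x * (conf (norm x) ^ ?N * (w x)\<^sup>2) \<partial>ball_measure)
      \<le> 6 ^ ?N * (2 ^ (?N + 1) * (6 * real ?N) * exp (6 * real ?N)) * (l * E)"
    by (simp add: mult_ac)
  define X Y where "X = (\<integral>x. conf (norm x) ^ ?N * (w x)\<^sup>2 \<partial>ball_measure)"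
    and "Y = (\<integral>x. i x * (conf (norm x) ^ ?N * (w x)\<^sup>2) \<partial>ball_measure)"
  have "3 / 2 * real ?N * X \<le> 3 * real ?N * Y + l * E"
    using ly(2) unfolding X_def Y_def E_def .
  \<comment> \<open>The gradient term is enlarged, as \<open>3 N / 2\<close> is at least 1, so that
    the common factor can be divided out.\<close>
  also have "\<dots> \<le> 3 / 2 * real ?N * (2 * Y + l * E)"
  proof -
    have "1 * (l * E) \<le> 3 / 2 * real ?N * (l * E)"
      using dim l E0 by (intro mult_right_mono) auto
    then show ?thesis by (simp add: algebra_simps)
  qed
  finally have "X \<le> 2 * Y + l * E"
    using N0 by (simp add: mult_le_cancel_left_pos)
  also have "\<dots> \<le> gauss_const ?N * (l * E)"
    using in_ball unfolding Y_def[symmetric] gauss_const_def by (simp add: algebra_simps)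
  finally have "X \<le> gauss_const ?N * l * E" by (simp add: mult.assoc)
  show ?thesis
  proof (rule that[of c])
    show "integrable ball_measure (\<lambda>x. conf (norm x) ^ ?N * (u x - c * rgauss (- (1 / (2 * l))) (norm x))\<^sup>2)"
      using hpw by (simp add: hyp_pair_def w_def \<sigma>_def)
    show "(\<integral>x. conf (norm x) ^ ?N * (u x - c * rgauss (- (1 / (2 * l))) (norm x))\<^sup>2 \<partial>ball_measure)
      \<le> gauss_const ?N * l * (\<integral>x. grad_sq (twist (\<lambda>r. r / l) u G) x \<partial>ball_measure)"
      using \<open>X \<le> gauss_const ?N * l * E\<close> by (simp add: X_def E_def T_def w_def \<sigma>_def)
  qed
qed

text \<open>Positivity of the energy is the spectral gap of hyperbolic space, obtained from
  \<open>hardy\<close> with \<kappa> = 0: the mass is at most 16 times the energy. For the second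
  moment it suffices that \<open>rad\<close> is positive off the origin.\<close>

lemma heis_dom_pos:
  fixes u :: "'a::euclidean_space \<Rightarrow> real"
  assumes dim: "2 \<le> DIM('a)" and u: "u \<in> heis_dom"
  shows "0 < energy u" "0 < second_moment u"
proof -
  note hp = heis_dom_hyp_pair[OF dim u]
  have cN: "0 < conf (norm x) ^ DIM('a)" if "norm x < 1" for x :: 'a
    using that by (intro zero_less_power conf_pos) simp
  have zero: "AE x in ball_measure. u x = 0"
    if int: "integrable ball_measure (\<lambda>x. conf (norm x) ^ DIM('a) * (p (norm x) * (u x)\<^sup>2))"
      and le: "(\<integral>x. conf (norm x) ^ DIM('a) * (p (norm x) * (u x)\<^sup>2) \<partial>ball_measure) \<le> 0"
      and p: "\<And>t. 0 < t \<Longrightarrow> t < 1 \<Longrightarrow> 0 < p t" for p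
  proof -
    have nn: "AE x in ball_measure. 0 \<le> conf (norm x) ^ DIM('a) * (p (norm x) * (u x)\<^sup>2)"
      using AE_ball_measure_nonzero
      by eventually_elim (auto intro!: mult_nonneg_nonneg less_imp_le[OF cN] less_imp_le[OF p])
    have "(\<integral>x. conf (norm x) ^ DIM('a) * (p (norm x) * (u x)\<^sup>2) \<partial>ball_measure) = 0"
      using le integral_nonneg_AE[OF nn] by linarith
    then have "AE x in ball_measure. conf (norm x) ^ DIM('a) * (p (norm x) * (u x)\<^sup>2) = 0"
      using integral_nonneg_eq_0_iff_AE[OF int nn] by simp
    then show ?thesis
      using AE_ball_measure_nonzero
    proof eventually_elim
      fix x assume "conf (norm x) ^ DIM('a) * (p (norm x) * (u x)\<^sup>2) = 0" "x \<noteq> 0 \<and> norm x < 1"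
      then show "u x = 0" using conf_pos[of "norm x"] p[of "norm x"] by auto
    qed
  qed
  show "0 < second_moment u"
  proof (rule ccontr)
    assume neg: "\<not> 0 < second_moment u"
    have "AE x in ball_measure. u x = 0"
    proof (rule zero)
      show "integrable ball_measure (\<lambda>x. conf (norm x) ^ DIM('a) * ((rad (norm x))\<^sup>2 * (u x)\<^sup>2))"
        using hp(1) by (simp add: hyp_pair_def)
      show "(\<integral>x. conf (norm x) ^ DIM('a) * ((rad (norm x))\<^sup>2 * (u x)\<^sup>2) \<partial>ball_measure) \<le> 0"
        using neg unfolding hp(3) by linarith
      show "0 < (rad t)\<^sup>2" if "0 < t" "t < 1" for t
        using rad_pos[OF that] by simp
    qed
    with hp(4) show False ..
  qed
  have tw: "twist (\<lambda>r. 0 * dpsi DIM('a) r) u (weak_grad u) = weak_grad u"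
    by (simp add: twist_def fun_eq_iff)
  have "(\<integral>x. conf (norm x) ^ DIM('a) * (u x)\<^sup>2 \<partial>ball_measure) \<le> 16 * energy u"
    using hardy[OF dim hp(1), of 0] unfolding tw hp(2) by simp
  note le = this
  show "0 < energy u"
  proof (rule ccontr)
    assume "\<not> 0 < energy u"
    with le have "(\<integral>x. conf (norm x) ^ DIM('a) * (u x)\<^sup>2 \<partial>ball_measure) \<le> 0" by linarith
    then have "AE x in ball_measure. u x = 0"
      using hp(1) by (intro zero[of "\<lambda>t. 1"]) (simp_all add: hyp_pair_def)
    with hp(4) show False ..
  qed
qed

section \<open>Extended integrals and the two regimes combined\<close>

lemma hyp_vol_nn_integral_square:
  fixes f :: "'a::euclidean_space \<Rightarrow> real"
  assumes f: "f \<in> borel_measurable ball_measure"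
    and int: "integrable ball_measure (\<lambda>x. conf (norm x) ^ DIM('a) * (f x)\<^sup>2)"
  shows "(\<integral>\<^sup>+x. ennreal (\<bar>f x\<bar>\<^sup>2) \<partial>hyp_vol) = ennreal (\<integral>x. conf (norm x) ^ DIM('a) * (f x)\<^sup>2 \<partial>ball_measure)"
proof -
  have m: "(\<lambda>x. (f x)\<^sup>2) \<in> borel_measurable ball_measure" by (intro borel_measurable_power f)
  have "integrable hyp_vol (\<lambda>x. (f x)\<^sup>2)" using hyp_vol_integral(1)[OF m] int by simp
  then have "(\<integral>\<^sup>+x. ennreal ((f x)\<^sup>2) \<partial>hyp_vol) = ennreal (\<integral>x. (f x)\<^sup>2 \<partial>hyp_vol)"
    by (intro nn_integral_eq_integral) auto
  then show ?thesis using hyp_vol_integral(2)[OF m] by simp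
qed

text \<open>Valid also for infinite integrals, since the square of infinity is infinity. The two
  infima of the theorem therefore agree term by term, including the comparison functions at infinite
  distance.\<close>

lemma hyp_L2_norm_square: "(hyp_L2_norm f)\<^sup>2 = hyp_sq_integral f"
proof (cases "hyp_sq_integral f")
  case (real r)
  then show ?thesis by (simp add: hyp_L2_norm_def ennreal_power)
next
  case top
  then show ?thesis by (simp add: hyp_L2_norm_def)
qed

lemma lambda_u_le_iff:
  assumes "0 < energy u" "0 < second_moment u" "0 < \<beta>"
  shows "second_moment u / energy u \<le> \<beta> ^ 4 \<longleftrightarrow> lambda_u u \<le> \<beta>"
proof -
  have "second_moment u / energy u \<le> \<beta> ^ 4 \<longleftrightarrow> root 4 (second_moment u / energy u) \<le> root 4 (\<beta> ^ 4)"
    by (rule real_root_le_iff[symmetric]) simp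
  also have "root 4 (\<beta> ^ 4) = \<beta>" using assms by (intro real_root_power_cancel) auto
  finally show ?thesis by (simp add: lambda_u_def)
qed

theorem theorem1p9:
  assumes "DIM('a::euclidean_space) \<ge> 2"
  shows "\<exists>\<beta>>0. \<exists>K>0. \<forall>u \<in> (heis_dom :: ('a \<Rightarrow> real) set).
    ereal (deficit u * indicator (class_A \<beta>) u + mod_deficit u * indicator (class_Ac \<beta>) u)
      \<ge> ereal K * enn2ereal (INF (c, lam) \<in> admissible \<beta> u.
          (\<integral>\<^sup>+x. ennreal (\<bar>u x - c * gauss lam x * indicator (class_A \<beta>) u
                              - c * mod_gauss lam x * indicator (class_Ac \<beta>) u\<bar>\<^sup>2) \<partial>hyp_vol))
    \<and> ereal K * enn2ereal (INF (c, lam) \<in> admissible \<beta> u.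
          (\<integral>\<^sup>+x. ennreal (\<bar>u x - c * gauss lam x * indicator (class_A \<beta>) u
                              - c * mod_gauss lam x * indicator (class_Ac \<beta>) u\<bar>\<^sup>2) \<partial>hyp_vol))
      = ereal K * enn2ereal (INF (c, lam) \<in> admissible \<beta> u.
          (hyp_L2_norm (\<lambda>x. u x - (c * gauss lam x * indicator (class_A \<beta>) u
                              + c * mod_gauss lam x * indicator (class_Ac \<beta>) u)))\<^sup>2)"
proof -
  let ?N = "DIM('a)"
  have N0: "0 < real ?N" using assms by simp
  \<comment> \<open>Chosen so that \<open>lambda_u u \<le> \<beta>\<close> gives
    \<open>6 * N * (lambda_u u)\<^sup>2 \<le> 1\<close>, the hypothesis of
    \<open>gauss_distance\<close>.\<close>
  define \<beta> where "\<beta> = 1 / sqrt (6 * real ?N)"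
  have \<beta>: "0 < \<beta>" "6 * real ?N * \<beta>\<^sup>2 = 1"
    using N0 by (auto simp: \<beta>_def power_divide)
  \<comment> \<open>\<open>K1\<close> balances \<open>gauss_const\<close> against the prefactor
    \<open>l / 2\<close> of the deficit. \<open>K2\<close> divides the least prefactor
    \<open>\<beta>\<^sup>2 / 2\<close> above the threshold by the Hardy constant
    \<open>16 * exp (12 / \<beta>\<^sup>2)\<close>.\<close>
  define K1 K2 where "K1 = 1 / (2 * gauss_const ?N)" and "K2 = \<beta>\<^sup>2 / (32 * exp (12 / \<beta>\<^sup>2))"
  define K where "K = min K1 K2"
  have K: "0 < K" "K \<le> K1" "K \<le> K2"
    using \<beta> gauss_const_pos[of ?N] by (auto simp: K_def K1_def K2_def)
  \<comment> \<open>One admissible pair at finite distance bounds the infimum, which confines the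
    extended arithmetic to this step.\<close>
  have bound: "ereal K * enn2ereal (INF (c, lam) \<in> A. I c lam) \<le> ereal D"
    if "(c, lam) \<in> A" "I c lam = ennreal X" "0 \<le> X" "K * X \<le> D" for A :: "(real \<times> real) set" and I c lam X D
  proof -
    have "(INF (c, lam) \<in> A. I c lam) \<le> ennreal X"
      using INF_lower[OF that(1), of "\<lambda>(c, lam). I c lam"] that(2) by simp
    then have "enn2ereal (INF (c, lam) \<in> A. I c lam) \<le> ereal X"
      using that(3) by (simp add: less_eq_ennreal.rep_eq)
    then have "ereal K * enn2ereal (INF (c, lam) \<in> A. I c lam) \<le> ereal K * ereal X"
      using K by (intro ereal_mult_left_mono) auto
    also have "\<dots> \<le> ereal D" using that(4) by simp
    finally show ?thesis .
  qed
  have part1: "ereal K * enn2ereal (INF (c, lam) \<in> admissible \<beta> u.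
          (\<integral>\<^sup>+x. ennreal (\<bar>u x - c * gauss lam x * indicator (class_A \<beta>) u
                              - c * mod_gauss lam x * indicator (class_Ac \<beta>) u\<bar>\<^sup>2) \<partial>hyp_vol))
      \<le> ereal (deficit u * indicator (class_A \<beta>) u + mod_deficit u * indicator (class_Ac \<beta>) u)"
    if u: "u \<in> heis_dom" for u :: "'a \<Rightarrow> real"
  proof -
    note pos = heis_dom_pos[OF assms u]
    note hp = heis_dom_hyp_pair[OF assms u]
    have app: "C1_approximable u (weak_grad u)" using hp(1) by (simp add: hyp_pair_def)
    have um: "u \<in> borel_measurable ball_measure"
      using C1_approximable_sq_int(1)[OF app] by (simp add: sq_int_def)
    define l where "l = (lambda_u u)\<^sup>2"
    have l: "0 < l" using lambda_u_props(1)[OF pos] by (simp add: l_def)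
    have nonneg: "0 \<le> (\<integral>x. conf (norm x) ^ ?N * (f x)\<^sup>2 \<partial>ball_measure)" for f :: "'a \<Rightarrow> real"
    proof (rule integral_nonneg_AE)
      show "AE x in ball_measure. 0 \<le> conf (norm x) ^ ?N * (f x)\<^sup>2"
        using AE_ball_measure_nonzero
        by eventually_elim (simp add: less_imp_le[OF conf_pos])
    qed
    show ?thesis
    proof (cases "u \<in> class_A \<beta>")
      case True
      then have ind: "indicator (class_A \<beta>) u = (1::real)" "indicator (class_Ac \<beta>) u = (0::real)"
        and "u \<notin> class_Ac \<beta>" by (auto simp: class_Ac_def)
      have lam: "lambda_u u \<le> \<beta>"
        using True lambda_u_le_iff[OF pos \<beta>(1)] by (simp add: class_A_def)
      then have "l \<le> \<beta>\<^sup>2" unfolding l_def using lambda_u_props(1)[OF pos] by (intro power_mono) auto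
      then have "6 * real ?N * l \<le> 6 * real ?N * \<beta>\<^sup>2" by (intro mult_left_mono) auto
      then have "6 * real ?N * l \<le> 1" using \<beta> by simp
      from gauss_distance[OF assms hp(1) l this] obtain c where
        c: "integrable ball_measure (\<lambda>x. conf (norm x) ^ ?N * (u x - c * rgauss (- (1 / (2 * l))) (norm x))\<^sup>2)"
        "(\<integral>x. conf (norm x) ^ ?N * (u x - c * rgauss (- (1 / (2 * l))) (norm x))\<^sup>2 \<partial>ball_measure)
          \<le> gauss_const ?N * l * (\<integral>x. grad_sq (twist (\<lambda>r. r / l) u (weak_grad u)) x \<partial>ball_measure)" .
      have gauss_eq: "gauss (lambda_u u) x = rgauss (- (1 / (2 * l))) (norm x)" for x :: 'a
        by (simp add: gauss_def rgauss_def hyp_rho_eq l_def)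
      have m: "(\<lambda>x. u x - c * rgauss (- (1 / (2 * l))) (norm x)) \<in> borel_measurable ball_measure"
        by (intro borel_measurable_diff borel_measurable_times um radial_measurable) measurable
      show ?thesis
      proof (rule bound)
        show "(c, lambda_u u) \<in> admissible \<beta> u"
          using lam lambda_u_props(1)[OF pos] \<open>u \<notin> class_Ac \<beta>\<close> by (simp add: admissible_def)
        show "(\<integral>\<^sup>+x. ennreal (\<bar>u x - c * gauss (lambda_u u) x * indicator (class_A \<beta>) u
            - c * mod_gauss (lambda_u u) x * indicator (class_Ac \<beta>) u\<bar>\<^sup>2) \<partial>hyp_vol)
          = ennreal (\<integral>x. conf (norm x) ^ ?N * (u x - c * rgauss (- (1 / (2 * l))) (norm x))\<^sup>2 \<partial>ball_measure)"
          unfolding ind gauss_eq using hyp_vol_nn_integral_square[OF m c(1)] by simp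
        show "0 \<le> (\<integral>x. conf (norm x) ^ ?N * (u x - c * rgauss (- (1 / (2 * l))) (norm x))\<^sup>2 \<partial>ball_measure)"
          by (rule nonneg)
        have "K * (\<integral>x. conf (norm x) ^ ?N * (u x - c * rgauss (- (1 / (2 * l))) (norm x))\<^sup>2 \<partial>ball_measure)
          \<le> K1 * (gauss_const ?N * l * (\<integral>x. grad_sq (twist (\<lambda>r. r / l) u (weak_grad u)) x \<partial>ball_measure))"
          using K c(2) nonneg by (intro mult_mono) auto
        also have "\<dots> = deficit u"
          using gauss_const_pos[of ?N] unfolding twist_deficit[OF assms u pos] l_def[symmetric] K1_def by simp
        finally show "K * (\<integral>x. conf (norm x) ^ ?N * (u x - c * rgauss (- (1 / (2 * l))) (norm x))\<^sup>2 \<partial>ball_measure)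
          \<le> deficit u * indicator (class_A \<beta>) u + mod_deficit u * indicator (class_Ac \<beta>) u"
          unfolding ind by simp
      qed
    next
      case False
      then have ac: "u \<in> class_Ac \<beta>" using u by (simp add: class_Ac_def)
      have ind: "indicator (class_A \<beta>) u = (0::real)" "indicator (class_Ac \<beta>) u = (1::real)"
        using False ac by auto
      have "\<beta> < lambda_u u"
        using False u lambda_u_le_iff[OF pos \<beta>(1)] by (simp add: class_A_def)
      then have l\<beta>: "\<beta>\<^sup>2 \<le> l" unfolding l_def using \<beta> by (intro power_mono) auto
      define Z where "Z = (\<integral>x. grad_sq (twist (\<lambda>r. dpsi ?N r / l) u (weak_grad u)) x \<partial>ball_measure)"
      have ui: "integrable ball_measure (\<lambda>x. conf (norm x) ^ ?N * (u x)\<^sup>2)"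
        using hp(1) by (simp add: hyp_pair_def)
      have h1: "(\<integral>x. conf (norm x) ^ ?N * (u x)\<^sup>2 \<partial>ball_measure) \<le> 16 * exp (12 * (1 / l)) * Z"
        using hardy[OF assms hp(1), of "1 / l"] l by (simp add: Z_def)
      have "0 \<le> 16 * exp (12 * (1 / l)) * Z" using order_trans[OF nonneg h1] .
      then have Z0: "0 \<le> Z" by (simp add: zero_le_mult_iff)
      \<comment> \<open>The exponential in the Hardy constant decreases in \<open>l\<close>, so the
        threshold yields a bound independent of \<open>u\<close>.\<close>
      have "12 * (1 / l) \<le> 12 / \<beta>\<^sup>2" using l\<beta> \<beta> l by (simp add: frac_le)
      then have "16 * exp (12 * (1 / l)) * Z \<le> 16 * exp (12 / \<beta>\<^sup>2) * Z"
        using Z0 by (intro mult_right_mono mult_left_mono) auto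
      with h1 have h: "(\<integral>x. conf (norm x) ^ ?N * (u x)\<^sup>2 \<partial>ball_measure) \<le> 16 * exp (12 / \<beta>\<^sup>2) * Z"
        by (rule order_trans)
      show ?thesis
      proof (rule bound)
        \<comment> \<open>With coefficient 0 the comparison function drops out and the distance is
          the norm of \<open>u\<close>, so any scale above the threshold serves as witness.\<close>
        show "(0, \<beta> + 1) \<in> admissible \<beta> u"
          using False \<beta> by (simp add: admissible_def)
        show "(\<integral>\<^sup>+x. ennreal (\<bar>u x - 0 * gauss (\<beta> + 1) x * indicator (class_A \<beta>) u
            - 0 * mod_gauss (\<beta> + 1) x * indicator (class_Ac \<beta>) u\<bar>\<^sup>2) \<partial>hyp_vol)
          = ennreal (\<integral>x. conf (norm x) ^ ?N * (u x)\<^sup>2 \<partial>ball_measure)"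
          using hyp_vol_nn_integral_square[OF um ui] by simp
        show "0 \<le> (\<integral>x. conf (norm x) ^ ?N * (u x)\<^sup>2 \<partial>ball_measure)" by (rule nonneg)
        have "K * (\<integral>x. conf (norm x) ^ ?N * (u x)\<^sup>2 \<partial>ball_measure) \<le> K2 * (16 * exp (12 / \<beta>\<^sup>2) * Z)"
          using K h nonneg by (intro mult_mono) auto
        also have "\<dots> = \<beta>\<^sup>2 / 2 * Z" by (simp add: K2_def)
        also have "\<dots> \<le> l / 2 * Z" using l\<beta> Z0 by (intro mult_right_mono) auto
        also have "\<dots> = mod_deficit u"
          unfolding twist_mod_deficit[OF assms u pos] Z_def l_def ..
        finally show "K * (\<integral>x. conf (norm x) ^ ?N * (u x)\<^sup>2 \<partial>ball_measure)
          \<le> deficit u * indicator (class_A \<beta>) u + mod_deficit u * indicator (class_Ac \<beta>) u"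
          unfolding ind by simp
      qed
    qed
  qed
  have part2: "(\<integral>\<^sup>+x. ennreal (\<bar>u x - c * gauss lam x * indicator (class_A \<beta>) u
                              - c * mod_gauss lam x * indicator (class_Ac \<beta>) u\<bar>\<^sup>2) \<partial>hyp_vol)
      = (hyp_L2_norm (\<lambda>x. u x - (c * gauss lam x * indicator (class_A \<beta>) u
                              + c * mod_gauss lam x * indicator (class_Ac \<beta>) u)))\<^sup>2"
    for u :: "'a \<Rightarrow> real" and c lam
    unfolding hyp_L2_norm_square hyp_sq_integral_def by (simp add: diff_diff_eq)
  show ?thesis
  proof (rule exI[of _ \<beta>], rule conjI[OF \<beta>(1)], rule exI[of _ K], rule conjI[OF K(1)], rule ballI, rule conjI)
    fix u :: "'a \<Rightarrow> real" assume u: "u \<in> heis_dom"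
    show "ereal K * enn2ereal (INF (c, lam) \<in> admissible \<beta> u.
          (\<integral>\<^sup>+x. ennreal (\<bar>u x - c * gauss lam x * indicator (class_A \<beta>) u
                              - c * mod_gauss lam x * indicator (class_Ac \<beta>) u\<bar>\<^sup>2) \<partial>hyp_vol))
      \<le> ereal (deficit u * indicator (class_A \<beta>) u + mod_deficit u * indicator (class_Ac \<beta>) u)"
      by (rule part1[OF u])
  qed (simp only: part2)
qed

end
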